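(* Let $m\ge1$ be an integer, let $C>0$ and $\alpha\in(0,1)$ be fixed, and let $n=n_N$, $s=s_N$ (positive integers with $N=sn$) and $\lambda=\lambda_N>0$ depend on $N$, with $h=\lambda^{1/(2m)}$. Suppose that $s\gg N^{(4m-1)/(4m+1)}$ (that is, $s/N^{(4m-1)/(4m+1)}\to\infty$ as $N\to\infty$), that $h\to0$ and $n\to\infty$ as $N\to\infty$, and that $\lim_{N\to\infty}nh$ exists (it may be infinite). Let $\mathcal{B}=\{f\in S^m(\mathbb{I}):J(f)\le C\}$ and $d^*_{N,\lambda}=N^{-2m/(4m+1)}$. Then there exists a positive sequence $\beta_{N,\lambda}$ with $\lim_{N\to\infty}\beta_{N,\lambda}=\infty$ such that $$\limsup_{N\to\infty}\ \inf_{\substack{f\in\mathcal{B}\\ \|f\|_2\ge\beta_{N,\lambda}d^*_{N,\lambda}}}P_f(\phi_{N,\lambda}=1)\ \le\ \alpha.$$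
   Context: Let $\mathbb{I}=[0,1]$ and let $m\ge1$ be an integer. For $k=1,2,\ldots$ put $\varphi_{2k-1}(t)=\sqrt2\cos(2\pi kt)$, $\varphi_{2k}(t)=\sqrt2\sin(2\pi kt)$, $\gamma_{2k-1}=\gamma_{2k}=(2\pi k)^{2m}$. The periodic Sobolev space is $$S^m(\mathbb{I})=\left\{\sum_{\nu=1}^\infty f_\nu\varphi_\nu(\cdot):\ f_\nu\in\mathbb{R},\ \sum_{\nu=1}^\infty f_\nu^2\gamma_\nu<\infty\right\}.$$ For $f,g\in S^m(\mathbb{I})$, $J(f,g)=\int_{\mathbb{I}} f^{(m)}(t)g^{(m)}(t)\,dt$ and $J(f)=J(f,f)$ (so $J(\sum_\nu f_\nu\varphi_\nu)=\sum_\nu f_\nu^2\gamma_\nu$). Also $\|f\|_2=\sqrt{\int_{\mathbb{I}}f(t)^2dt}$. Model: $y_l=f(l/N)+\epsilon_l$, $l=0,1,\ldots,N-1$, where $f\in S^m(\mathbb{I})$ and the $\epsilon_l$ are i.i.d. standard normal. $P_f$ denotes probability when $f$ is the true regression function. Distributed estimator: with $N=s\times n$, for $j=1,\ldots,s$ the $j$th machine receives $(Y_{i,j},t_{i,j})$, $i=1,\ldots,n$, where $Y_{i,j}=y_{is-s+j-1}$ and $t_{i,j}=(is-s+j-1)/N$. For a smoothing parameter $\lambda>0$, the $j$th sub-estimate is $$\widehat f_j=\arg\min_{g\in S^m(\mathbb{I})}\ \frac1{2n}\sum_{i=1}^n\bigl(Y_{i,j}-g(t_{i,j})\bigr)^2+\frac{\lambda}{2}J(g),$$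 and the averaged estimator is $\bar f=\frac1s\sum_{j=1}^s\widehat f_j$. Throughout $h=\lambda^{1/(2m)}$. Test of $H_0:f=0$ versus $H_1:f\in S^m(\mathbb{I})\setminus\{0\}$: $T_{N,\lambda}=\|\bar f\|_2^2$, $\mu_{N,\lambda}=E_{H_0}\{T_{N,\lambda}\}$, $\sigma_{N,\lambda}^2=\mathrm{Var}_{H_0}\{T_{N,\lambda}\}$, $\sigma_{N,\lambda}>0$ (computed when $f=0$), and the test is $$\phi_{N,\lambda}=I\bigl(|T_{N,\lambda}-\mu_{N,\lambda}|\ge z_{1-\alpha/2}\,\sigma_{N,\lambda}\bigr),$$ where $I(\cdot)$ is the indicator function, $1-\alpha$ is the pre-specified significance level and $z_{1-\alpha/2}$ is the $(1-\alpha/2)$-quantile of $N(0,1)$. *)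

theory Defs
  imports "HOL-Probability.Probability"
begin

section \<open>The periodic Sobolev space\<close>

text \<open>Index \<open>\<nu> \<ge> 1\<close>: \<open>\<nu> = 2k - 1\<close> is the cosine and \<open>\<nu> = 2k\<close> the sine of frequency
  \<open>k = (\<nu> + 1) div 2\<close>.\<close>

definition trig_basis :: "nat \<Rightarrow> real \<Rightarrow> real" where
  "trig_basis \<nu> t =
     sqrt 2 * (if odd \<nu> then cos (2 * pi * real ((\<nu> + 1) div 2) * t)
               else sin (2 * pi * real ((\<nu> + 1) div 2) * t))"

definition trig_eigenvalue :: "nat \<Rightarrow> nat \<Rightarrow> real" where
  "trig_eigenvalue m \<nu> = (2 * pi * real ((\<nu> + 1) div 2)) ^ (2 * m)"

text \<open>A function on \<open>[0,1]\<close> in the space is represented by its 1-periodic extension, i.e. by the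
  series itself on the whole real line. For \<open>m \<ge> 1\<close> the series converges absolutely and uniformly.
  All sums start at \<open>\<nu> = 1\<close>.\<close>

definition sobolev :: "nat \<Rightarrow> (real \<Rightarrow> real) set" where
  "sobolev m =
     {(\<lambda>t. \<Sum>\<nu>. c (Suc \<nu>) * trig_basis (Suc \<nu>) t) | c :: nat \<Rightarrow> real.
        summable (\<lambda>\<nu>. (c (Suc \<nu>))\<^sup>2 * trig_eigenvalue m (Suc \<nu>))}"

text \<open>For \<open>f\<close> in the space, \<open>f\<^sup>(\<^sup>m\<^sup>-\<^sup>1\<^sup>)\<close> is in general only absolutely continuous, so the \<open>m\<close>-th
  derivative is understood in the Sobolev sense: \<open>ac_deriv f g\<close> says that \<open>f\<close> is absolutely continuous
  on \<open>[0,1]\<close> with derivative \<open>g\<close>, and the \<open>m\<close>-fold relational power iterates this. The resulting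
  \<open>m\<close>-th derivative is unique up to a null set of \<open>[0,1]\<close>.\<close>

definition ac_deriv :: "(real \<Rightarrow> real) \<Rightarrow> (real \<Rightarrow> real) \<Rightarrow> bool" where
  "ac_deriv f g \<longleftrightarrow>
     set_integrable lborel {0..1} g \<and>
     (\<forall>t\<in>{0..1}. f t = f 0 + (LINT u:{0..t}|lborel. g u))"

definition nth_deriv :: "nat \<Rightarrow> (real \<Rightarrow> real) \<Rightarrow> real \<Rightarrow> real" where
  "nth_deriv m f = (SOME g. (ac_deriv ^^ m) f g)"

definition sobolev_form :: "nat \<Rightarrow> (real \<Rightarrow> real) \<Rightarrow> (real \<Rightarrow> real) \<Rightarrow> real" where
  "sobolev_form m f g = (LINT t:{0..1}|lborel. nth_deriv m f t * nth_deriv m g t)"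

definition L2norm :: "(real \<Rightarrow> real) \<Rightarrow> real" where
  "L2norm f = sqrt (LINT t:{0..1}|lborel. (f t)\<^sup>2)"

section \<open>The distributed estimator\<close>

text \<open>The data are \<open>y l\<close> for \<open>l < s * n\<close>. Machine \<open>j \<in> {1..s}\<close> holds the observations with index
  \<open>obs_index s i j\<close>, \<open>i \<in> {1..n}\<close>; for \<open>i, j \<ge> 1\<close> the subtractions do not truncate.\<close>

definition obs_index :: "nat \<Rightarrow> nat \<Rightarrow> nat \<Rightarrow> nat" where
  "obs_index s i j = i * s - s + j - 1"

definition penalized_loss ::
  "nat \<Rightarrow> nat \<Rightarrow> nat \<Rightarrow> real \<Rightarrow> (nat \<Rightarrow> real) \<Rightarrow> nat \<Rightarrow> (real \<Rightarrow> real) \<Rightarrow> real" where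
  "penalized_loss m s n lam y j g =
     1 / (2 * real n) *
       (\<Sum>i = 1..n. (y (obs_index s i j) - g (real (obs_index s i j) / real (s * n)))\<^sup>2)
     + lam / 2 * sobolev_form m g g"

definition sub_estimate ::
  "nat \<Rightarrow> nat \<Rightarrow> nat \<Rightarrow> real \<Rightarrow> (nat \<Rightarrow> real) \<Rightarrow> nat \<Rightarrow> real \<Rightarrow> real" where
  "sub_estimate m s n lam y j = arg_min_on (penalized_loss m s n lam y j) (sobolev m)"

definition avg_estimate ::
  "nat \<Rightarrow> nat \<Rightarrow> nat \<Rightarrow> real \<Rightarrow> (nat \<Rightarrow> real) \<Rightarrow> real \<Rightarrow> real" where
  "avg_estimate m s n lam y = (\<lambda>t. 1 / real s * (\<Sum>j = 1..s. sub_estimate m s n lam y j t))"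

definition test_stat :: "nat \<Rightarrow> nat \<Rightarrow> nat \<Rightarrow> real \<Rightarrow> (nat \<Rightarrow> real) \<Rightarrow> real" where
  "test_stat m s n lam y = (L2norm (avg_estimate m s n lam y))\<^sup>2"

section \<open>The model and the test\<close>

definition observations ::
  "nat \<Rightarrow> (nat \<Rightarrow> 'a \<Rightarrow> real) \<Rightarrow> (real \<Rightarrow> real) \<Rightarrow> 'a \<Rightarrow> nat \<Rightarrow> real" where
  "observations N e f \<omega> = (\<lambda>l. f (real l / real N) + e l \<omega>)"

definition iid_std_normal :: "'a measure \<Rightarrow> (nat \<Rightarrow> 'a \<Rightarrow> real) \<Rightarrow> nat \<Rightarrow> bool" where
  "iid_std_normal M e N \<longleftrightarrow>
     prob_space.indep_vars M (\<lambda>_. borel) e {..<N} \<and>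
     (\<forall>l<N. distributed M lborel (e l) (\<lambda>x. ennreal (std_normal_density x)))"

definition quantile :: "real measure \<Rightarrow> real \<Rightarrow> real" where
  "quantile D p = Inf {x. p \<le> cdf D x}"

text \<open>Mean and standard deviation of the test statistic under \<open>f = 0\<close>.\<close>

definition null_mean ::
  "'a measure \<Rightarrow> (nat \<Rightarrow> 'a \<Rightarrow> real) \<Rightarrow> nat \<Rightarrow> nat \<Rightarrow> nat \<Rightarrow> real \<Rightarrow> real" where
  "null_mean M e m s n lam =
     prob_space.expectation M (\<lambda>\<omega>. test_stat m s n lam (observations (s * n) e (\<lambda>_. 0) \<omega>))"

definition null_sd ::
  "'a measure \<Rightarrow> (nat \<Rightarrow> 'a \<Rightarrow> real) \<Rightarrow> nat \<Rightarrow> nat \<Rightarrow> nat \<Rightarrow> real \<Rightarrow> real" where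
  "null_sd M e m s n lam =
     sqrt (prob_space.variance M
       (\<lambda>\<omega>. test_stat m s n lam (observations (s * n) e (\<lambda>_. 0) \<omega>)))"

text \<open>The test as a 0/1-valued function of the data \<open>y\<close>; \<open>M\<close> and \<open>e\<close> enter only through the null
  mean and standard deviation.\<close>

definition wald_test ::
  "'a measure \<Rightarrow> (nat \<Rightarrow> 'a \<Rightarrow> real) \<Rightarrow> nat \<Rightarrow> nat \<Rightarrow> nat \<Rightarrow> real \<Rightarrow> real \<Rightarrow> (nat \<Rightarrow> real) \<Rightarrow> nat" where
  "wald_test M e m s n lam \<alpha> y =
     of_bool (\<bar>test_stat m s n lam y - null_mean M e m s n lam\<bar>
       \<ge> quantile std_normal_distribution (1 - \<alpha> / 2) * null_sd M e m s n lam)"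

definition rejection_prob ::
  "'a measure \<Rightarrow> (nat \<Rightarrow> 'a \<Rightarrow> real) \<Rightarrow> nat \<Rightarrow> nat \<Rightarrow> nat \<Rightarrow> real \<Rightarrow> real \<Rightarrow> (real \<Rightarrow> real) \<Rightarrow> real" where
  "rejection_prob M e m s n lam \<alpha> f =
     measure M {\<omega> \<in> space M. wald_test M e m s n lam \<alpha> (observations (s * n) e f \<omega>) = 1}"

definition sobolev_ball :: "nat \<Rightarrow> real \<Rightarrow> (real \<Rightarrow> real) set" where
  "sobolev_ball m C = {f \<in> sobolev m. sobolev_form m f f \<le> C}"

definition separation_rate :: "nat \<Rightarrow> nat \<Rightarrow> real" where
  "separation_rate m N = real N powr (- (2 * real m) / (4 * real m + 1))"

end

theory Submission
  imports Defs
begin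

text \<open>The bound is attained on one explicit sequence of alternatives, each a single frequency \<open>r\<close>.
Such a function with \<open>J = C\<close> has norm \<open>sqrt C / (2 * pi * r) ^ m\<close>, which is large compared with the
rate \<open>N powr (- 2 * m / (4 * m + 1))\<close> as soon as \<open>r\<close> is small compared with
\<open>R = N powr (2 / (4 * m + 1))\<close>. The assumption on \<open>s\<close> says precisely that a machine sees only
\<open>n << R\<close> points, so there is room for a frequency with \<open>n << r << R\<close>. A machine cannot tell \<open>r\<close> from
its aliases modulo \<open>n\<close>, and the roughness penalty makes it explain the data mostly by low aliases.
The grids of the machines are shifted against each other, so these spurious low frequency parts
cancel in the average, and only the fraction of the signal that was fitted at \<open>r\<close> itself survives,
which is at most \<open>(n / r) ^ (2 * m)\<close>. The test statistic then behaves as under the null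
hypothesis, where the test rejects with probability tending to \<open>\<alpha>\<close>.

The penalty becomes a weighted sum of squared Fourier coefficients in
\<open>sobolev_form_trig_series\<close>, where the existence of the \<open>m\<close>-th derivative is a
Riesz-Fischer argument and the choice made by \<open>nth_deriv\<close> is harmless because weak derivatives are
unique almost everywhere. The normal equations of each machine can then be solved in closed form:
the fit multiplies the empirical Fourier coefficients by weights \<open>filter_weight\<close>
that are the same for all machines (\<open>sub_estimate_eq\<close>). Averaging therefore just pools the data,
and \<open>test_stat_diagonal\<close> writes the statistic as a quadratic form that is diagonal in an
orthonormal basis of the data space, with eigenvalues \<open>noise_weight\<close>.

Under the null hypothesis this is a weighted sum of independent chi-square variables
(\<open>distr_quadratic_orthonormal\<close>), asymptotically normal since no weight dominates. All weights are
at most \<open>1 / N\<close>, and about \<open>K\<close> of them are of this order, where the effective dimension \<open>K\<close> is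
the smaller of \<open>n\<close> and \<open>1 / (2 * pi * h)\<close>; thus \<open>K\<close> tends to infinity and the standard
deviation is at least of order \<open>sqrt K / N\<close>. The signal at frequency \<open>r\<close> shifts the mean of the
statistic by at most \<open>(K / r) ^ (2 * m)\<close> times its squared norm. For \<open>r\<close> close to
\<open>R * (n / R) powr (1 / 4)\<close> the shift is negligible against the standard deviation
(\<open>shift_to_noise_bound\<close>), so the perturbed statistic has the same normal limit
(\<open>char_normalized_spike_stat\<close>, \<open>two_sided_rejection_limsup\<close>).\<close>

section \<open>Square-integrable limits and orthonormal series\<close>

lemma square_integrable_imp_mult:
  fixes a b :: "'a \<Rightarrow> real"
  assumes [measurable]: "a \<in> borel_measurable M" "b \<in> borel_measurable M"
    and "integrable M (\<lambda>x. (a x)\<^sup>2)" "integrable M (\<lambda>x. (b x)\<^sup>2)"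
  shows "integrable M (\<lambda>x. a x * b x)"
proof (rule Bochner_Integration.integrable_bound)
  show "integrable M (\<lambda>x. (a x)\<^sup>2 + (b x)\<^sup>2)" using assms by simp
  have "norm (a x * b x) \<le> norm ((a x)\<^sup>2 + (b x)\<^sup>2)" for x
  proof -
    have "0 \<le> \<bar>a x\<bar> * \<bar>b x\<bar>" "2 * (\<bar>a x\<bar> * \<bar>b x\<bar>) \<le> (a x)\<^sup>2 + (b x)\<^sup>2"
      using sum_squares_bound[of "\<bar>a x\<bar>" "\<bar>b x\<bar>"] by (simp_all add: mult.assoc)
    then show ?thesis unfolding real_norm_def abs_mult by linarith
  qed
  then show "AE x in M. norm (a x * b x) \<le> norm ((a x)\<^sup>2 + (b x)\<^sup>2)" by simp
qed simp

lemma cauchy_schwarz_integral: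
  fixes a b :: "'a \<Rightarrow> real"
  assumes [measurable]: "a \<in> borel_measurable M" "b \<in> borel_measurable M"
    and a: "integrable M (\<lambda>x. (a x)\<^sup>2)" and b: "integrable M (\<lambda>x. (b x)\<^sup>2)"
  shows "(\<integral>x. a x * b x \<partial>M)\<^sup>2 \<le> (\<integral>x. (a x)\<^sup>2 \<partial>M) * (\<integral>x. (b x)\<^sup>2 \<partial>M)"
proof -
  define A B c where "A = (\<integral>x. (a x)\<^sup>2 \<partial>M)" and "B = (\<integral>x. (b x)\<^sup>2 \<partial>M)" and "c = (\<integral>x. a x * b x \<partial>M)"
  have ab: "integrable M (\<lambda>x. a x * b x)" by (intro square_integrable_imp_mult assms)
  have quad: "0 \<le> A + 2 * t * c + t\<^sup>2 * B" for t
  proof -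
    have "0 \<le> (\<integral>x. (a x + t * b x)\<^sup>2 \<partial>M)" by simp
    also have "\<dots> = (\<integral>x. (a x)\<^sup>2 + 2 * t * (a x * b x) + t\<^sup>2 * (b x)\<^sup>2 \<partial>M)"
      by (simp add: power2_eq_square algebra_simps)
    also have "\<dots> = A + 2 * t * c + t\<^sup>2 * B"
      using a b ab unfolding A_def B_def c_def by simp
    finally show ?thesis .
  qed
  have "B \<ge> 0" unfolding B_def by simp
  show ?thesis
  proof (cases "B = 0")
    case True
    have "c = 0"
    proof (rule ccontr)
      assume "c \<noteq> 0"
      then have "2 * (- (A + 1) / (2 * c)) * c = - A - 1" by (simp add: field_simps)
      with quad[of "- (A + 1) / (2 * c)"] True show False by simp
    qed
    then show ?thesis using True unfolding A_def B_def c_def by simp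
  next
    case False
    with \<open>B \<ge> 0\<close> have "B > 0" by simp
    with quad[of "- c / B"] have "c\<^sup>2 \<le> A * B"
      by (simp add: field_simps power2_eq_square)
    then show ?thesis unfolding A_def B_def c_def .
  qed
qed

lemma (in prob_space) expectation_abs_le_sqrt:
  fixes X :: "'a \<Rightarrow> real"
  assumes [measurable]: "X \<in> borel_measurable M" and X: "integrable M (\<lambda>x. (X x)\<^sup>2)"
  shows "expectation (\<lambda>x. \<bar>X x\<bar>) \<le> sqrt (expectation (\<lambda>x. (X x)\<^sup>2))"
  using cauchy_schwarz_integral[of "\<lambda>x. \<bar>X x\<bar>" M "\<lambda>_. 1"] X by (simp add: prob_space real_le_rsqrt)

text \<open>Cauchy in mean square implies Cauchy in mean, so a subsequence converges almost everywhere;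
Fatou's lemma along this subsequence upgrades the pointwise limit to a limit in mean square.\<close>

lemma (in prob_space) L2_complete:
  fixes S :: "nat \<Rightarrow> 'a \<Rightarrow> real"
  assumes meas[measurable]: "\<And>n. S n \<in> borel_measurable M"
    and sq: "\<And>n. integrable M (\<lambda>x. (S n x)\<^sup>2)"
    and cauchy: "\<And>i j. i \<le> j \<Longrightarrow> (\<integral>x. (S i x - S j x)\<^sup>2 \<partial>M) \<le> d i"
    and d: "d \<longlonglongrightarrow> 0"
  obtains g where "g \<in> borel_measurable M" "integrable M (\<lambda>x. (g x)\<^sup>2)"
    "(\<lambda>n. \<integral>x. (S n x - g x)\<^sup>2 \<partial>M) \<longlonglongrightarrow> 0"
proof -
  have d_nonneg: "0 \<le> d n" for n using cauchy[of n n] by simp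
  have int: "integrable M (S n)" for n by (rule square_integrable_imp_integrable[OF meas sq])
  have dsq: "integrable M (\<lambda>x. (S i x - S j x)\<^sup>2)" for i j
    using sq[of i] sq[of j] square_integrable_imp_mult[OF meas meas sq sq, of i j]
    by (simp add: power2_diff mult.assoc)
  have L1: "(\<integral>x. norm (S i x - S j x) \<partial>M) \<le> sqrt (d (min i j))" for i j
  proof -
    have "(\<integral>x. norm (S i x - S j x) \<partial>M) \<le> sqrt (\<integral>x. (S i x - S j x)\<^sup>2 \<partial>M)"
      using expectation_abs_le_sqrt[of "\<lambda>x. S i x - S j x"] dsq by simp
    also have "(\<integral>x. (S i x - S j x)\<^sup>2 \<partial>M) \<le> d (min i j)"
      using cauchy[of i j] cauchy[of j i] by (cases "i \<le> j") (auto simp: min_def power2_commute)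
    finally show ?thesis by simp
  qed
  have "\<exists>N. \<forall>i\<ge>N. \<forall>j\<ge>N. (\<integral>x. norm (S i x - S j x) \<partial>M) < e" if "e > 0" for e
  proof -
    have "(\<lambda>n. sqrt (d n)) \<longlonglongrightarrow> 0" using tendsto_real_sqrt[OF d] by simp
    then have "\<forall>\<^sub>F n in sequentially. sqrt (d n) < e"
      using that by (rule order_tendstoD(2))
    then obtain N where N: "\<And>n. n \<ge> N \<Longrightarrow> sqrt (d n) < e"
      unfolding eventually_sequentially by blast
    show ?thesis
    proof (intro exI[of _ N] allI impI)
      fix i j assume "i \<ge> N" "j \<ge> N"
      then have "sqrt (d (min i j)) < e" by (intro N) simp
      with L1[of i j] show "(\<integral>x. norm (S i x - S j x) \<partial>M) < e" by linarith
    qed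
  qed
  then obtain r where r: "strict_mono r" and ae: "AE x in M. Cauchy (\<lambda>i. S (r i) x)"
    using cauchy_L1_AE_cauchy_subseq[of M S] int by blast
  define g where "g = (\<lambda>x. lim (\<lambda>i. S (r i) x))"
  have gm[measurable]: "g \<in> borel_measurable M" unfolding g_def by measurable
  have lim: "AE x in M. (\<lambda>i. S (r i) x) \<longlonglongrightarrow> g x"
    using ae by eventually_elim (simp add: g_def Cauchy_convergent_iff convergent_LIMSEQ_iff)
  have nn: "(\<integral>\<^sup>+x. ennreal ((S n x - g x)\<^sup>2) \<partial>M) \<le> ennreal (d n)" for n
  proof -
    have "(\<integral>\<^sup>+x. ennreal ((S n x - g x)\<^sup>2) \<partial>M)
        = (\<integral>\<^sup>+x. liminf (\<lambda>i. ennreal ((S n x - S (r i) x)\<^sup>2)) \<partial>M)"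
    proof (rule nn_integral_cong_AE)
      show "AE x in M. ennreal ((S n x - g x)\<^sup>2) = liminf (\<lambda>i. ennreal ((S n x - S (r i) x)\<^sup>2))"
        using lim
      proof eventually_elim
        case (elim x)
        then have "(\<lambda>i. ennreal ((S n x - S (r i) x)\<^sup>2)) \<longlonglongrightarrow> ennreal ((S n x - g x)\<^sup>2)"
          by (intro tendsto_intros)
        then show ?case by (rule lim_imp_Liminf[OF sequentially_bot, symmetric])
      qed
    qed
    also have "\<dots> \<le> liminf (\<lambda>i. \<integral>\<^sup>+x. ennreal ((S n x - S (r i) x)\<^sup>2) \<partial>M)"
      by (rule nn_integral_liminf) simp
    also have "\<dots> \<le> liminf (\<lambda>i::nat. ennreal (d n))"
    proof (rule Liminf_mono)
      have "\<forall>\<^sub>F i in sequentially. n \<le> r i"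
        using filterlim_subseq[OF r] by (simp add: filterlim_at_top)
      then show "\<forall>\<^sub>F i in sequentially. (\<integral>\<^sup>+x. ennreal ((S n x - S (r i) x)\<^sup>2) \<partial>M) \<le> ennreal (d n)"
      proof eventually_elim
        case (elim i)
        then show ?case using cauchy[of n "r i"] dsq[of n "r i"]
          by (subst nn_integral_eq_integral) (auto simp: ennreal_leI)
      qed
    qed
    also have "\<dots> = ennreal (d n)" by (simp add: Liminf_const)
    finally show ?thesis .
  qed
  have di: "integrable M (\<lambda>x. (S n x - g x)\<^sup>2)" for n
  proof (rule integrableI_bounded)
    show "(\<integral>\<^sup>+ x. ennreal (norm ((S n x - g x)\<^sup>2)) \<partial>M) < \<infinity>"
      using nn[of n] by (simp add: le_less_trans)
  qed simp
  have "integrable M (\<lambda>x. (g x)\<^sup>2)"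
  proof (rule Bochner_Integration.integrable_bound)
    show "integrable M (\<lambda>x. 2 * (S 0 x)\<^sup>2 + 2 * (S 0 x - g x)\<^sup>2)" using sq di by simp
    have "(g x)\<^sup>2 \<le> 2 * (S 0 x)\<^sup>2 + 2 * (S 0 x - g x)\<^sup>2" for x
    proof -
      have "2 * (S 0 x)\<^sup>2 + 2 * (S 0 x - g x)\<^sup>2 - (g x)\<^sup>2 = (2 * S 0 x - g x)\<^sup>2"
        by (simp add: power2_eq_square algebra_simps)
      then show ?thesis by (smt (verit) zero_le_power2)
    qed
    then show "AE x in M. norm ((g x)\<^sup>2) \<le> norm (2 * (S 0 x)\<^sup>2 + 2 * (S 0 x - g x)\<^sup>2)" by simp
  qed simp
  moreover have "(\<lambda>n. \<integral>x. (S n x - g x)\<^sup>2 \<partial>M) \<longlonglongrightarrow> 0"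
  proof (rule tendsto_sandwich[OF _ _ tendsto_const d])
    show "\<forall>\<^sub>F n in sequentially. (\<integral>x. (S n x - g x)\<^sup>2 \<partial>M) \<le> d n"
      using nn di d_nonneg by (auto simp: nn_integral_eq_integral ennreal_le_iff intro!: always_eventually)
  qed simp
  ultimately show ?thesis using gm that by blast
qed

text \<open>The sum \<open>g\<close> is the mean square limit of the partial sums. Inner products pass to the limit, which
is the last clause; tested against the \<open>\<psi> j\<close> and then against \<open>g\<close> itself, it gives the
coefficients and Parseval's identity. Tested against indicators of intervals it will identify \<open>g\<close>
as a weak derivative.\<close>

lemma (in prob_space) riesz_fischer:
  fixes \<psi> :: "nat \<Rightarrow> 'a \<Rightarrow> real" and d :: "nat \<Rightarrow> real"
  assumes meas[measurable]: "\<And>i. \<psi> i \<in> borel_measurable M"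
    and sq: "\<And>i. integrable M (\<lambda>x. (\<psi> i x)\<^sup>2)"
    and on: "\<And>i j. (\<integral>x. \<psi> i x * \<psi> j x \<partial>M) = of_bool (i = j)"
    and d: "summable (\<lambda>i. (d i)\<^sup>2)"
  obtains g where "g \<in> borel_measurable M" "integrable M (\<lambda>x. (g x)\<^sup>2)"
    "(\<integral>x. (g x)\<^sup>2 \<partial>M) = (\<Sum>i. (d i)\<^sup>2)"
    "\<And>u. u \<in> borel_measurable M \<Longrightarrow> integrable M (\<lambda>x. (u x)\<^sup>2) \<Longrightarrow>
       (\<lambda>i. d i * (\<integral>x. \<psi> i x * u x \<partial>M)) sums (\<integral>x. g x * u x \<partial>M)"
proof -
  have prod: "integrable M (\<lambda>x. \<psi> i x * \<psi> j x)" for i j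
    by (intro square_integrable_imp_mult meas sq)
  define S where "S = (\<lambda>n x. \<Sum>i<n. d i * \<psi> i x)"
  have Sm[measurable]: "S n \<in> borel_measurable M" for n unfolding S_def by measurable
  have pyth: "integrable M (\<lambda>x. (\<Sum>i\<in>I. d i * \<psi> i x)\<^sup>2) \<and>
      (\<integral>x. (\<Sum>i\<in>I. d i * \<psi> i x)\<^sup>2 \<partial>M) = (\<Sum>i\<in>I. (d i)\<^sup>2)" if "finite I" for I
  proof -
    have eq: "(\<Sum>i\<in>I. d i * \<psi> i x)\<^sup>2 = (\<Sum>i\<in>I. \<Sum>j\<in>I. d i * d j * (\<psi> i x * \<psi> j x))" for x
      by (simp add: power2_eq_square sum_product algebra_simps)
    have "(\<integral>x. (\<Sum>i\<in>I. d i * \<psi> i x)\<^sup>2 \<partial>M) = (\<Sum>i\<in>I. \<Sum>j\<in>I. d i * d j * of_bool (i = j))"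
      unfolding eq using prod by (simp add: on)
    also have "\<dots> = (\<Sum>i\<in>I. (d i)\<^sup>2)"
      using that by (simp add: of_bool_def if_distrib[of "\<lambda>z. _ * z"] sum.delta power2_eq_square cong: if_cong)
    finally show ?thesis unfolding eq using prod by simp
  qed
  define t where "t = (\<lambda>n. (\<Sum>i. (d i)\<^sup>2) - (\<Sum>i<n. (d i)\<^sup>2))"
  have t0: "t \<longlonglongrightarrow> 0"
    unfolding t_def using summable_LIMSEQ[OF d] by (auto intro!: tendsto_eq_intros)
  have Ssq: "integrable M (\<lambda>x. (S n x)\<^sup>2)" for n
    unfolding S_def using pyth[of "{..<n}"] by simp
  have Sc: "(\<integral>x. (S i x - S j x)\<^sup>2 \<partial>M) \<le> t i" if "i \<le> j" for i j
  proof -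
    have "S j x - S i x = (\<Sum>l\<in>{i..<j}. d l * \<psi> l x)" for x
      unfolding S_def using sum_diff_nat_ivl[of 0 i j "\<lambda>l. d l * \<psi> l x"] that
      by (simp add: atLeast0LessThan)
    then have "(\<integral>x. (S i x - S j x)\<^sup>2 \<partial>M) = (\<Sum>l\<in>{i..<j}. (d l)\<^sup>2)"
      using pyth[of "{i..<j}"] by (simp add: power2_commute[of "S i _"])
    also have "\<dots> = (\<Sum>l<j. (d l)\<^sup>2) - (\<Sum>l<i. (d l)\<^sup>2)"
      using sum_diff_nat_ivl[of 0 i j "\<lambda>l. (d l)\<^sup>2"] that by (simp add: atLeast0LessThan)
    also have "\<dots> \<le> t i" unfolding t_def using sum_le_suminf[OF d, of "{..<j}"] by simp
    finally show ?thesis .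
  qed
  obtain g where gm[measurable]: "g \<in> borel_measurable M" and gsq: "integrable M (\<lambda>x. (g x)\<^sup>2)"
    and conv: "(\<lambda>n. \<integral>x. (S n x - g x)\<^sup>2 \<partial>M) \<longlonglongrightarrow> 0"
    using L2_complete[OF Sm Ssq Sc t0] by blast
  have sums: "(\<lambda>i. d i * (\<integral>x. \<psi> i x * u x \<partial>M)) sums (\<integral>x. g x * u x \<partial>M)"
    if um[measurable]: "u \<in> borel_measurable M" and usq: "integrable M (\<lambda>x. (u x)\<^sup>2)" for u
  proof -
    have dsq: "integrable M (\<lambda>x. (S n x - g x)\<^sup>2)" for n
      using Ssq gsq square_integrable_imp_mult[OF Sm gm Ssq gsq, of n]
      by (simp add: power2_diff mult.assoc)
    have pu: "integrable M (\<lambda>x. \<psi> i x * u x)" for i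
      by (intro square_integrable_imp_mult meas um sq usq)
    have gu: "integrable M (\<lambda>x. g x * u x)" by (intro square_integrable_imp_mult gm um gsq usq)
    have part: "(\<Sum>i<n. d i * (\<integral>x. \<psi> i x * u x \<partial>M)) - (\<integral>x. g x * u x \<partial>M)
        = (\<integral>x. (S n x - g x) * u x \<partial>M)" for n
    proof -
      have "(S n x - g x) * u x = (\<Sum>i<n. d i * (\<psi> i x * u x)) - g x * u x" for x
        unfolding S_def by (simp add: algebra_simps sum_distrib_left)
      then show ?thesis using pu gu by simp
    qed
    have bound: "\<bar>\<integral>x. (S n x - g x) * u x \<partial>M\<bar> \<le> sqrt ((\<integral>x. (S n x - g x)\<^sup>2 \<partial>M) * (\<integral>x. (u x)\<^sup>2 \<partial>M))" for n
    proof -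
      have "(\<integral>x. (S n x - g x) * u x \<partial>M)\<^sup>2 \<le> (\<integral>x. (S n x - g x)\<^sup>2 \<partial>M) * (\<integral>x. (u x)\<^sup>2 \<partial>M)"
        by (rule cauchy_schwarz_integral) (simp_all add: dsq usq)
      then show ?thesis using real_sqrt_le_mono by fastforce
    qed
    have "(\<lambda>n. sqrt ((\<integral>x. (S n x - g x)\<^sup>2 \<partial>M) * (\<integral>x. (u x)\<^sup>2 \<partial>M))) \<longlonglongrightarrow> sqrt (0 * (\<integral>x. (u x)\<^sup>2 \<partial>M))"
      by (intro tendsto_intros conv)
    then have lim: "(\<lambda>n. sqrt ((\<integral>x. (S n x - g x)\<^sup>2 \<partial>M) * (\<integral>x. (u x)\<^sup>2 \<partial>M))) \<longlonglongrightarrow> 0"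
      by simp
    have "(\<lambda>n. \<integral>x. (S n x - g x) * u x \<partial>M) \<longlonglongrightarrow> 0"
      by (rule Lim_null_comparison[OF _ lim]) (simp only: real_norm_def bound eventually_True)
    then show ?thesis unfolding sums_def part[symmetric] by (simp add: LIM_zero_iff)
  qed
  have coef: "(\<integral>x. g x * \<psi> j x \<partial>M) = d j" for j
  proof -
    have "(\<lambda>i. d i * of_bool (i = j)) sums (\<integral>x. g x * \<psi> j x \<partial>M)"
      using sums[OF meas sq, of j] by (simp add: on)
    moreover have "(\<lambda>i. d i * of_bool (i = j)) sums d j"
      using sums_single[of j d] by (simp add: of_bool_def if_distrib cong: if_cong)
    ultimately show ?thesis by (rule sums_unique2)
  qed
  have "(\<lambda>i. (d i)\<^sup>2) sums (\<integral>x. (g x)\<^sup>2 \<partial>M)"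
    using sums[OF gm gsq] coef by (simp add: mult.commute power2_eq_square)
  then show ?thesis by (intro that[OF gm gsq _ sums]) (simp_all add: sums_iff)
qed

section \<open>The trigonometric basis and its derivatives\<close>

text \<open>Integrals over \<open>[0,1]\<close> are taken with respect to a probability measure, so that the results of the
previous section apply to them.\<close>

definition unit_interval_measure :: "real measure" where
  "unit_interval_measure = restrict_space lborel {0..1}"

abbreviation "\<U> \<equiv> unit_interval_measure"

lemma set_integral_unit_interval:
  fixes f :: "real \<Rightarrow> real"
  shows "(LINT t:{0..1}|lborel. f t) = integral\<^sup>L \<U> f"
  by (simp add: set_lebesgue_integral_def unit_interval_measure_def integral_restrict_space)

lemma set_integrable_unit_interval:
  fixes f :: "real \<Rightarrow> real"
  shows "set_integrable lborel {0..1} f \<longleftrightarrow> integrable \<U> f"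
  by (simp add: set_integrable_def unit_interval_measure_def integrable_restrict_space)

lemma space_unit_interval[simp]: "space \<U> = {0..1}"
  by (simp add: unit_interval_measure_def space_restrict_space)

lemma measurable_unit_interval[measurable_dest]:
  "f \<in> borel_measurable borel \<Longrightarrow> f \<in> borel_measurable \<U>"
  by (simp add: unit_interval_measure_def measurable_restrict_space1)

interpretation unit_interval: prob_space \<U>
proof
  show "emeasure \<U> (space \<U>) = 1"
    by (simp add: unit_interval_measure_def space_restrict_space emeasure_restrict_space)
qed

lemma set_integral_subinterval:
  fixes f :: "real \<Rightarrow> real"
  assumes "t \<in> {0..1}"
  shows "(LINT u:{0..t}|lborel. f u) = (\<integral>u. f u * indicator {0..t} u \<partial>\<U>)"
proof -
  have "indicator {0..t} u *\<^sub>R f u = indicator {0..1} u *\<^sub>R (f u * indicator {0..t} u)" for u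
    using assms by (auto simp: indicator_def)
  then show ?thesis
    unfolding set_lebesgue_integral_def unit_interval_measure_def
    by (subst integral_restrict_space) (auto intro!: Bochner_Integration.integral_cong)
qed

abbreviation freq :: "nat \<Rightarrow> nat" where "freq \<nu> \<equiv> (\<nu> + 1) div 2"

text \<open>A sine is a cosine delayed by a quarter turn; with this phase one formula serves both parities.\<close>

definition phase :: "nat \<Rightarrow> real" where
  "phase \<nu> = (if odd \<nu> then 0 else - pi / 2)"

lemma trig_basis_phase: "trig_basis \<nu> t = sqrt 2 * cos (2 * pi * real (freq \<nu>) * t + phase \<nu>)"
  by (simp add: trig_basis_def phase_def cos_add)

text \<open>The \<open>j\<close>-th derivative of \<open>trig_basis \<nu>\<close>: each differentiation multiplies by the angular
frequency and advances the phase by a quarter turn.\<close>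

definition trig_deriv :: "nat \<Rightarrow> nat \<Rightarrow> real \<Rightarrow> real" where
  "trig_deriv j \<nu> t = sqrt 2 * (2 * pi * real (freq \<nu>)) ^ j *
     cos (2 * pi * real (freq \<nu>) * t + phase \<nu> + real j * pi / 2)"

lemma trig_deriv_0: "trig_deriv 0 = trig_basis"
  by (intro ext) (simp add: trig_deriv_def trig_basis_phase)

lemma trig_deriv_has_derivative:
  "(trig_deriv j \<nu> has_real_derivative trig_deriv (Suc j) \<nu> t) (at t within A)"
proof -
  have shift: "cos (2 * pi * real (freq \<nu>) * t + phase \<nu> + real (Suc j) * pi / 2)
      = - sin (2 * pi * real (freq \<nu>) * t + phase \<nu> + real j * pi / 2)"
    by (simp add: field_simps minus_sin_cos_eq)
  show ?thesis
    unfolding trig_deriv_def shift by (auto intro!: derivative_eq_intros)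
qed

lemma trig_deriv_bound: "\<bar>trig_deriv j \<nu> t\<bar> \<le> sqrt 2 * (2 * pi * real (freq \<nu>)) ^ j"
  using mult_left_mono[OF abs_cos_le_one, of "sqrt 2 * (2 * pi * real (freq \<nu>)) ^ j"]
  by (simp add: trig_deriv_def abs_mult)

lemma trig_deriv_measurable[measurable]: "trig_deriv j \<nu> \<in> borel_measurable borel"
  unfolding trig_deriv_def by measurable

lemma trig_deriv_integral:
  assumes "t \<in> {0..1}"
  shows "(\<integral>u. trig_deriv (Suc j) \<nu> u * indicator {0..t} u \<partial>\<U>) = trig_deriv j \<nu> t - trig_deriv j \<nu> 0"
proof -
  have "(LINT u:{0..t}|lborel. trig_deriv (Suc j) \<nu> u) = trig_deriv j \<nu> t - trig_deriv j \<nu> 0"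
    unfolding set_lebesgue_integral_def
  proof (rule integral_FTC_atLeastAtMost)
    show "continuous_on {0..t} (trig_deriv (Suc j) \<nu>)"
      unfolding trig_deriv_def by (intro continuous_intros)
  qed (use assms in \<open>auto intro: trig_deriv_has_derivative simp: has_real_derivative_iff_has_vector_derivative[symmetric]\<close>)
  then show ?thesis using set_integral_subinterval[OF assms] by simp
qed

lemma integral_cos_period:
  "(\<integral>t. cos (2 * pi * of_int z * t + a) \<partial>\<U>) = (if z = 0 then cos a else 0)"
proof (cases "z = 0")
  case True
  then show ?thesis using unit_interval.prob_space by simp
next
  case False
  have "(LINT t:{0..1}|lborel. cos (2 * pi * of_int z * t + a))
      = sin (2 * pi * of_int z * 1 + a) / (2 * pi * of_int z) - sin (2 * pi * of_int z * 0 + a) / (2 * pi * of_int z)"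
    unfolding set_lebesgue_integral_def
  proof (rule integral_FTC_atLeastAtMost)
    fix x :: real
    show "((\<lambda>t. sin (2 * pi * of_int z * t + a) / (2 * pi * of_int z)) has_vector_derivative
        cos (2 * pi * of_int z * x + a)) (at x within {0..1})"
      unfolding has_real_derivative_iff_has_vector_derivative[symmetric]
      using False by (auto intro!: derivative_eq_intros)
  qed (auto intro!: continuous_intros)
  also have "sin (2 * pi * of_int z * 1 + a) = sin a"
    by (simp add: sin_add sin_int_2pin cos_int_2pin)
  finally show ?thesis using False by (simp add: set_integral_unit_interval)
qed

lemma trig_deriv_orthogonal:
  assumes "0 < \<mu>" "0 < \<nu>"
  shows "(\<integral>t. trig_deriv j \<mu> t * trig_deriv j \<nu> t \<partial>\<U>)
    = (if \<mu> = \<nu> then (2 * pi * real (freq \<mu>)) ^ (2 * j) else 0)"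
proof -
  let ?k = "int (freq \<mu>)" and ?l = "int (freq \<nu>)"
  let ?c = "(2 * pi * real (freq \<mu>)) ^ j * (2 * pi * real (freq \<nu>)) ^ j"
  have pos: "?k > 0" "?l > 0" using assms by auto
  have "trig_deriv j \<mu> t * trig_deriv j \<nu> t
      = ?c * (2 * (cos (2 * pi * real (freq \<mu>) * t + phase \<mu> + real j * pi / 2) * cos (2 * pi * real (freq \<nu>) * t + phase \<nu> + real j * pi / 2)))" for t
    by (simp add: trig_deriv_def)
  also have "\<dots> t = ?c * (cos (2 * pi * of_int (?k - ?l) * t + (phase \<mu> - phase \<nu>))
       + cos (2 * pi * of_int (?k + ?l) * t + (phase \<mu> + phase \<nu> + real j * pi)))" for t
    unfolding cos_times_cos by (simp add: algebra_simps)
  finally have eq: "trig_deriv j \<mu> t * trig_deriv j \<nu> t = ?c * (cos (2 * pi * of_int (?k - ?l) * t + (phase \<mu> - phase \<nu>))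
       + cos (2 * pi * of_int (?k + ?l) * t + (phase \<mu> + phase \<nu> + real j * pi)))" for t .
  have int: "integrable \<U> (\<lambda>t. cos (2 * pi * of_int z * t + a))" for z :: int and a :: real
    by (rule unit_interval.integrable_const_bound[of _ 1]) (auto intro!: measurable_unit_interval)
  have "(\<integral>t. trig_deriv j \<mu> t * trig_deriv j \<nu> t \<partial>\<U>) = ?c * (if ?k = ?l then cos (phase \<mu> - phase \<nu>) else 0)"
    unfolding eq using int pos by (simp add: integral_cos_period del: of_int_add of_int_diff of_int_of_nat_eq)
  moreover have "\<mu> = \<nu>" if "?k = ?l" "odd \<mu> \<longleftrightarrow> odd \<nu>"
    using that by presburger
  ultimately show ?thesis
    by (auto simp: phase_def power_mult power2_eq_square power_mult_distrib cos_diff mult_ac split: if_splits)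
qed

section \<open>The Sobolev form as a weighted sum of squared coefficients\<close>

text \<open>Coefficient sequences are indexed from \<open>0\<close>; entry \<open>i\<close> belongs to the basis function with index
\<open>Suc i\<close>.\<close>

definition sobolev_coeffs :: "nat \<Rightarrow> (nat \<Rightarrow> real) \<Rightarrow> bool" where
  "sobolev_coeffs m c \<longleftrightarrow> summable (\<lambda>i. (c i)\<^sup>2 * trig_eigenvalue m (Suc i))"

definition trig_series :: "(nat \<Rightarrow> real) \<Rightarrow> real \<Rightarrow> real" where
  "trig_series c t = (\<Sum>i. c i * trig_basis (Suc i) t)"

lemma sobolev_eq: "sobolev m = {trig_series c | c. sobolev_coeffs m c}"
proof (intro set_eqI iffI)
  fix f assume "f \<in> sobolev m"
  then obtain c where "f = (\<lambda>t. \<Sum>\<nu>. c (Suc \<nu>) * trig_basis (Suc \<nu>) t)"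
    "summable (\<lambda>\<nu>. (c (Suc \<nu>))\<^sup>2 * trig_eigenvalue m (Suc \<nu>))"
    unfolding sobolev_def by blast
  then have "f = trig_series (\<lambda>i. c (Suc i))" "sobolev_coeffs m (\<lambda>i. c (Suc i))"
    by (auto simp: trig_series_def sobolev_coeffs_def)
  then show "f \<in> {trig_series c | c. sobolev_coeffs m c}" by blast
next
  fix f assume "f \<in> {trig_series c | c. sobolev_coeffs m c}"
  then obtain c where "f = trig_series c" "sobolev_coeffs m c" by blast
  then have "f = (\<lambda>t. \<Sum>\<nu>. (c \<circ> (\<lambda>n. n - 1)) (Suc \<nu>) * trig_basis (Suc \<nu>) t)"
    "summable (\<lambda>\<nu>. ((c \<circ> (\<lambda>n. n - 1)) (Suc \<nu>))\<^sup>2 * trig_eigenvalue m (Suc \<nu>))"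
    by (auto simp: trig_series_def sobolev_coeffs_def)
  then show "f \<in> sobolev m" unfolding sobolev_def by blast
qed

lemma trig_eigenvalue_pos: "0 < trig_eigenvalue m (Suc i)"
  by (auto simp: trig_eigenvalue_def)

lemma summable_inverse_freq_square: "summable (\<lambda>i. 1 / (real (freq (Suc i)))\<^sup>2)"
proof (rule summable_comparison_test')
  have "summable (\<lambda>i. 4 * inverse ((real (Suc i))\<^sup>2))"
    using inverse_power_summable[of 2, where 'a=real]
    by (intro summable_mult) (subst summable_Suc_iff, simp)
  then show "summable (\<lambda>i. 4 / (real (Suc i))\<^sup>2)" by (simp add: field_simps)
  fix i :: nat
  have "Suc i \<le> 2 * freq (Suc i)" by simp
  then have "real (Suc i) \<le> real (2 * freq (Suc i))" by (rule of_nat_mono)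
  then have "real (Suc i) / 2 \<le> real (freq (Suc i))" by simp
  then have "(real (Suc i) / 2)\<^sup>2 \<le> (real (freq (Suc i)))\<^sup>2" by (intro power_mono) auto
  then have "1 / (real (freq (Suc i)))\<^sup>2 \<le> 1 / (real (Suc i) / 2)\<^sup>2"
    by (intro divide_left_mono) (auto simp del: of_nat_Suc)
  then show "norm (1 / (real (freq (Suc i)))\<^sup>2) \<le> 4 / (real (Suc i))\<^sup>2"
    by (simp add: power_divide)
qed

text \<open>By the inequality between arithmetic and geometric means, each term is at most a term of the
Sobolev sum plus \<open>1 / k\<^sup>2\<close>, where \<open>k\<close> is the frequency: lowering the power of \<open>2 * pi * k\<close> from
\<open>m\<close> to \<open>j\<close> gains a factor \<open>1 / k\<close>.\<close>

lemma sobolev_coeffs_summable_weighted: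
  assumes "sobolev_coeffs m c" "j < m"
  shows "summable (\<lambda>i. \<bar>c i\<bar> * (2 * pi * real (freq (Suc i))) ^ j)"
proof (rule summable_comparison_test')
  show "summable (\<lambda>i. (c i)\<^sup>2 * trig_eigenvalue m (Suc i) + 1 / (real (freq (Suc i)))\<^sup>2)"
    using assms summable_inverse_freq_square by (intro summable_add) (auto simp: sobolev_coeffs_def)
  fix i :: nat
  define k where "k = real (freq (Suc i))"
  define x where "x = 2 * pi * k"
  have k: "k \<ge> 1" unfolding k_def by simp
  have x: "x \<ge> k" "x \<ge> 1"
  proof -
    have "1 * k \<le> (2 * pi) * k" using pi_gt3 k by (intro mult_right_mono) auto
    then show "x \<ge> k" by (simp add: x_def)
    then show "x \<ge> 1" using k by simp
  qed
  have "\<bar>c i\<bar> * x ^ j \<le> \<bar>c i\<bar> * x ^ m * (1 / k)"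
  proof -
    have "x ^ j * k \<le> x ^ j * x" using x by (intro mult_left_mono) auto
    also have "\<dots> = x ^ Suc j" by simp
    also have "\<dots> \<le> x ^ m" using assms x by (intro power_increasing) auto
    finally have "x ^ j \<le> x ^ m * (1 / k)" using k by (simp add: field_simps)
    from mult_left_mono[OF this abs_ge_zero[of "c i"]] show ?thesis by (simp only: mult.assoc)
  qed
  also have "\<dots> \<le> (\<bar>c i\<bar> * x ^ m)\<^sup>2 + (1 / k)\<^sup>2"
  proof -
    have "2 * (\<bar>c i\<bar> * x ^ m * (1 / k)) \<le> (\<bar>c i\<bar> * x ^ m)\<^sup>2 + (1 / k)\<^sup>2"
      using sum_squares_bound[of "\<bar>c i\<bar> * x ^ m" "1 / k"] by (simp add: mult.assoc)
    moreover have "0 \<le> \<bar>c i\<bar> * x ^ m * (1 / k)" using k x by simp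
    ultimately show ?thesis by linarith
  qed
  also have "\<dots> = (c i)\<^sup>2 * trig_eigenvalue m (Suc i) + 1 / (real (freq (Suc i)))\<^sup>2"
    by (simp add: trig_eigenvalue_def x_def k_def power_mult_distrib power_even_eq power_divide power_mult[symmetric] mult.commute)
  finally show "norm (\<bar>c i\<bar> * (2 * pi * real (freq (Suc i))) ^ j)
      \<le> (c i)\<^sup>2 * trig_eigenvalue m (Suc i) + 1 / (real (freq (Suc i)))\<^sup>2"
    by (simp add: x_def k_def abs_mult)
qed

lemma summable_trig_deriv:
  assumes "summable (\<lambda>i. \<bar>c i\<bar> * (2 * pi * real (freq (Suc i))) ^ j)"
  shows "summable (\<lambda>i. \<bar>c i * trig_deriv j (Suc i) t\<bar>)"
proof (rule summable_comparison_test')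
  show "summable (\<lambda>i. sqrt 2 * (\<bar>c i\<bar> * (2 * pi * real (freq (Suc i))) ^ j))"
    using assms by (rule summable_mult)
  fix i :: nat
  show "norm \<bar>c i * trig_deriv j (Suc i) t\<bar> \<le> sqrt 2 * (\<bar>c i\<bar> * (2 * pi * real (freq (Suc i))) ^ j)"
    using mult_left_mono[OF trig_deriv_bound[of j "Suc i" t], of "\<bar>c i\<bar>"]
    by (simp add: abs_mult mult_ac)
qed

text \<open>Absolute convergence is uniform in \<open>t\<close>, so the series may be integrated termwise against any
bounded \<open>w\<close>; constant, indicator and basis functions \<open>w\<close> are all needed below.\<close>

lemma trig_deriv_series_integral:
  fixes w :: "real \<Rightarrow> real"
  assumes sm: "summable (\<lambda>i. \<bar>c i\<bar> * (2 * pi * real (freq (Suc i))) ^ j)"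
    and wm: "w \<in> borel_measurable \<U>" and w: "\<And>t. \<bar>w t\<bar> \<le> K"
  shows "integrable \<U> (\<lambda>u. (\<Sum>i. c i * trig_deriv j (Suc i) u) * w u)"
    and "(\<lambda>i. c i * (\<integral>u. trig_deriv j (Suc i) u * w u \<partial>\<U>)) sums
       (\<integral>u. (\<Sum>i. c i * trig_deriv j (Suc i) u) * w u \<partial>\<U>)"
proof -
  let ?f = "\<lambda>i u. c i * trig_deriv j (Suc i) u * w u"
  let ?B = "\<lambda>i. sqrt 2 * K * (\<bar>c i\<bar> * (2 * pi * real (freq (Suc i))) ^ j)"
  have tm: "trig_deriv j i \<in> borel_measurable \<U>" for i by (rule measurable_unit_interval) measurable
  have bd: "norm (?f i u) \<le> ?B i" for i u
  proof -
    have "norm (?f i u) = \<bar>c i\<bar> * (\<bar>trig_deriv j (Suc i) u\<bar> * \<bar>w u\<bar>)"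
      by (simp add: abs_mult mult.assoc)
    also have "\<dots> \<le> \<bar>c i\<bar> * ((sqrt 2 * (2 * pi * real (freq (Suc i))) ^ j) * K)"
      by (intro mult_left_mono mult_mono trig_deriv_bound w) auto
    finally show ?thesis by (simp only: mult_ac)
  qed
  have sB: "summable ?B" using sm by (rule summable_mult)
  have int: "integrable \<U> (?f i)" for i
    by (rule unit_interval.integrable_const_bound[of _ "?B i"])
       (use bd tm wm in \<open>auto intro!: borel_measurable_times\<close>)
  have s1: "AE u in \<U>. summable (\<lambda>i. norm (?f i u))"
  proof (rule AE_I2)
    fix u show "summable (\<lambda>i. norm (?f i u))"
      by (rule summable_comparison_test'[OF sB]) (use bd in simp)
  qed
  have s2: "summable (\<lambda>i. \<integral>u. norm (?f i u) \<partial>\<U>)"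
  proof (rule summable_comparison_test'[OF sB])
    fix i :: nat
    have "(\<integral>u. norm (?f i u) \<partial>\<U>) \<le> (\<integral>u. ?B i \<partial>\<U>)"
      by (intro integral_mono integrable_norm int) (use bd in auto)
    then show "norm (\<integral>u. norm (?f i u) \<partial>\<U>) \<le> ?B i"
      using unit_interval.prob_space by simp
  qed
  have "(\<Sum>i. ?f i u) = (\<Sum>i. c i * trig_deriv j (Suc i) u) * w u" for u
    by (rule suminf_mult2[symmetric]) (rule summable_rabs_cancel[OF summable_trig_deriv[OF sm]])
  then show "integrable \<U> (\<lambda>u. (\<Sum>i. c i * trig_deriv j (Suc i) u) * w u)"
    and "(\<lambda>i. c i * (\<integral>u. trig_deriv j (Suc i) u * w u \<partial>\<U>)) sums
       (\<integral>u. (\<Sum>i. c i * trig_deriv j (Suc i) u) * w u \<partial>\<U>)"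
    using integrable_suminf[OF int s1 s2] sums_integral[OF int s1 s2] by (simp_all add: mult.assoc)
qed

lemma trig_deriv_series_ac_deriv:
  assumes sm: "summable (\<lambda>i. \<bar>c i\<bar> * (2 * pi * real (freq (Suc i))) ^ j)"
    "summable (\<lambda>i. \<bar>c i\<bar> * (2 * pi * real (freq (Suc i))) ^ Suc j)"
  shows "ac_deriv (\<lambda>t. \<Sum>i. c i * trig_deriv j (Suc i) t) (\<lambda>t. \<Sum>i. c i * trig_deriv (Suc j) (Suc i) t)"
proof -
  have sum_j: "summable (\<lambda>i. c i * trig_deriv j (Suc i) t)" for t
    using summable_trig_deriv[OF sm(1)] by (rule summable_rabs_cancel)
  show ?thesis
    unfolding ac_deriv_def
  proof (intro conjI ballI)
    show "set_integrable lborel {0..1} (\<lambda>t. \<Sum>i. c i * trig_deriv (Suc j) (Suc i) t)"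
      using trig_deriv_series_integral(1)[OF sm(2), of "\<lambda>_. 1" 1] by (simp add: set_integrable_unit_interval)
    fix t :: real assume t: "t \<in> {0..1}"
    have "(\<lambda>i. c i * (trig_deriv j (Suc i) t - trig_deriv j (Suc i) 0)) sums
        (\<integral>u. (\<Sum>i. c i * trig_deriv (Suc j) (Suc i) u) * indicator {0..t} u \<partial>\<U>)"
      using trig_deriv_series_integral(2)[OF sm(2), of "indicator {0..t}" 1] trig_deriv_integral[OF t]
      by (simp add: measurable_unit_interval)
    then have "(\<integral>u. (\<Sum>i. c i * trig_deriv (Suc j) (Suc i) u) * indicator {0..t} u \<partial>\<U>)
      = (\<Sum>i. c i * trig_deriv j (Suc i) t - c i * trig_deriv j (Suc i) 0)"
      by (simp add: sums_iff right_diff_distrib)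
    also have "\<dots> = (\<Sum>i. c i * trig_deriv j (Suc i) t) - (\<Sum>i. c i * trig_deriv j (Suc i) 0)"
      by (intro suminf_diff[symmetric] sum_j)
    finally show "(\<Sum>i. c i * trig_deriv j (Suc i) t) = (\<Sum>i. c i * trig_deriv j (Suc i) 0)
      + (LINT u:{0..t}|lborel. (\<Sum>i. c i * trig_deriv (Suc j) (Suc i) u))"
      using set_integral_subinterval[OF t] by simp
  qed
qed

text \<open>Up to order \<open>m - 1\<close> the differentiated series converges uniformly and integrates termwise. At order
\<open>m\<close> it converges only in mean square, so its sum comes from the Riesz-Fischer theorem.\<close>

lemma nth_weak_derivative_exists:
  assumes m: "m \<ge> 1" and c: "sobolev_coeffs m c"
  obtains g where "(ac_deriv ^^ m) (trig_series c) g" "integral\<^sup>L \<U> (\<lambda>t. (g t)\<^sup>2) = (\<Sum>i. (c i)\<^sup>2 * trig_eigenvalue m (Suc i))"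
proof -
  obtain p where p: "m = Suc p" using m by (cases m) auto
  define F where "F = (\<lambda>j t. \<Sum>i. c i * trig_deriv j (Suc i) t)"
  have F0: "F 0 = trig_series c" by (simp add: F_def trig_series_def trig_deriv_0 fun_eq_iff)
  have chain: "(ac_deriv ^^ j) (F 0) (F j)" if "j < m" for j
    using that
  proof (induction j)
    case (Suc j)
    have "ac_deriv (F j) (F (Suc j))" unfolding F_def
      using Suc.prems by (intro trig_deriv_series_ac_deriv sobolev_coeffs_summable_weighted[OF c]) simp_all
    then show ?case using Suc by (auto simp: relcompp.simps)
  qed simp
  define \<psi> where "\<psi> = (\<lambda>i t. trig_deriv m (Suc i) t / (2 * pi * real (freq (Suc i))) ^ m)"
  define d where "d = (\<lambda>i. c i * (2 * pi * real (freq (Suc i))) ^ m)"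
  have meas[measurable]: "\<psi> i \<in> borel_measurable borel" for i unfolding \<psi>_def by measurable
  have measU: "\<psi> i \<in> borel_measurable \<U>" for i by (rule measurable_unit_interval) measurable
  have on: "(\<integral>x. \<psi> i x * \<psi> j x \<partial>\<U>) = of_bool (i = j)" for i j
  proof -
    have "(\<integral>x. \<psi> i x * \<psi> j x \<partial>\<U>) = (\<integral>x. trig_deriv m (Suc i) x * trig_deriv m (Suc j) x \<partial>\<U>)
      / ((2 * pi * real (freq (Suc i))) ^ m * (2 * pi * real (freq (Suc j))) ^ m)"
      unfolding \<psi>_def by (simp add: mult_ac)
    then show ?thesis
      by (cases "i = j") (simp_all add: trig_deriv_orthogonal power_even_eq power2_eq_square)
  qed
  have sq: "integrable \<U> (\<lambda>x. (\<psi> i x)\<^sup>2)" for i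
  proof (rule ccontr)
    assume "\<not> ?thesis"
    then have "(\<integral>x. (\<psi> i x)\<^sup>2 \<partial>\<U>) = 0" by (simp add: not_integrable_integral_eq)
    then show False using on[of i i] by (simp add: power2_eq_square)
  qed
  have d2: "(d i)\<^sup>2 = (c i)\<^sup>2 * trig_eigenvalue m (Suc i)" for i
    by (simp add: d_def trig_eigenvalue_def power_mult_distrib power_even_eq)
  have ds: "summable (\<lambda>i. (d i)\<^sup>2)" unfolding d2 using c by (simp add: sobolev_coeffs_def)
  obtain g where gm: "g \<in> borel_measurable \<U>" and gsq: "integrable \<U> (\<lambda>x. (g x)\<^sup>2)"
    and gnorm: "(\<integral>x. (g x)\<^sup>2 \<partial>\<U>) = (\<Sum>i. (d i)\<^sup>2)"
    and gsums: "\<And>u. u \<in> borel_measurable \<U> \<Longrightarrow> integrable \<U> (\<lambda>x. (u x)\<^sup>2) \<Longrightarrow>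
       (\<lambda>i. d i * (\<integral>x. \<psi> i x * u x \<partial>\<U>)) sums (\<integral>x. g x * u x \<partial>\<U>)"
    using unit_interval.riesz_fischer[OF measU sq on ds] by blast
  have "ac_deriv (F p) g" unfolding ac_deriv_def
  proof (intro conjI ballI)
    show "set_integrable lborel {0..1} g"
      using unit_interval.square_integrable_imp_integrable[OF gm gsq] by (simp add: set_integrable_unit_interval)
    fix t :: real assume t: "t \<in> {0..1}"
    have "(\<lambda>i. d i * (\<integral>x. \<psi> i x * indicator {0..t} x \<partial>\<U>)) sums (\<integral>x. g x * indicator {0..t} x \<partial>\<U>)"
      by (rule gsums; (rule unit_interval.integrable_const_bound[of _ 1])?)
         (auto intro!: measurable_unit_interval simp: indicator_def)
    moreover have "d i * (\<integral>x. \<psi> i x * indicator {0..t} x \<partial>\<U>)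
       = c i * trig_deriv p (Suc i) t - c i * trig_deriv p (Suc i) 0" for i
    proof -
      define x where "x = (2 * pi * real (freq (Suc i))) ^ Suc p"
      have "x \<noteq> 0" by (simp add: x_def)
      have "d i * (\<integral>v. \<psi> i v * indicator {0..t} v \<partial>\<U>)
          = c i * x * (\<integral>v. trig_deriv (Suc p) (Suc i) v * indicator {0..t} v / x \<partial>\<U>)"
        unfolding d_def \<psi>_def p x_def[symmetric] by simp
      also have "\<dots> = c i * (\<integral>v. trig_deriv (Suc p) (Suc i) v * indicator {0..t} v \<partial>\<U>)"
        using \<open>x \<noteq> 0\<close> by simp
      finally show ?thesis
        by (simp only: trig_deriv_integral[OF t] right_diff_distrib)
    qed
    moreover have "summable (\<lambda>i. c i * trig_deriv p (Suc i) u)" for u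
      by (rule summable_rabs_cancel[OF summable_trig_deriv[OF sobolev_coeffs_summable_weighted[OF c]]])
         (simp add: p)
    ultimately have "(\<integral>x. g x * indicator {0..t} x \<partial>\<U>) = F p t - F p 0"
      unfolding F_def by (simp add: sums_iff suminf_diff)
    then show "F p t = F p 0 + (LINT u:{0..t}|lborel. g u)"
      using set_integral_subinterval[OF t] by simp
  qed
  then have "(ac_deriv ^^ m) (trig_series c) g"
    using chain[of p] F0 p by (auto simp: relcompp.simps)
  then show ?thesis using that gnorm d2 by simp
qed

text \<open>The sets over which \<open>G\<close> integrates to zero form a Dynkin system, and half-lines form a generator of
the Borel sets that is closed under intersection.\<close>

lemma unit_interval_integral_zero_imp_AE_zero:
  fixes G :: "real \<Rightarrow> real"
  assumes G: "integrable \<U> G"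
    and zero: "\<And>t. t \<in> {0..1} \<Longrightarrow> (\<integral>u. G u * indicator {0..t} u \<partial>\<U>) = 0"
  shows "AE t in \<U>. G t = 0"
proof (rule unit_interval.density_zero[OF G])
  have S: "sigma_sets UNIV (range (\<lambda>a::real. {..a})) = sets borel"
    by (subst borel_eq_atMost) (simp add: sets_measure_of)
  fix A assume "A \<in> sets \<U>"
  then have A01: "A \<in> sets borel"
    by (auto simp: unit_interval_measure_def sets_restrict_space)
  then have A: "A \<in> sigma_sets UNIV (range (\<lambda>a::real. {..a}))" unfolding S .
  have "Int_stable (range (\<lambda>a::real. {..a}))" "range (\<lambda>a::real. {..a}) \<subseteq> Pow UNIV"
    by (auto simp: Int_stable_def)
  from this A have "(\<integral>u. G u * indicator A u \<partial>\<U>) = 0"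
  proof (induction rule: sigma_sets_induct_disjoint)
    case (basic A)
    then obtain a where A: "A = {..a}" by auto
    have eq: "(\<integral>u. G u * indicator A u \<partial>\<U>) = (\<integral>u. G u * indicator {0..min a 1} u \<partial>\<U>)"
      by (intro Bochner_Integration.integral_cong) (auto simp: A indicator_def)
    show ?case
    proof (cases "a < 0")
      case True then show ?thesis unfolding eq by simp
    next
      case False then show ?thesis unfolding eq by (intro zero) auto
    qed
  next
    case (compl A)
    then have A: "A \<in> sets borel" unfolding S by simp
    have "integrable \<U> (\<lambda>u. G u * indicator (A \<inter> {0..1}) u)"
      by (rule integrable_real_mult_indicator[OF _ G])
         (use A in \<open>auto simp: unit_interval_measure_def sets_restrict_space_iff\<close>)
    then have iA: "integrable \<U> (\<lambda>u. G u * indicator A u)"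
      by (rule Bochner_Integration.integrable_cong[THEN iffD1, rotated -1]) (auto simp: indicator_def)
    have "(\<integral>u. G u * indicator (UNIV - A) u \<partial>\<U>) = (\<integral>u. G u - G u * indicator A u \<partial>\<U>)"
      by (intro Bochner_Integration.integral_cong) (auto simp: indicator_def)
    also have "\<dots> = (\<integral>u. G u \<partial>\<U>) - (\<integral>u. G u * indicator A u \<partial>\<U>)" using G iA by simp
    also have "(\<integral>u. G u \<partial>\<U>) = (\<integral>u. G u * indicator {0..1} u \<partial>\<U>)"
      by (intro Bochner_Integration.integral_cong) auto
    finally show ?case using zero[of 1] compl.IH by simp
  next
    case (union A)
    have A: "A i \<in> sets borel" for i using union(2) unfolding S by auto
    define B where "B = (\<lambda>i. A i \<inter> {0..1})"
    have B: "B i \<in> sets \<U>" for i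
      unfolding B_def using A[of i] by (auto simp: unit_interval_measure_def sets_restrict_space_iff)
    have "(\<integral>u. G u * indicator (\<Union>i. A i) u \<partial>\<U>) = (LINT u:(\<Union>i. B i)|\<U>. G u)"
      unfolding set_lebesgue_integral_def B_def
      by (intro Bochner_Integration.integral_cong) (auto simp: indicator_def)
    also have "\<dots> = (\<Sum>i. (LINT u:B i|\<U>. G u))"
    proof (rule lebesgue_integral_countable_add)
      show "B i \<inter> B j = {}" if "i \<noteq> j" for i j
        using union(1) that unfolding B_def disjoint_family_on_def by auto
      show "set_integrable \<U> (\<Union>i. B i) G"
        using integrable_real_mult_indicator[OF _ G, of "\<Union>i. B i"] B
        unfolding set_integrable_def by (simp add: mult.commute sets.countable_UN)
    qed (rule B)
    also have "(LINT u:B i|\<U>. G u) = (\<integral>u. G u * indicator (A i) u \<partial>\<U>)" for i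
      unfolding set_lebesgue_integral_def B_def
      by (intro Bochner_Integration.integral_cong) (auto simp: indicator_def)
    then have "(\<Sum>i. (LINT u:B i|\<U>. G u)) = 0" using union(3) by simp
    finally show ?case .
  qed simp
  then show "set_lebesgue_integral \<U> A G = 0"
    by (simp add: set_lebesgue_integral_def mult.commute)
qed

lemma ac_deriv_continuous:
  assumes "ac_deriv f g"
  shows "continuous_on {0..1} f"
proof -
  have si: "set_integrable lborel {0..t} g" if "t \<in> {0..1}" for t
    by (rule set_integrable_subset[of _ "{0..1}"]) (use assms that in \<open>auto simp: ac_deriv_def\<close>)
  have "continuous_on {0..1} (\<lambda>t. f 0 + integral {0..t} g)"
    using set_borel_integral_eq_integral(1)[OF si[of 1]]
    by (intro continuous_intros indefinite_integral_continuous_1) simp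
  then show ?thesis
  proof (rule continuous_on_eq)
    fix t :: real assume t: "t \<in> {0..1}"
    have "f t = f 0 + (LINT u:{0..t}|lborel. g u)" using assms t unfolding ac_deriv_def by blast
    then show "f 0 + integral {0..t} g = f t"
      using set_borel_integral_eq_integral(2)[OF si[OF t]] by simp
  qed
qed

lemma AE_eq_imp_eq_continuous:
  fixes f f' :: "real \<Rightarrow> real"
  assumes "continuous_on {0..1} f" "continuous_on {0..1} f'" and ae: "AE t in \<U>. f t = f' t"
    and t: "t \<in> {0..1}"
  shows "f t = f' t"
proof (rule ccontr)
  assume ne: "f t \<noteq> f' t"
  have "continuous_on {0..1} (\<lambda>t. f t - f' t)" by (intro continuous_intros assms)
  then obtain d where d: "d > 0" "\<And>u. u \<in> {0..1} \<Longrightarrow> dist u t < d \<Longrightarrow> dist (f u - f' u) (f t - f' t) < \<bar>f t - f' t\<bar>"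
    unfolding continuous_on_iff using t ne by (metis zero_less_abs_iff right_minus_eq)
  define a b where "a = max 0 (t - d / 2)" and "b = min 1 (t + d / 2)"
  have ab: "a < b" "0 \<le> a" "b \<le> 1" using t d(1) by (auto simp: a_def b_def)
  have neq: "f u \<noteq> f' u" if "u \<in> {a..b}" for u
  proof -
    have "dist u t < d" using that d(1) by (auto simp: a_def b_def dist_real_def)
    then show ?thesis using d(2)[of u] that ab by (auto simp: dist_real_def)
  qed
  have "AE u in lborel. u \<in> {0..1} \<longrightarrow> f u = f' u"
    using ae unfolding unit_interval_measure_def by (subst (asm) AE_restrict_space_iff) auto
  then have "AE u in lborel. u \<notin> {a..b}"
    by eventually_elim (use neq ab in force)
  then have "emeasure lborel {a..b} = 0"
    by (subst (asm) AE_iff_measurable[of "{a..b}"]) auto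
  then show False using ab by simp
qed

text \<open>Absolutely continuous functions that agree almost everywhere agree everywhere, hence so do the
integrals of their derivatives over all intervals \<open>[0,t]\<close>.\<close>

lemma ac_deriv_AE_unique:
  assumes fg: "ac_deriv f g" and fg': "ac_deriv f' g'" and ae: "AE t in \<U>. f t = f' t"
  shows "AE t in \<U>. g t = g' t"
proof -
  have eq: "f t = f' t" if "t \<in> {0..1}" for t
    using AE_eq_imp_eq_continuous[OF ac_deriv_continuous[OF fg] ac_deriv_continuous[OF fg'] ae that] .
  have int: "integrable \<U> g" "integrable \<U> g'"
    using fg fg' by (auto simp: ac_deriv_def set_integrable_unit_interval)
  have "AE t in \<U>. g t - g' t = 0"
  proof (rule unit_interval_integral_zero_imp_AE_zero)
    fix t :: real assume t: "t \<in> {0..1}"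
    have m: "{0..t} \<in> sets \<U>" using t by (simp add: unit_interval_measure_def sets_restrict_space_iff)
    have "(\<integral>u. (g u - g' u) * indicator {0..t} u \<partial>\<U>)
      = (\<integral>u. g u * indicator {0..t} u \<partial>\<U>) - (\<integral>u. g' u * indicator {0..t} u \<partial>\<U>)"
      using int m by (simp add: left_diff_distrib integrable_real_mult_indicator)
    also have "\<dots> = (f t - f 0) - (f' t - f' 0)"
    proof -
      have "f t = f 0 + (LINT u:{0..t}|lborel. g u)" "f' t = f' 0 + (LINT u:{0..t}|lborel. g' u)"
        using fg fg' t unfolding ac_deriv_def by blast+
      then show ?thesis unfolding set_integral_subinterval[OF t] by linarith
    qed
    also have "\<dots> = 0" using eq[OF t] eq[of 0] by simp
    finally show "(\<integral>u. (g u - g' u) * indicator {0..t} u \<partial>\<U>) = 0" .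
  qed (use int in simp)
  then show ?thesis by simp
qed

lemma nth_weak_derivative_AE_unique:
  assumes "(ac_deriv ^^ m) f g" "(ac_deriv ^^ m) f' g'" "AE t in \<U>. f t = f' t"
  shows "AE t in \<U>. g t = g' t"
  using assms
proof (induction m arbitrary: g g')
  case (Suc m)
  then obtain h h' where h: "(ac_deriv ^^ m) f h" "ac_deriv h g" "(ac_deriv ^^ m) f' h'" "ac_deriv h' g'"
    by auto
  then show ?case using Suc.IH Suc.prems(3) ac_deriv_AE_unique by blast
qed simp

text \<open>The derivative selected by \<open>nth_deriv\<close> agrees almost everywhere with the one for which Parseval's
identity was established.\<close>

lemma sobolev_form_trig_series:
  assumes "m \<ge> 1" "sobolev_coeffs m c"
  shows "sobolev_form m (trig_series c) (trig_series c) = (\<Sum>i. (c i)\<^sup>2 * trig_eigenvalue m (Suc i))"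
proof -
  obtain g where g: "(ac_deriv ^^ m) (trig_series c) g"
    and gn: "integral\<^sup>L \<U> (\<lambda>t. (g t)\<^sup>2) = (\<Sum>i. (c i)\<^sup>2 * trig_eigenvalue m (Suc i))"
    using nth_weak_derivative_exists[OF assms] by blast
  have chosen: "(ac_deriv ^^ m) (trig_series c) (nth_deriv m (trig_series c))"
    unfolding nth_deriv_def using someI[of "(ac_deriv ^^ m) (trig_series c)", OF g] by simp
  obtain p where p: "m = Suc p" using assms by (cases m) auto
  have int: "h \<in> borel_measurable \<U>" if "(ac_deriv ^^ m) (trig_series c) h" for h
    using that unfolding p by (auto simp: ac_deriv_def set_integrable_unit_interval)
  have "AE t in \<U>. nth_deriv m (trig_series c) t = g t"
    by (rule nth_weak_derivative_AE_unique[OF chosen g]) simp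
  then have "integral\<^sup>L \<U> (\<lambda>t. (nth_deriv m (trig_series c) t)\<^sup>2) = integral\<^sup>L \<U> (\<lambda>t. (g t)\<^sup>2)"
    using int[OF chosen] int[OF g] by (intro integral_cong_AE) auto
  then show ?thesis using gn unfolding sobolev_form_def set_integral_unit_interval
    by (simp add: power2_eq_square)
qed

lemma trig_series_bounded:
  assumes "m \<ge> 1" "sobolev_coeffs m c"
  obtains K where "\<And>t. \<bar>trig_series c t\<bar> \<le> K"
proof -
  have sm: "summable (\<lambda>i. \<bar>c i\<bar> * (2 * pi * real (freq (Suc i))) ^ 0)"
    using assms by (intro sobolev_coeffs_summable_weighted) auto
  then have sm': "summable (\<lambda>i. sqrt 2 * \<bar>c i\<bar>)" by (intro summable_mult) simp
  have "\<bar>trig_series c t\<bar> \<le> (\<Sum>i. sqrt 2 * \<bar>c i\<bar>)" for t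
  proof -
    have s: "summable (\<lambda>i. \<bar>c i * trig_basis (Suc i) t\<bar>)"
      using summable_trig_deriv[OF sm, of t] by (simp add: trig_deriv_0)
    have "\<bar>trig_series c t\<bar> \<le> (\<Sum>i. \<bar>c i * trig_basis (Suc i) t\<bar>)"
      unfolding trig_series_def by (rule summable_rabs[OF s])
    also have "\<dots> \<le> (\<Sum>i. sqrt 2 * \<bar>c i\<bar>)"
    proof (rule suminf_le[OF _ s sm'])
      fix i
      show "\<bar>c i * trig_basis (Suc i) t\<bar> \<le> sqrt 2 * \<bar>c i\<bar>"
        using mult_left_mono[OF trig_deriv_bound[of 0 "Suc i" t], of "\<bar>c i\<bar>"]
        by (simp add: abs_mult trig_deriv_0 mult_ac)
    qed
    finally show ?thesis .
  qed
  then show ?thesis by (rule that)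
qed

lemma trig_series_measurable:
  "trig_series c \<in> borel_measurable borel"
  unfolding trig_series_def trig_deriv_0[symmetric] by measurable

lemma L2norm_trig_series:
  assumes "m \<ge> 1" "sobolev_coeffs m c"
  shows "(L2norm (trig_series c))\<^sup>2 = (\<Sum>i. (c i)\<^sup>2)"
proof -
  have sm: "summable (\<lambda>i. \<bar>c i\<bar> * (2 * pi * real (freq (Suc i))) ^ 0)"
    using assms by (intro sobolev_coeffs_summable_weighted) auto
  have fm: "trig_series c \<in> borel_measurable \<U>"
    by (rule measurable_unit_interval) (rule trig_series_measurable)
  obtain K where K: "\<And>t. \<bar>trig_series c t\<bar> \<le> K" using trig_series_bounded[OF assms] by blast
  have termwise: "(\<lambda>i. c i * (\<integral>u. trig_basis (Suc i) u * w u \<partial>\<U>)) sums (\<integral>u. trig_series c u * w u \<partial>\<U>)"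
    if "w \<in> borel_measurable \<U>" "\<And>t. \<bar>w t\<bar> \<le> B" for w :: "real \<Rightarrow> real" and B
    using trig_deriv_series_integral(2)[OF sm that] by (simp add: trig_deriv_0 trig_series_def)
  have coef: "(\<integral>u. trig_basis (Suc j) u * trig_series c u \<partial>\<U>) = c j" for j
  proof -
    have "(\<lambda>i. c i * (\<integral>u. trig_basis (Suc i) u * trig_basis (Suc j) u \<partial>\<U>)) sums
        (\<integral>u. trig_series c u * trig_basis (Suc j) u \<partial>\<U>)"
      using trig_deriv_bound[of 0 "Suc j"]
      by (intro termwise[of _ "sqrt 2"] measurable_unit_interval) (auto simp: trig_deriv_0[symmetric])
    moreover have "(\<integral>u. trig_basis (Suc i) u * trig_basis (Suc j) u \<partial>\<U>) = (if i = j then 1 else 0)" for i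
      using trig_deriv_orthogonal[of "Suc i" "Suc j" 0] by (simp add: trig_deriv_0)
    ultimately have "(\<lambda>i. if i = j then c i else 0) sums (\<integral>u. trig_series c u * trig_basis (Suc j) u \<partial>\<U>)"
      by (simp add: if_distrib cong: if_cong)
    from sums_unique2[OF this sums_single] show ?thesis by (simp add: mult.commute)
  qed
  have "(\<lambda>i. c i * c i) sums (\<integral>u. trig_series c u * trig_series c u \<partial>\<U>)"
    using termwise[OF fm K] by (simp add: coef)
  then show ?thesis
    by (simp add: L2norm_def set_integral_unit_interval power2_eq_square[symmetric] sums_iff)
qed

section \<open>Trigonometric sums over equispaced points\<close>

text \<open>If \<open>n\<close> does not divide \<open>z\<close>, then multiplication by \<open>2 * sin (\<theta> / 2)\<close>, with \<open>\<theta>\<close> the angular step,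
makes the sum telescope over a full period.\<close>

lemma sum_cos_equispaced:
  fixes z :: int and a :: real
  assumes n: "n > 0"
  shows "(\<Sum>i<n. cos (2 * pi * of_int z * (real i / real n) + a)) = (if int n dvd z then real n * cos a else 0)"
proof (cases "int n dvd z")
  case True
  then obtain q where q: "z = int n * q" by auto
  have "cos (2 * pi * of_int z * (real i / real n) + a) = cos a" for i
  proof -
    have eq: "2 * pi * of_int z * (real i / real n) + a = a + 2 * pi * of_int (q * int i)"
      using n q by (simp add: field_simps)
    show ?thesis unfolding eq by (simp only: cos_add cos_int_2pin sin_int_2pin)
  qed
  then show ?thesis using True by simp
next
  case False
  define \<theta> where "\<theta> = 2 * pi * of_int z / real n"
  have s: "sin (\<theta> / 2) \<noteq> 0"
  proof
    assume "sin (\<theta> / 2) = 0"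
    then obtain i :: int where "\<theta> / 2 = of_int i * pi" using sin_zero_iff_int2 by auto
    then have "of_int z = real n * of_int i" using n by (simp add: \<theta>_def field_simps)
    then have "z = int n * i" by (metis of_int_eq_iff of_int_mult of_int_of_nat_eq)
    with False show False by simp
  qed
  have tel: "2 * sin (\<theta> / 2) * cos (real i * \<theta> + a)
      = sin ((real (Suc i) - 1/2) * \<theta> + a) - sin ((real i - 1/2) * \<theta> + a)" for i
  proof -
    have "(real (Suc i) - 1/2) * \<theta> + a = (real i * \<theta> + a) + \<theta> / 2"
      "(real i - 1/2) * \<theta> + a = (real i * \<theta> + a) - \<theta> / 2"
      by (simp_all add: field_simps)
    then show ?thesis by (simp only: sin_add sin_diff) (simp add: field_simps)
  qed
  have "2 * sin (\<theta> / 2) * (\<Sum>i<n. cos (real i * \<theta> + a))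
      = (\<Sum>i<n. sin ((real (Suc i) - 1/2) * \<theta> + a) - sin ((real i - 1/2) * \<theta> + a))"
    by (simp only: sum_distrib_left tel)
  also have "\<dots> = sin ((real n - 1/2) * \<theta> + a) - sin ((real 0 - 1/2) * \<theta> + a)"
    by (rule sum_lessThan_telescope)
  also have "(real n - 1/2) * \<theta> + a = ((real 0 - 1/2) * \<theta> + a) + 2 * pi * of_int z"
    using n by (simp add: \<theta>_def field_simps)
  finally have "2 * sin (\<theta> / 2) * (\<Sum>i<n. cos (real i * \<theta> + a)) = 0"
    by (simp only: sin_add cos_int_2pin sin_int_2pin) simp
  then have "(\<Sum>i<n. cos (real i * \<theta> + a)) = 0" using s by simp
  then show ?thesis using False by (simp add: \<theta>_def mult_ac)
qed

lemma sum_residue_class: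
  assumes N: "N > 0"
  shows "(\<Sum>p<N. of_bool (int N dvd z - int p) * F p) = (F (nat (z mod int N)) :: real)"
proof -
  define r where "r = nat (z mod int N)"
  have r: "int r = z mod int N" "r < N" using N by (auto simp: r_def nat_less_iff)
  have iff: "int N dvd z - int p \<longleftrightarrow> p = r" if "p < N" for p
  proof -
    have "int N dvd z - int p \<longleftrightarrow> z mod int N = int p mod int N" by (simp add: mod_eq_dvd_iff)
    also have "int p mod int N = int p" using that by simp
    finally show ?thesis using r by auto
  qed
  have "(\<Sum>p<N. of_bool (int N dvd z - int p) * F p) = (\<Sum>p<N. if p = r then F r else 0)"
    by (intro sum.cong refl) (auto simp: iff)
  also have "\<dots> = F r" using r by simp
  finally show ?thesis by (simp add: r_def)
qed

text \<open>On a grid of mesh \<open>1 / n\<close> the frequencies \<open>k\<close> and \<open>q\<close> are indistinguishable if \<open>k\<close> is congruent to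
\<open>q\<close> or to \<open>- q\<close> modulo \<open>n\<close>. Both can hold, and then the cosine is counted twice.\<close>

definition aliases :: "nat \<Rightarrow> nat \<Rightarrow> nat \<Rightarrow> real" where
  "aliases n k q = of_bool (int n dvd int k - int q) + of_bool (int n dvd int k + int q)"

lemma aliases_nonneg: "0 \<le> aliases n k q" and aliases_le_2: "aliases n k q \<le> 2"
  by (auto simp: aliases_def)

lemma aliases_cong:
  assumes "aliases n k q \<noteq> 0"
  shows "aliases n l k = aliases n l q"
proof -
  have "int n dvd int k - int q \<or> int n dvd int k + int q"
    using assms by (auto simp: aliases_def split: if_splits)
  then show ?thesis
  proof
    assume d: "int n dvd int k - int q"
    have "int n dvd int l - int k \<longleftrightarrow> int n dvd int l - int q"
      using dvd_add_right_iff[OF d, of "int l - int k"] by (simp add: algebra_simps)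
    moreover have "int n dvd int l + int k \<longleftrightarrow> int n dvd int l + int q"
      using dvd_add_right_iff[OF d, of "int l + int q"] by (simp add: algebra_simps)
    ultimately show ?thesis by (simp add: aliases_def)
  next
    assume d: "int n dvd int k + int q"
    have "int n dvd int l - int k \<longleftrightarrow> int n dvd int l + int q"
      using dvd_add_right_iff[OF d, of "int l - int k"] by (simp add: algebra_simps)
    moreover have "int n dvd int l + int k \<longleftrightarrow> int n dvd int l - int q"
      using dvd_add_right_iff[OF d, of "int l - int q"] by (simp add: algebra_simps)
    ultimately show ?thesis by (simp add: aliases_def)
  qed
qed

text \<open>Averaged over the grid, the cosine kernel of frequency \<open>k\<close> reproduces a wave of frequency \<open>q\<close> at
grid points when \<open>k\<close> is an alias of \<open>q\<close>, and annihilates it otherwise. The product formula splits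
the summand into the frequencies \<open>k - q\<close> and \<open>k + q\<close>.\<close>

lemma kernel_average:
  fixes \<tau> b :: real
  assumes n: "n > 0"
  shows "(\<Sum>i<n. 2 * cos (2 * pi * real k * ((\<tau> + real i / real n) - (\<tau> + real i' / real n)))
           * cos (2 * pi * real q * (\<tau> + real i / real n) + b))
       = real n * (aliases n k q * cos (2 * pi * real q * (\<tau> + real i' / real n) + b))"
proof -
  let ?u = "\<tau> + real i' / real n"
  define A where "A = - 2 * pi * real k * (real i' / real n) - 2 * pi * real q * \<tau> - b"
  define B where "B = - 2 * pi * real k * (real i' / real n) + 2 * pi * real q * \<tau> + b"
  have prod: "2 * cos x * cos y = cos (x - y) + cos (x + y)" for x y :: real
    by (simp add: cos_add cos_diff)
  have "2 * cos (2 * pi * real k * ((\<tau> + real i / real n) - ?u)) * cos (2 * pi * real q * (\<tau> + real i / real n) + b)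
      = cos (2 * pi * of_int (int k - int q) * (real i / real n) + A)
      + cos (2 * pi * of_int (int k + int q) * (real i / real n) + B)" for i
    unfolding prod A_def B_def by (simp add: algebra_simps)
  then have "?thesis \<longleftrightarrow> (if int n dvd int k - int q then real n * cos A else 0)
      + (if int n dvd int k + int q then real n * cos B else 0)
      = real n * (aliases n k q * cos (2 * pi * real q * ?u + b))"
    by (simp only: sum.distrib sum_cos_equispaced[OF n])
  moreover have "cos A = cos (2 * pi * real q * ?u + b)" if d: "int n dvd int k - int q"
  proof -
    obtain z where z: "int k - int q = int n * z" using d by auto
    have "real_of_int (int k - int q) = real_of_int (int n * z)" unfolding z ..
    then have "real k = real q + real n * of_int z" by simp
    then have "A = - (2 * pi * real q * ?u + b) - 2 * pi * of_int (z * int i')"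
      using n by (simp add: A_def field_simps)
    then show ?thesis by (simp only: cos_diff cos_int_2pin sin_int_2pin cos_minus)
  qed
  moreover have "cos B = cos (2 * pi * real q * ?u + b)" if d: "int n dvd int k + int q"
  proof -
    obtain z where z: "int k + int q = int n * z" using d by auto
    have "real_of_int (int k + int q) = real_of_int (int n * z)" unfolding z ..
    then have k: "real k = - real q + real n * of_int z" by simp
    have "B = (2 * pi * real q * ?u + b) - 2 * pi * of_int (z * int i')"
      unfolding B_def k using n by (simp add: field_simps)
    then show ?thesis by (simp only: cos_diff cos_int_2pin sin_int_2pin)
  qed
  ultimately show ?thesis by (auto simp: aliases_def)
qed

lemma trig_basis_pair_sum:
  "(\<Sum>i\<in>{k * 2..<k * 2 + 2}. trig_basis (Suc i) t * trig_basis (Suc i) u) = 2 * cos (2 * pi * real (Suc k) * (t - u))"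
proof -
  have I: "{k * 2..<k * 2 + 2} = {2 * k, Suc (2 * k)}" by auto
  have f: "(Suc (2 * k) + 1) div 2 = Suc k" "(Suc (Suc (2 * k)) + 1) div 2 = Suc k" by auto
  have "(\<Sum>i\<in>{k * 2..<k * 2 + 2}. trig_basis (Suc i) t * trig_basis (Suc i) u)
     = 2 * (cos (2 * pi * real (Suc k) * t) * cos (2 * pi * real (Suc k) * u)
         + sin (2 * pi * real (Suc k) * t) * sin (2 * pi * real (Suc k) * u))"
  proof -
    have eq: "sqrt 2 * x * (sqrt 2 * y) = 2 * (x * y)" for x y :: real
      using real_sqrt_mult_self[of 2] by (simp add: algebra_simps)
    show ?thesis
      unfolding I trig_basis_def f by (simp add: eq distrib_left)
  qed
  also have "\<dots> = 2 * cos (2 * pi * real (Suc k) * (t - u))"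
    by (simp only: cos_diff[symmetric] right_diff_distrib)
  finally show ?thesis .
qed

lemma trig_basis_bound: "\<bar>trig_basis \<nu> t\<bar> \<le> sqrt 2"
  using trig_deriv_bound[of 0 \<nu> t] by (simp add: trig_deriv_0)

section \<open>Filter weights\<close>

text \<open>All aliases \<open>k\<close> of a frequency \<open>q\<close> can be used to fit the same data, and the penalized criterion
shares the data among them in proportion to the inverse penalties \<open>inverse_penalty m lam k\<close>. Their
total is \<open>alias_mass\<close>, and \<open>filter_weight\<close> is the fraction of the empirical coefficient that is
fitted at frequency \<open>k\<close>.\<close>

definition inverse_penalty :: "nat \<Rightarrow> real \<Rightarrow> nat \<Rightarrow> real" where
  "inverse_penalty m lam k = 1 / (lam * (2 * pi * real k) ^ (2 * m))"

definition alias_mass :: "nat \<Rightarrow> nat \<Rightarrow> real \<Rightarrow> nat \<Rightarrow> real" where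
  "alias_mass m n lam q = (\<Sum>k. aliases n (Suc k) q * inverse_penalty m lam (Suc k))"

definition filter_weight :: "nat \<Rightarrow> nat \<Rightarrow> real \<Rightarrow> nat \<Rightarrow> real" where
  "filter_weight m n lam k = inverse_penalty m lam k / (1 + alias_mass m n lam k)"

lemma inverse_penalty_pos: "lam > 0 \<Longrightarrow> k > 0 \<Longrightarrow> inverse_penalty m lam k > 0"
  by (simp add: inverse_penalty_def)

lemma inverse_penalty_le:
  assumes "m \<ge> 1" "lam > 0" "k > 0"
  shows "inverse_penalty m lam k \<le> 1 / lam * (1 / (real k)\<^sup>2)"
proof -
  have k: "1 \<le> real k" using assms by simp
  have x: "real k \<le> 2 * pi * real k"
    using mult_right_mono[of 1 "2 * pi" "real k"] pi_gt3 by simp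
  have "(real k)\<^sup>2 \<le> (2 * pi * real k)\<^sup>2" using x by (intro power_mono) auto
  also have "\<dots> \<le> (2 * pi * real k) ^ (2 * m)"
    using order_trans[OF k x] assms by (intro power_increasing) auto
  finally have "lam * (real k)\<^sup>2 \<le> lam * (2 * pi * real k) ^ (2 * m)"
    using assms by (intro mult_left_mono) auto
  then have "inverse_penalty m lam k \<le> 1 / (lam * (real k)\<^sup>2)"
    unfolding inverse_penalty_def using assms by (intro divide_left_mono) auto
  then show ?thesis by simp
qed

lemma summable_inverse_penalty:
  assumes "m \<ge> 1" "lam > 0"
  shows "summable (\<lambda>k. inverse_penalty m lam (Suc k))"
proof (rule summable_comparison_test')
  have "summable (\<lambda>k. inverse ((real (Suc k))\<^sup>2))"
    using inverse_power_summable[of 2, where 'a=real] by (subst summable_Suc_iff) simp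
  then show "summable (\<lambda>k. 1 / lam * (1 / (real (Suc k))\<^sup>2))"
    unfolding inverse_eq_divide by (rule summable_mult)
  fix k :: nat
  show "norm (inverse_penalty m lam (Suc k)) \<le> 1 / lam * (1 / (real (Suc k))\<^sup>2)"
    using inverse_penalty_le[OF assms, of "Suc k"] inverse_penalty_pos[OF assms(2), of "Suc k" m] by simp
qed

lemma summable_aliases_times:
  assumes "summable (\<lambda>k. f (Suc k))" "\<And>k. 0 \<le> f (Suc k)"
  shows "summable (\<lambda>k. aliases n (Suc k) q * f (Suc k))"
proof (rule summable_comparison_test')
  show "summable (\<lambda>k. 2 * f (Suc k))" using assms(1) by (rule summable_mult)
  fix k
  show "norm (aliases n (Suc k) q * f (Suc k)) \<le> 2 * f (Suc k)"
    using assms(2)[of k] aliases_nonneg[of n "Suc k" q] aliases_le_2[of n "Suc k" q]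
    by (simp add: abs_mult mult_right_mono)
qed

lemma alias_mass_sums:
  assumes "m \<ge> 1" "lam > 0"
  shows "(\<lambda>k. aliases n (Suc k) q * inverse_penalty m lam (Suc k)) sums alias_mass m n lam q"
  unfolding alias_mass_def using assms inverse_penalty_pos[OF assms(2)]
  by (intro summable_sums summable_aliases_times summable_inverse_penalty) (auto simp: less_imp_le)

lemma alias_mass_nonneg:
  assumes "m \<ge> 1" "lam > 0"
  shows "0 \<le> alias_mass m n lam q"
  using inverse_penalty_pos[OF assms(2)] aliases_nonneg
  by (intro sums_le[OF _ sums_zero alias_mass_sums[OF assms]]) (simp add: less_imp_le)

lemma alias_mass_ge_term:
  assumes "m \<ge> 1" "lam > 0" "l > 0" "aliases n l q \<noteq> 0"
  shows "inverse_penalty m lam l \<le> alias_mass m n lam q"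
proof -
  have pos: "0 \<le> aliases n (Suc k) q * inverse_penalty m lam (Suc k)" for k
    using inverse_penalty_pos[OF assms(2), of "Suc k" m] aliases_nonneg[of n "Suc k" q] by simp
  have s: "summable (\<lambda>k. aliases n (Suc k) q * inverse_penalty m lam (Suc k))"
    using alias_mass_sums[OF assms(1,2)] by (rule sums_summable)
  have "1 \<le> aliases n l q" using assms(4) by (auto simp: aliases_def)
  then have "inverse_penalty m lam l \<le> aliases n l q * inverse_penalty m lam l"
    using inverse_penalty_pos[OF assms(2,3), of m] by simp
  also have "\<dots> \<le> alias_mass m n lam q"
    using sum_le_suminf[OF s, of "{l - 1}"] pos assms(3) by (simp add: alias_mass_def)
  finally show ?thesis .
qed

lemma filter_weight_pos:
  assumes "m \<ge> 1" "lam > 0" "k > 0"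
  shows "0 < filter_weight m n lam k"
  using alias_mass_nonneg[OF assms(1,2), of n k] inverse_penalty_pos[OF assms(2,3), of m]
  by (simp add: filter_weight_def)

lemma filter_weight_le_inverse_penalty:
  assumes "m \<ge> 1" "lam > 0" "k > 0"
  shows "filter_weight m n lam k \<le> inverse_penalty m lam k"
  using alias_mass_nonneg[OF assms(1,2), of n k] inverse_penalty_pos[OF assms(2,3), of m]
  by (simp add: filter_weight_def divide_le_eq mult_le_cancel_left1)

lemma alias_mass_cong:
  assumes "aliases n k q \<noteq> 0"
  shows "alias_mass m n lam k = alias_mass m n lam q"
  unfolding alias_mass_def using aliases_cong[OF assms] by simp

text \<open>Aliases of \<open>q\<close> have the same alias mass as \<open>q\<close>, so the denominator of the weights is constant along
the sum. The value is the total fraction of the data at \<open>q\<close> that is fitted.\<close>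

lemma filter_weight_sums:
  assumes "m \<ge> 1" "lam > 0"
  shows "(\<lambda>k. aliases n (Suc k) q * filter_weight m n lam (Suc k)) sums
    (alias_mass m n lam q / (1 + alias_mass m n lam q))"
proof -
  have "aliases n (Suc k) q * filter_weight m n lam (Suc k)
     = aliases n (Suc k) q * inverse_penalty m lam (Suc k) / (1 + alias_mass m n lam q)" for k
    using alias_mass_cong[of n "Suc k" q m lam]
    by (cases "aliases n (Suc k) q = 0") (simp_all add: filter_weight_def)
  then show ?thesis using sums_divide[OF alias_mass_sums[OF assms]] by simp
qed

lemma filter_weight_normal_equation:
  assumes "m \<ge> 1" "lam > 0" "q > 0"
  shows "lam * (2 * pi * real q) ^ (2 * m) * filter_weight m n lam q
     = 1 - alias_mass m n lam q / (1 + alias_mass m n lam q)"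
proof -
  have "lam * (2 * pi * real q) ^ (2 * m) * inverse_penalty m lam q = 1"
    using assms by (simp add: inverse_penalty_def)
  then show ?thesis
    using alias_mass_nonneg[OF assms(1,2), of n q] by (simp add: filter_weight_def field_simps)
qed

section \<open>The penalized least squares fit on one machine\<close>

lemma trig_series_sums:
  assumes "m \<ge> 1" "sobolev_coeffs m c"
  shows "(\<lambda>i. c i * trig_basis (Suc i) t) sums trig_series c t"
proof -
  have "summable (\<lambda>i. \<bar>c i\<bar> * (2 * pi * real (freq (Suc i))) ^ 0)"
    using assms by (intro sobolev_coeffs_summable_weighted) auto
  from summable_rabs_cancel[OF summable_trig_deriv[OF this, of t]]
  show ?thesis unfolding trig_series_def trig_deriv_0 by (rule summable_sums)
qed

lemma sobolev_coeffs_cmult: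
  "sobolev_coeffs m c \<Longrightarrow> sobolev_coeffs m (\<lambda>i. a * c i)"
  unfolding sobolev_coeffs_def
  using summable_mult[of "\<lambda>i. (c i)\<^sup>2 * trig_eigenvalue m (Suc i)" "a\<^sup>2"]
  by (simp add: power_mult_distrib mult.assoc)

lemma sobolev_coeffs_product_summable:
  assumes "sobolev_coeffs m c" "sobolev_coeffs m d"
  shows "summable (\<lambda>i. c i * d i * trig_eigenvalue m (Suc i))"
proof (rule summable_comparison_test')
  show "summable (\<lambda>i. (c i)\<^sup>2 * trig_eigenvalue m (Suc i) + (d i)\<^sup>2 * trig_eigenvalue m (Suc i))"
    using assms by (intro summable_add) (auto simp: sobolev_coeffs_def)
  fix i :: nat
  have "\<bar>c i * d i\<bar> \<le> (c i)\<^sup>2 + (d i)\<^sup>2"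
    using sum_squares_bound[of "\<bar>c i\<bar>" "\<bar>d i\<bar>"] abs_ge_zero[of "c i * d i"]
    unfolding power2_abs mult.assoc abs_mult[symmetric] by linarith
  then have "\<bar>c i * d i\<bar> * trig_eigenvalue m (Suc i) \<le> ((c i)\<^sup>2 + (d i)\<^sup>2) * trig_eigenvalue m (Suc i)"
    using trig_eigenvalue_pos[of m i] by (intro mult_right_mono) auto
  then show "norm (c i * d i * trig_eigenvalue m (Suc i))
     \<le> (c i)\<^sup>2 * trig_eigenvalue m (Suc i) + (d i)\<^sup>2 * trig_eigenvalue m (Suc i)"
    using trig_eigenvalue_pos[of m i] by (simp add: abs_mult distrib_right)
qed

lemma sobolev_coeffs_add:
  assumes "sobolev_coeffs m c" "sobolev_coeffs m d"
  shows "sobolev_coeffs m (\<lambda>i. c i + d i)"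
  unfolding sobolev_coeffs_def
proof -
  have "summable (\<lambda>i. (c i)\<^sup>2 * trig_eigenvalue m (Suc i) + (d i)\<^sup>2 * trig_eigenvalue m (Suc i)
      + 2 * (c i * d i * trig_eigenvalue m (Suc i)))"
    using assms sobolev_coeffs_product_summable[OF assms]
    by (intro summable_add summable_mult) (auto simp: sobolev_coeffs_def)
  then show "summable (\<lambda>i. (c i + d i)\<^sup>2 * trig_eigenvalue m (Suc i))"
    by (simp add: power2_sum algebra_simps)
qed

lemma trig_series_add:
  assumes "m \<ge> 1" "sobolev_coeffs m c" "sobolev_coeffs m d"
  shows "trig_series (\<lambda>i. c i + d i) t = trig_series c t + trig_series d t"
  using sums_add[OF trig_series_sums[OF assms(1,2)] trig_series_sums[OF assms(1,3)], of t t]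
    trig_series_sums[OF assms(1) sobolev_coeffs_add[OF assms(2,3)], of t]
  by (simp add: distrib_right sums_unique2)

lemma trig_series_cmult:
  assumes "m \<ge> 1" "sobolev_coeffs m c"
  shows "trig_series (\<lambda>i. a * c i) t = a * trig_series c t"
  using sums_mult[OF trig_series_sums[OF assms, of t], of a]
    trig_series_sums[OF assms(1) sobolev_coeffs_cmult[OF assms(2)], of a t]
  by (simp add: mult.assoc sums_unique2)

text \<open>The criterion is quadratic, and \<open>normal\<close> says that its derivative at \<open>c\<close> vanishes along every
basis function. Only the pure second order terms in \<open>d\<close> remain.\<close>

lemma penalized_loss_excess:
  fixes s n j :: nat
  defines "x \<equiv> \<lambda>i. real (obs_index s i j) / real (s * n)"
  assumes m: "m \<ge> 1" and n: "n > 0" and c: "sobolev_coeffs m c" and d: "sobolev_coeffs m d"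
    and normal: "\<And>v. 1 / real n * (\<Sum>i = 1..n. (y (obs_index s i j) - trig_series c (x i)) * trig_basis (Suc v) (x i))
        = lam * trig_eigenvalue m (Suc v) * c v"
  shows "penalized_loss m s n lam y j (trig_series (\<lambda>i. c i + d i))
     = penalized_loss m s n lam y j (trig_series c)
       + 1 / (2 * real n) * (\<Sum>i = 1..n. (trig_series d (x i))\<^sup>2)
       + lam / 2 * (\<Sum>i. (d i)\<^sup>2 * trig_eigenvalue m (Suc i))"
proof -
  let ?r = "\<lambda>i. y (obs_index s i j) - trig_series c (x i)"
  let ?G = "\<lambda>c. \<Sum>i. (c i)\<^sup>2 * trig_eigenvalue m (Suc i)"
  let ?P = "\<Sum>i. c i * d i * trig_eigenvalue m (Suc i)"
  have cross: "1 / real n * (\<Sum>i = 1..n. ?r i * trig_series d (x i)) = lam * ?P"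
  proof -
    have "(\<lambda>v. 1 / real n * (\<Sum>i = 1..n. ?r i * (d v * trig_basis (Suc v) (x i)))) sums
        (1 / real n * (\<Sum>i = 1..n. ?r i * trig_series d (x i)))"
      by (intro sums_mult sums_sum trig_series_sums[OF m d])
    moreover have "1 / real n * (\<Sum>i = 1..n. ?r i * (d v * trig_basis (Suc v) (x i)))
        = lam * (c v * d v * trig_eigenvalue m (Suc v))" for v
    proof -
      have "1 / real n * (\<Sum>i = 1..n. ?r i * (d v * trig_basis (Suc v) (x i)))
        = d v * (1 / real n * (\<Sum>i = 1..n. ?r i * trig_basis (Suc v) (x i)))"
        by (simp add: sum_distrib_left sum_divide_distrib mult_ac)
      then show ?thesis unfolding normal by (simp add: mult_ac)
    qed
    moreover have "(\<lambda>v. lam * (c v * d v * trig_eigenvalue m (Suc v))) sums (lam * ?P)"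
      by (intro sums_mult summable_sums sobolev_coeffs_product_summable c d)
    ultimately show ?thesis by (simp add: sums_unique2)
  qed
  have G: "?G (\<lambda>i. c i + d i) = ?G c + ?G d + 2 * ?P"
  proof -
    have "?G (\<lambda>i. c i + d i) = (\<Sum>i. (c i)\<^sup>2 * trig_eigenvalue m (Suc i) + (d i)\<^sup>2 * trig_eigenvalue m (Suc i)
      + 2 * (c i * d i * trig_eigenvalue m (Suc i)))"
      by (simp add: power2_sum algebra_simps)
    also have "\<dots> = ?G c + ?G d + 2 * ?P"
      using c d sobolev_coeffs_product_summable[OF c d]
      by (simp add: suminf_add[symmetric] suminf_mult sobolev_coeffs_def summable_add summable_mult)
    finally show ?thesis .
  qed
  have S: "(\<Sum>i = 1..n. (y (obs_index s i j) - trig_series (\<lambda>i. c i + d i) (x i))\<^sup>2)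
      = (\<Sum>i = 1..n. (?r i)\<^sup>2) + (\<Sum>i = 1..n. (trig_series d (x i))\<^sup>2) - 2 * (\<Sum>i = 1..n. ?r i * trig_series d (x i))"
    unfolding trig_series_add[OF m c d] sum_distrib_left sum.distrib[symmetric] sum_subtractf[symmetric]
    by (intro sum.cong refl) (simp add: power2_eq_square algebra_simps)
  have "1 / (2 * real n) * (2 * (\<Sum>i = 1..n. ?r i * trig_series d (x i))) = lam * ?P"
    using cross by simp
  moreover have x: "real (obs_index s i j) / real (s * n) = x i" for i by (simp add: x_def)
  ultimately show ?thesis
    unfolding penalized_loss_def x sobolev_form_trig_series[OF m c]
      sobolev_form_trig_series[OF m sobolev_coeffs_add[OF c d]] G S right_diff_distrib distrib_left
    by linarith
qed

text \<open>The excess of the criterion is at least the penalty of the difference, which is positive definite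
because the space contains no constants. Hence the minimizer exists and is unique, and
\<open>arg_min_on\<close> selects it.\<close>

lemma sub_estimate_unique:
  fixes s n j :: nat
  defines "x \<equiv> \<lambda>i. real (obs_index s i j) / real (s * n)"
  assumes m: "m \<ge> 1" and n: "n > 0" and lam: "lam > 0" and c: "sobolev_coeffs m c"
    and normal: "\<And>v. 1 / real n * (\<Sum>i = 1..n. (y (obs_index s i j) - trig_series c (x i)) * trig_basis (Suc v) (x i))
        = lam * trig_eigenvalue m (Suc v) * c v"
  shows "sub_estimate m s n lam y j = trig_series c"
proof -
  let ?L = "penalized_loss m s n lam y j"
  have excess: "?L (trig_series b) \<ge> ?L (trig_series c) + lam / 2 * (\<Sum>i. (b i - c i)\<^sup>2 * trig_eigenvalue m (Suc i))"
    and coef: "sobolev_coeffs m (\<lambda>i. b i - c i)"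
    if b: "sobolev_coeffs m b" for b
  proof -
    show d: "sobolev_coeffs m (\<lambda>i. b i - c i)"
      using sobolev_coeffs_add[OF b sobolev_coeffs_cmult[OF c, of "-1"]] by simp
    have "0 \<le> 1 / (2 * real n) * (\<Sum>i = 1..n. (trig_series (\<lambda>i. b i - c i) (x i))\<^sup>2)"
      by (intro mult_nonneg_nonneg sum_nonneg) auto
    then show "?L (trig_series b) \<ge> ?L (trig_series c) + lam / 2 * (\<Sum>i. (b i - c i)\<^sup>2 * trig_eigenvalue m (Suc i))"
      using penalized_loss_excess[OF m n c d, of y s j lam] normal by (simp add: x_def)
  qed
  have nonneg: "0 \<le> lam / 2 * (\<Sum>i. (b i - c i)\<^sup>2 * trig_eigenvalue m (Suc i))" if "sobolev_coeffs m b" for b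
    using coef[OF that] lam less_imp_le[OF trig_eigenvalue_pos]
    by (intro mult_nonneg_nonneg suminf_nonneg) (auto simp: sobolev_coeffs_def)
  have min: "is_arg_min ?L (\<lambda>g. g \<in> sobolev m) (trig_series c)"
    unfolding is_arg_min_def sobolev_eq
    using c excess nonneg by (fastforce simp: not_less)
  have unique: "g = trig_series c" if "is_arg_min ?L (\<lambda>g. g \<in> sobolev m) g" for g
  proof -
    from that obtain b where g: "g = trig_series b" and b: "sobolev_coeffs m b"
      by (auto simp: is_arg_min_def sobolev_eq)
    have "\<not> ?L (trig_series c) < ?L (trig_series b)"
      using that c unfolding is_arg_min_def g sobolev_eq by blast
    then have "lam / 2 * (\<Sum>i. (b i - c i)\<^sup>2 * trig_eigenvalue m (Suc i)) = 0"
      using excess[OF b] nonneg[OF b] by linarith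
    then have "(\<Sum>i. (b i - c i)\<^sup>2 * trig_eigenvalue m (Suc i)) = 0" using lam by simp
    then have "(b i - c i)\<^sup>2 * trig_eigenvalue m (Suc i) = 0" for i
      using suminf_eq_zero_iff[of "\<lambda>i. (b i - c i)\<^sup>2 * trig_eigenvalue m (Suc i)"] coef[OF b]
        less_imp_le[OF trig_eigenvalue_pos] by (auto simp: sobolev_coeffs_def)
    then have "b = c" using trig_eigenvalue_pos[of m] by (auto simp: fun_eq_iff less_le)
    then show ?thesis by (simp add: g)
  qed
  show ?thesis
    unfolding sub_estimate_def arg_min_on_def arg_min_def
    by (rule unique[OF someI[of "is_arg_min ?L (\<lambda>g. g \<in> sobolev m)", OF min]])
qed

text \<open>
Coefficients of the fit to data on the shifted grid \<open>\<tau> + l / n\<close>, \<open>l < n\<close>, on which the data of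
every machine sit.\<close>

definition fit_coeff :: "nat \<Rightarrow> nat \<Rightarrow> real \<Rightarrow> real \<Rightarrow> (nat \<Rightarrow> real) \<Rightarrow> nat \<Rightarrow> real" where
  "fit_coeff m n lam \<tau> Y i = filter_weight m n lam (freq (Suc i)) *
     (1 / real n * (\<Sum>l<n. Y l * trig_basis (Suc i) (\<tau> + real l / real n)))"

lemma trig_eigenvalue_inverse_penalty:
  "lam > 0 \<Longrightarrow> trig_eigenvalue m (Suc i) * inverse_penalty m lam (freq (Suc i)) = 1 / lam"
  by (simp add: trig_eigenvalue_def inverse_penalty_def)

text \<open>The weights are at most the inverse penalties, and one of the two factors \<open>inverse_penalty\<close> in the
squared coefficient compensates the eigenvalue.\<close>

lemma sobolev_coeffs_weighted_bounded:
  assumes m: "m \<ge> 1" and lam: "lam > 0" and B: "\<And>i. \<bar>b i\<bar> \<le> B"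
  shows "sobolev_coeffs m (\<lambda>i. filter_weight m n lam (freq (Suc i)) * b i)"
  unfolding sobolev_coeffs_def
proof (rule summable_comparison_test')
  show "summable (\<lambda>i. B\<^sup>2 / lam * (1 / lam * (1 / (real (freq (Suc i)))\<^sup>2)))"
    by (intro summable_mult summable_inverse_freq_square)
  fix i :: nat
  let ?k = "freq (Suc i)"
  have k: "?k > 0" by simp
  have w: "0 < filter_weight m n lam ?k" "filter_weight m n lam ?k \<le> inverse_penalty m lam ?k"
    using filter_weight_pos[OF m lam k] filter_weight_le_inverse_penalty[OF m lam k] by auto
  have "(filter_weight m n lam ?k * b i)\<^sup>2 * trig_eigenvalue m (Suc i)
      \<le> ((inverse_penalty m lam ?k)\<^sup>2 * B\<^sup>2) * trig_eigenvalue m (Suc i)"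
  proof -
    have "\<bar>b i\<bar>\<^sup>2 \<le> B\<^sup>2" using B[of i] by (intro power_mono) auto
    then show ?thesis
      unfolding power_mult_distrib using w trig_eigenvalue_pos[of m i]
      by (intro mult_right_mono mult_mono[OF power_mono]) auto
  qed
  also have "\<dots> = B\<^sup>2 * inverse_penalty m lam ?k * (trig_eigenvalue m (Suc i) * inverse_penalty m lam ?k)"
    by (simp add: power2_eq_square)
  also have "\<dots> = B\<^sup>2 / lam * inverse_penalty m lam ?k"
    unfolding trig_eigenvalue_inverse_penalty[OF lam] by simp
  also have "\<dots> \<le> B\<^sup>2 / lam * (1 / lam * (1 / (real ?k)\<^sup>2))"
    using inverse_penalty_le[OF m lam k] lam by (intro mult_left_mono) auto
  finally show "norm ((filter_weight m n lam ?k * b i)\<^sup>2 * trig_eigenvalue m (Suc i))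
      \<le> B\<^sup>2 / lam * (1 / lam * (1 / (real ?k)\<^sup>2))"
    using trig_eigenvalue_pos[of m i] by simp
qed

lemma grid_coefficient_bound:
  assumes "\<And>l. l < n \<Longrightarrow> \<bar>b l\<bar> \<le> sqrt 2"
  shows "\<bar>1 / real n * (\<Sum>l<n. Y l * b l)\<bar> \<le> sqrt 2 * (1 / real n * (\<Sum>l<n. \<bar>Y l\<bar>))"
proof -
  have "\<bar>\<Sum>l<n. Y l * b l\<bar> \<le> (\<Sum>l<n. \<bar>Y l\<bar> * sqrt 2)"
    using assms by (intro order_trans[OF sum_abs] sum_mono) (auto simp: abs_mult intro!: mult_left_mono)
  then have "1 / real n * \<bar>\<Sum>l<n. Y l * b l\<bar> \<le> 1 / real n * (\<Sum>l<n. \<bar>Y l\<bar> * sqrt 2)"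
    by (intro mult_left_mono) auto
  then show ?thesis by (simp add: abs_mult sum_distrib_right[symmetric] mult_ac)
qed

lemma fit_coeff_sobolev:
  assumes "m \<ge> 1" "lam > 0"
  shows "sobolev_coeffs m (fit_coeff m n lam \<tau> Y)"
proof -
  have "sobolev_coeffs m (\<lambda>i. filter_weight m n lam (freq (Suc i)) *
     (1 / real n * (\<Sum>l<n. Y l * trig_basis (Suc i) (\<tau> + real l / real n))))"
    by (rule sobolev_coeffs_weighted_bounded[OF assms]) (rule grid_coefficient_bound, rule trig_basis_bound)
  then show ?thesis unfolding fit_coeff_def .
qed

lemma sums_pairs: "f sums (S::real) \<Longrightarrow> (\<lambda>k. \<Sum>i\<in>{k * 2..<k * 2 + 2}. f i) sums S"
  using sums_group[of f S 2] by simp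

lemma freq_pair: "i \<in> {k * 2..<k * 2 + 2} \<Longrightarrow> freq (Suc i) = Suc k"
  by auto

text \<open>The fitted values at the grid points are computed with \<open>kernel_average\<close>: their empirical
coefficient at \<open>q\<close> is that of the data, times the total fraction from \<open>filter_weight_sums\<close>. The
unexplained fraction is what \<open>filter_weight_normal_equation\<close> balances against the penalty.\<close>

lemma fit_coeff_normal_equation:
  fixes \<tau> :: real
  assumes m: "m \<ge> 1" and lam: "lam > 0" and n: "n > 0"
  defines "x \<equiv> \<lambda>l. \<tau> + real l / real n"
  shows "1 / real n * (\<Sum>l<n. (Y l - trig_series (fit_coeff m n lam \<tau> Y) (x l)) * trig_basis (Suc v) (x l))
     = lam * trig_eigenvalue m (Suc v) * fit_coeff m n lam \<tau> Y v"
proof -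
  let ?c = "fit_coeff m n lam \<tau> Y" and ?w = "filter_weight m n lam" and ?q = "freq (Suc v)"
  let ?D = "1 / real n * (\<Sum>l<n. Y l * trig_basis (Suc v) (x l))"
  let ?W = "alias_mass m n lam ?q / (1 + alias_mass m n lam ?q)"
  have series: "(\<lambda>k. ?w (Suc k) * (1 / real n * (\<Sum>l'<n. Y l' * (2 * cos (2 * pi * real (Suc k) * (t - x l')))))) sums
      trig_series ?c t" for t
  proof -
    have "(\<Sum>i\<in>{k * 2..<k * 2 + 2}. ?c i * trig_basis (Suc i) t)
        = ?w (Suc k) * (1 / real n * (\<Sum>l'<n. Y l' * (2 * cos (2 * pi * real (Suc k) * (t - x l')))))" for k
    proof -
      have "(\<Sum>i\<in>{k * 2..<k * 2 + 2}. ?c i * trig_basis (Suc i) t)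
         = (\<Sum>i\<in>{k * 2..<k * 2 + 2}. ?w (Suc k) * (1 / real n *
              (\<Sum>l'<n. Y l' * (trig_basis (Suc i) t * trig_basis (Suc i) (x l')))))"
      proof (intro sum.cong refl)
        fix i assume "i \<in> {k * 2..<k * 2 + 2}"
        then have f: "freq (Suc i) = Suc k" by (rule freq_pair)
        show "?c i * trig_basis (Suc i) t = ?w (Suc k) * (1 / real n *
              (\<Sum>l'<n. Y l' * (trig_basis (Suc i) t * trig_basis (Suc i) (x l'))))"
          unfolding fit_coeff_def f x_def sum_distrib_left sum_distrib_right by (simp only: mult_ac)
      qed
      also have "\<dots> = ?w (Suc k) * (1 / real n *
              (\<Sum>l'<n. Y l' * (\<Sum>i\<in>{k * 2..<k * 2 + 2}. trig_basis (Suc i) t * trig_basis (Suc i) (x l'))))"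
        unfolding sum_distrib_left[symmetric] by (subst sum.swap) (simp only: sum_distrib_left)
      finally show ?thesis unfolding trig_basis_pair_sum .
    qed
    then show ?thesis using sums_pairs[OF trig_series_sums[OF m fit_coeff_sobolev[OF m lam], of n \<tau> Y t]] by simp
  qed
  have "(\<lambda>k. \<Sum>l<n. ?w (Suc k) * (1 / real n * (\<Sum>l'<n. Y l' * (2 * cos (2 * pi * real (Suc k) * (x l - x l'))))) * trig_basis (Suc v) (x l)) sums
      (\<Sum>l<n. trig_series ?c (x l) * trig_basis (Suc v) (x l))"
    by (intro sums_sum sums_mult2 series)
  moreover have "(\<Sum>l<n. ?w (Suc k) * (1 / real n * (\<Sum>l'<n. Y l' * (2 * cos (2 * pi * real (Suc k) * (x l - x l'))))) * trig_basis (Suc v) (x l))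
     = real n * ?D * (aliases n (Suc k) ?q * ?w (Suc k))" for k
  proof -
    have "(\<Sum>l<n. ?w (Suc k) * (1 / real n * (\<Sum>l'<n. Y l' * (2 * cos (2 * pi * real (Suc k) * (x l - x l'))))) * trig_basis (Suc v) (x l))
      = ?w (Suc k) * (1 / real n) * (\<Sum>l'<n. Y l' * (sqrt 2 * (\<Sum>l<n. 2 * cos (2 * pi * real (Suc k) * (x l - x l')) * cos (2 * pi * real ?q * x l + phase (Suc v)))))"
      unfolding trig_basis_phase sum_distrib_left sum_distrib_right
      by (subst sum.swap) (simp only: mult_ac)
    also have "\<dots> = ?w (Suc k) * (1 / real n) * (\<Sum>l'<n. Y l' * (sqrt 2 * (real n * (aliases n (Suc k) ?q * cos (2 * pi * real ?q * x l' + phase (Suc v))))))"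
      unfolding x_def kernel_average[OF n] ..
    also have "\<dots> = real n * ?D * (aliases n (Suc k) ?q * ?w (Suc k))"
      unfolding trig_basis_phase sum_distrib_left sum_distrib_right by (simp only: mult_ac)
    finally show ?thesis .
  qed
  ultimately have "(\<lambda>k. real n * ?D * (aliases n (Suc k) ?q * ?w (Suc k))) sums
      (\<Sum>l<n. trig_series ?c (x l) * trig_basis (Suc v) (x l))" by simp
  moreover have "(\<lambda>k. real n * ?D * (aliases n (Suc k) ?q * ?w (Suc k))) sums (real n * ?D * ?W)"
    by (intro sums_mult filter_weight_sums m lam)
  ultimately have fit: "(\<Sum>l<n. trig_series ?c (x l) * trig_basis (Suc v) (x l)) = real n * ?D * ?W"
    by (rule sums_unique2)
  have "1 / real n * (\<Sum>l<n. (Y l - trig_series ?c (x l)) * trig_basis (Suc v) (x l)) = ?D - ?D * ?W"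
    unfolding left_diff_distrib sum_subtractf fit using n by (simp add: right_diff_distrib)
  also have "\<dots> = ?D * (1 - ?W)" by (simp only: right_diff_distrib mult_1_right)
  also have "1 - ?W = lam * trig_eigenvalue m (Suc v) * ?w ?q"
    unfolding trig_eigenvalue_def using filter_weight_normal_equation[OF m lam, of ?q n] by simp
  finally show ?thesis unfolding fit_coeff_def x_def by (simp only: mult_ac)
qed

lemma obs_index_Suc: "j \<ge> 1 \<Longrightarrow> obs_index s (Suc i) j = i * s + (j - 1)"
  by (simp add: obs_index_def)

lemma sum_from_1: "(\<Sum>i = 1..n. f i) = (\<Sum>l<n. f (Suc l))"
  by (simp add: sum.atLeast1_atMost_eq)

lemma sub_estimate_eq:
  assumes m: "m \<ge> 1" and lam: "lam > 0" and n: "n > 0" and s: "s > 0" and j: "j \<ge> 1"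
  shows "sub_estimate m s n lam y j =
     trig_series (fit_coeff m n lam (real (j - 1) / real (s * n)) (\<lambda>l. y (l * s + (j - 1))))"
proof (rule sub_estimate_unique[OF m n lam fit_coeff_sobolev[OF m lam]])
  fix v
  have x: "real (l * s + (j - 1)) / real (s * n) = real (j - 1) / real (s * n) + real l / real n" for l
    using n s by (simp add: field_simps)
  show "1 / real n * (\<Sum>i = 1..n. (y (obs_index s i j) - trig_series (fit_coeff m n lam (real (j - 1) / real (s * n)) (\<lambda>l. y (l * s + (j - 1)))) (real (obs_index s i j) / real (s * n))) *
      trig_basis (Suc v) (real (obs_index s i j) / real (s * n)))
    = lam * trig_eigenvalue m (Suc v) * fit_coeff m n lam (real (j - 1) / real (s * n)) (\<lambda>l. y (l * s + (j - 1))) v"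
    unfolding sum_from_1 x obs_index_Suc[OF j]
    by (rule fit_coeff_normal_equation[OF m lam n])
qed

section \<open>The test statistic as a diagonal quadratic form\<close>

definition empirical_coeff :: "nat \<Rightarrow> (nat \<Rightarrow> real) \<Rightarrow> nat \<Rightarrow> real" where
  "empirical_coeff N y i = 1 / real N * (\<Sum>l<N. y l * trig_basis (Suc i) (real l / real N))"

lemma trig_series_sum:
  assumes "m \<ge> 1" "finite I" "\<And>j. j \<in> I \<Longrightarrow> sobolev_coeffs m (c j)"
  shows "sobolev_coeffs m (\<lambda>i. \<Sum>j\<in>I. c j i) \<and> (trig_series (\<lambda>i. \<Sum>j\<in>I. c j i) t = (\<Sum>j\<in>I. trig_series (c j) t))"
  using assms(2,3)
proof (induction I)
  case empty
  then show ?case by (simp add: sobolev_coeffs_def trig_series_def)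
next
  case (insert j I)
  then show ?case
    using sobolev_coeffs_add[of m "c j" "\<lambda>i. \<Sum>j\<in>I. c j i"]
      trig_series_add[OF assms(1), of "c j" "\<lambda>i. \<Sum>j\<in>I. c j i" t] by simp
qed

text \<open>The weights do not depend on the shift of the grid, so averaging over machines only
reassembles the full empirical coefficient over all \<open>s * n\<close> points.\<close>

lemma machine_coefficients_average:
  assumes n: "n > 0" and s: "s > 0"
  shows "1 / real s * (\<Sum>j = 1..s. fit_coeff m n lam (real (j - 1) / real (s * n)) (\<lambda>l. y (l * s + (j - 1))) i)
    = filter_weight m n lam (freq (Suc i)) * empirical_coeff (s * n) y i"
proof -
  let ?F = "\<lambda>l. y l * trig_basis (Suc i) (real l / real (s * n))"
  have x: "real j / real (s * n) + real l / real n = real (l * s + j) / real (s * n)" for j l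
    using n s by (simp add: field_simps)
  have "(\<Sum>j = 1..s. fit_coeff m n lam (real (j - 1) / real (s * n)) (\<lambda>l. y (l * s + (j - 1))) i)
    = filter_weight m n lam (freq (Suc i)) * (1 / real n * (\<Sum>j<s. \<Sum>l<n. ?F (l * s + j)))"
    unfolding sum_from_1 fit_coeff_def diff_Suc_1 x sum_distrib_left ..
  also have "(\<Sum>j<s. \<Sum>l<n. ?F (l * s + j)) = (\<Sum>l<n. \<Sum>j<s. ?F (l * s + j))"
    by (rule sum.swap)
  also have "\<dots> = (\<Sum>l<n. sum ?F {l * s..<l * s + s})"
  proof (rule sum.cong[OF refl])
    fix l
    show "(\<Sum>j<s. ?F (l * s + j)) = sum ?F {l * s..<l * s + s}"
      using sum.shift_bounds_nat_ivl[of ?F 0 "l * s" s] by (simp add: lessThan_atLeast0 add.commute)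
  qed
  also have "\<dots> = sum ?F {..<s * n}" using sum.nat_group[of ?F s n] by (simp add: mult.commute)
  finally show ?thesis unfolding empirical_coeff_def by simp
qed

lemma avg_estimate_eq:
  assumes m: "m \<ge> 1" and lam: "lam > 0" and n: "n > 0" and s: "s > 0"
  shows "avg_estimate m s n lam y = trig_series (\<lambda>i. filter_weight m n lam (freq (Suc i)) * empirical_coeff (s * n) y i)"
proof
  fix t
  let ?c = "\<lambda>j. fit_coeff m n lam (real (j - 1) / real (s * n)) (\<lambda>l. y (l * s + (j - 1)))"
  have sum: "sobolev_coeffs m (\<lambda>i. \<Sum>j\<in>{1..s}. ?c j i)"
      "trig_series (\<lambda>i. \<Sum>j\<in>{1..s}. ?c j i) t = (\<Sum>j\<in>{1..s}. trig_series (?c j) t)"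
    using trig_series_sum[OF m, of "{1..s}" ?c t] fit_coeff_sobolev[OF m lam] by auto
  have "avg_estimate m s n lam y t = 1 / real s * (\<Sum>j = 1..s. trig_series (?c j) t)"
    unfolding avg_estimate_def using sub_estimate_eq[OF m lam n s] by simp
  also have "\<dots> = trig_series (\<lambda>i. 1 / real s * (\<Sum>j\<in>{1..s}. ?c j i)) t"
    using trig_series_cmult[OF m sum(1), of "1 / real s" t] sum(2) by simp
  finally show "avg_estimate m s n lam y t
      = trig_series (\<lambda>i. filter_weight m n lam (freq (Suc i)) * empirical_coeff (s * n) y i) t"
    unfolding machine_coefficients_average[OF n s] .
qed

lemma test_stat_eq_suminf:
  assumes m: "m \<ge> 1" and lam: "lam > 0" and n: "n > 0" and s: "s > 0"
  shows "(\<lambda>i. (filter_weight m n lam (freq (Suc i)) * empirical_coeff (s * n) y i)\<^sup>2) sums test_stat m s n lam y"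
proof -
  have c: "sobolev_coeffs m (\<lambda>i. filter_weight m n lam (freq (Suc i)) * empirical_coeff (s * n) y i)"
    unfolding empirical_coeff_def
    by (rule sobolev_coeffs_weighted_bounded[OF m lam]) (rule grid_coefficient_bound, rule trig_basis_bound)
  have "summable (\<lambda>i. (filter_weight m n lam (freq (Suc i)) * empirical_coeff (s * n) y i)\<^sup>2)"
  proof (rule summable_comparison_test')
    show "summable (\<lambda>i. (filter_weight m n lam (freq (Suc i)) * empirical_coeff (s * n) y i)\<^sup>2 * trig_eigenvalue m (Suc i))"
      using c by (simp add: sobolev_coeffs_def)
    fix i :: nat
    have "1 * 1 \<le> (2 * pi) * real (freq (Suc i))" using pi_gt3 by (intro mult_mono) auto
    then have "1 \<le> trig_eigenvalue m (Suc i)" unfolding trig_eigenvalue_def by (intro one_le_power) simp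
    then show "norm ((filter_weight m n lam (freq (Suc i)) * empirical_coeff (s * n) y i)\<^sup>2)
       \<le> (filter_weight m n lam (freq (Suc i)) * empirical_coeff (s * n) y i)\<^sup>2 * trig_eigenvalue m (Suc i)"
      by (simp add: mult_le_cancel_left1)
  qed
  then show ?thesis
    unfolding test_stat_def avg_estimate_eq[OF m lam n s] L2norm_trig_series[OF m c] by (rule summable_sums)
qed

text \<open>
The real discrete Fourier basis of Hartley, with \<open>cos (x - pi / 4) = (cos x + sin x) / sqrt 2\<close>.
In contrast to cosines and sines, one formula covers all residues modulo \<open>N\<close>, including \<open>0\<close> and
\<open>N / 2\<close>.\<close>

definition hartley :: "nat \<Rightarrow> int \<Rightarrow> nat \<Rightarrow> real" where
  "hartley N p l = sqrt (2 / real N) * cos (2 * pi * of_int p * (real l / real N) - pi / 4)"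

lemma hartley_product:
  "hartley N p l * hartley N q l' = 1 / real N *
     (cos (2 * pi * of_int p * (real l / real N) - 2 * pi * of_int q * (real l' / real N))
      + cos (2 * pi * of_int p * (real l / real N) + 2 * pi * of_int q * (real l' / real N) - pi / 2))"
proof -
  have "hartley N p l * hartley N q l' = (sqrt (2 / real N) * sqrt (2 / real N)) *
     (cos (2 * pi * of_int p * (real l / real N) - pi / 4) * cos (2 * pi * of_int q * (real l' / real N) - pi / 4))"
    unfolding hartley_def by (simp only: mult_ac)
  also have "sqrt (2 / real N) * sqrt (2 / real N) = 2 / real N" by simp
  finally show ?thesis unfolding cos_times_cos by (simp add: algebra_simps)
qed

text \<open>In the product formula the difference frequency contributes the diagonal. The sum frequency always
drops out, since its phase is a quarter turn.\<close>

lemma hartley_orthonormal: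
  assumes N: "N > 0" and "p < N" "q < N"
  shows "(\<Sum>l<N. hartley N (int p) l * hartley N (int q) l) = of_bool (p = q)"
proof -
  have "hartley N (int p) l * hartley N (int q) l = 1 / real N *
     (cos (2 * pi * of_int (int p - int q) * (real l / real N) + 0)
      + cos (2 * pi * of_int (int p + int q) * (real l / real N) + (- pi / 2)))" for l
    unfolding hartley_product by (simp add: algebra_simps)
  then have "(\<Sum>l<N. hartley N (int p) l * hartley N (int q) l) = 1 / real N *
     ((if int N dvd int p - int q then real N * cos 0 else 0)
      + (if int N dvd int p + int q then real N * cos (- pi / 2) else 0))"
    by (simp only: sum_distrib_left[symmetric] sum.distrib sum_cos_equispaced[OF N])
  also have "\<dots> = of_bool (int N dvd int p - int q)" using N by simp
  also have "int N dvd int p - int q \<longleftrightarrow> p = q"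
    using assms by (metis mod_eq_dvd_iff mod_less of_nat_eq_iff zmod_int)
  finally show ?thesis .
qed

lemma hartley_cong:
  assumes N: "N > 0" and d: "int N dvd p - q"
  shows "hartley N p l = hartley N q l"
proof -
  obtain z where z: "p - q = int N * z" using d by auto
  then have "real_of_int (p - q) = real_of_int (int N * z)" by (simp only:)
  then have p: "real_of_int p = real_of_int q + real N * real_of_int z" by simp
  have "2 * pi * of_int p * (real l / real N) - pi / 4
      = (2 * pi * of_int q * (real l / real N) - pi / 4) + 2 * pi * of_int (z * int l)"
    unfolding p using N by (simp add: field_simps)
  then show ?thesis
    unfolding hartley_def by (simp only: cos_add cos_int_2pin sin_int_2pin mult_1_right mult_zero_right diff_0_right)
qed

definition hartley_coeff :: "nat \<Rightarrow> (nat \<Rightarrow> real) \<Rightarrow> int \<Rightarrow> real" where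
  "hartley_coeff N y p = (\<Sum>l<N. hartley N p l * y l)"

text \<open>The eigenvalues of the test statistic as a quadratic form in the data: the squared weights of all
frequencies that are aliases of \<open>p\<close> on the full grid of \<open>N\<close> points.\<close>

definition noise_weight :: "nat \<Rightarrow> nat \<Rightarrow> nat \<Rightarrow> real \<Rightarrow> nat \<Rightarrow> real" where
  "noise_weight m N n lam p = 1 / real N * (\<Sum>k. aliases N (Suc k) p * (filter_weight m n lam (Suc k))\<^sup>2)"

text \<open>Cosine and sine power at one frequency add up to the Hartley power at that frequency and at its
negative, because the \<open>sin (\<theta> + \<theta>')\<close> parts of the two Hartley products cancel.\<close>

lemma empirical_pair_hartley:
  assumes N: "N > 0"
  shows "(\<Sum>i\<in>{k * 2..<k * 2 + 2}. (empirical_coeff N y i)\<^sup>2)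
    = 1 / real N * ((hartley_coeff N y (int (Suc k)))\<^sup>2 + (hartley_coeff N y (- int (Suc k)))\<^sup>2)"
proof -
  let ?x = "\<lambda>l. real l / real N" and ?k = "int (Suc k)"
  have "(\<Sum>i\<in>{k * 2..<k * 2 + 2}. (empirical_coeff N y i)\<^sup>2)
     = (\<Sum>i\<in>{k * 2..<k * 2 + 2}. 1 / (real N)\<^sup>2 * (\<Sum>l<N. \<Sum>l'<N. y l * y l' * (trig_basis (Suc i) (?x l) * trig_basis (Suc i) (?x l'))))"
  proof (rule sum.cong[OF refl])
    fix i
    let ?S = "\<Sum>l<N. y l * trig_basis (Suc i) (?x l)"
    have "(empirical_coeff N y i)\<^sup>2 = 1 / (real N)\<^sup>2 * (?S * ?S)"
      by (simp add: empirical_coeff_def power_divide power2_eq_square)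
    also have "?S * ?S = (\<Sum>l<N. \<Sum>l'<N. y l * y l' * (trig_basis (Suc i) (?x l) * trig_basis (Suc i) (?x l')))"
      unfolding sum_product by (intro sum.cong refl) (simp only: mult_ac)
    finally show "(empirical_coeff N y i)\<^sup>2 = 1 / (real N)\<^sup>2 *
      (\<Sum>l<N. \<Sum>l'<N. y l * y l' * (trig_basis (Suc i) (?x l) * trig_basis (Suc i) (?x l')))" .
  qed
  also have "\<dots> = 1 / (real N)\<^sup>2 * (\<Sum>l<N. \<Sum>l'<N. y l * y l' * (\<Sum>i\<in>{k * 2..<k * 2 + 2}. trig_basis (Suc i) (?x l) * trig_basis (Suc i) (?x l')))"
    unfolding sum_distrib_left by (subst sum.swap, rule sum.cong[OF refl], rule sum.swap)
  also have "\<dots> = 1 / (real N)\<^sup>2 * (\<Sum>l<N. \<Sum>l'<N. y l * y l' * (2 * cos (2 * pi * real (Suc k) * (?x l - ?x l'))))"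
    unfolding trig_basis_pair_sum ..
  also have "\<dots> = 1 / real N * (\<Sum>l<N. \<Sum>l'<N. y l * y l' *
      (hartley N ?k l * hartley N ?k l' + hartley N (- ?k) l * hartley N (- ?k) l'))"
  proof -
    have "hartley N ?k l * hartley N ?k l' + hartley N (- ?k) l * hartley N (- ?k) l'
       = 1 / real N * (2 * cos (2 * pi * real (Suc k) * (?x l - ?x l')))" for l l'
    proof -
      define a b where "a = 2 * pi * real (Suc k) * ?x l" and "b = 2 * pi * real (Suc k) * ?x l'"
      have ab: "2 * pi * of_int ?k * ?x l = a" "2 * pi * of_int ?k * ?x l' = b"
        "2 * pi * of_int (- ?k) * ?x l = - a" "2 * pi * of_int (- ?k) * ?x l' = - b"
        "2 * pi * real (Suc k) * (?x l - ?x l') = a - b"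
        by (simp_all add: a_def b_def algebra_simps)
      have "cos (a + b - pi / 2) = sin (a + b)" "cos (- a + - b - pi / 2) = - sin (a + b)" "cos (- a - - b) = cos (a - b)"
        using sin_minus[of "a + b"] cos_minus[of "a - b"] by (simp_all add: cos_diff add.commute)
      then show ?thesis unfolding hartley_product ab by (simp add: algebra_simps)
    qed
    then show ?thesis unfolding power2_eq_square by (simp add: sum_distrib_left mult_ac)
  qed
  also have "(\<Sum>l<N. \<Sum>l'<N. y l * y l' *
      (hartley N ?k l * hartley N ?k l' + hartley N (- ?k) l * hartley N (- ?k) l'))
     = (hartley_coeff N y ?k)\<^sup>2 + (hartley_coeff N y (- ?k))\<^sup>2"
    unfolding hartley_coeff_def power2_eq_square sum_product sum.distrib[symmetric]
    by (intro sum.cong refl) (simp only: distrib_left mult_ac)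
  finally show ?thesis .
qed

lemma sum_aliases_hartley:
  assumes N: "N > 0"
  shows "(\<Sum>p<N. aliases N k p * (hartley_coeff N y (int p))\<^sup>2)
    = (hartley_coeff N y (int k))\<^sup>2 + (hartley_coeff N y (- int k))\<^sup>2"
proof -
  have pick: "(\<Sum>p<N. of_bool (int N dvd z - int p) * (hartley_coeff N y (int p))\<^sup>2) = (hartley_coeff N y z)\<^sup>2" for z
  proof -
    have r: "int (nat (z mod int N)) = z mod int N" using N by simp
    have "int N dvd z mod int N - z" by (simp add: mod_eq_dvd_iff[symmetric])
    then have "hartley_coeff N y (z mod int N) = hartley_coeff N y z"
      unfolding hartley_coeff_def using hartley_cong[OF N] by simp
    then show ?thesis unfolding sum_residue_class[OF N] r by simp
  qed
  have neg: "int N dvd int k + int p \<longleftrightarrow> int N dvd - int k - int p" for p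
    using dvd_minus_iff[of "int N" "int k + int p"] by (simp add: algebra_simps)
  show ?thesis
    unfolding aliases_def distrib_right sum.distrib neg pick ..
qed

lemma filter_weight_le_1:
  assumes "m \<ge> 1" "lam > 0" "n > 0" "k > 0"
  shows "filter_weight m n lam k \<le> 1"
proof -
  have "inverse_penalty m lam k \<le> alias_mass m n lam k"
    by (rule alias_mass_ge_term[OF assms(1,2,4)]) (simp add: aliases_def)
  then show ?thesis
    using alias_mass_nonneg[OF assms(1,2), of n k] by (simp add: filter_weight_def divide_le_eq)
qed

lemma noise_weight_summable:
  assumes "m \<ge> 1" "lam > 0" "n > 0"
  shows "summable (\<lambda>k. aliases N (Suc k) p * (filter_weight m n lam (Suc k))\<^sup>2)"
proof (rule summable_aliases_times)
  show "summable (\<lambda>k. (filter_weight m n lam (Suc k))\<^sup>2)"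
  proof (rule summable_comparison_test'[OF summable_inverse_penalty[OF assms(1,2)]])
    fix k
    have w: "0 < filter_weight m n lam (Suc k)" "filter_weight m n lam (Suc k) \<le> 1"
      "filter_weight m n lam (Suc k) \<le> inverse_penalty m lam (Suc k)"
      using filter_weight_pos[OF assms(1,2)] filter_weight_le_1[OF assms] filter_weight_le_inverse_penalty[OF assms(1,2)]
      by auto
    then have "(filter_weight m n lam (Suc k))\<^sup>2 \<le> filter_weight m n lam (Suc k)"
      by (simp add: power2_eq_square mult_le_cancel_left2)
    then show "norm ((filter_weight m n lam (Suc k))\<^sup>2) \<le> inverse_penalty m lam (Suc k)"
      using w by simp
  qed
qed simp

text \<open>By Parseval's identity the statistic is the sum of the squared coefficients of the averaged
estimator. The cosine and sine coefficients of each frequency are paired and expressed by Hartley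
coefficients, which depend only on the residue modulo \<open>N\<close>; collecting residues gives the weights.\<close>

theorem test_stat_diagonal:
  assumes m: "m \<ge> 1" and lam: "lam > 0" and n: "n > 0" and s: "s > 0"
  defines "N \<equiv> s * n"
  shows "test_stat m s n lam y = (\<Sum>p<N. noise_weight m N n lam p * (hartley_coeff N y (int p))\<^sup>2)"
proof -
  let ?w = "filter_weight m n lam"
  have N: "N > 0" using n s by (simp add: N_def)
  have "(\<lambda>k. \<Sum>i\<in>{k * 2..<k * 2 + 2}. (?w (freq (Suc i)) * empirical_coeff N y i)\<^sup>2) sums test_stat m s n lam y"
    unfolding N_def by (rule sums_pairs[OF test_stat_eq_suminf[OF m lam n s]])
  moreover have "(\<Sum>i\<in>{k * 2..<k * 2 + 2}. (?w (freq (Suc i)) * empirical_coeff N y i)\<^sup>2)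
     = (\<Sum>p<N. 1 / real N * (aliases N (Suc k) p * (?w (Suc k))\<^sup>2) * (hartley_coeff N y (int p))\<^sup>2)" for k
  proof -
    have "(\<Sum>i\<in>{k * 2..<k * 2 + 2}. (?w (freq (Suc i)) * empirical_coeff N y i)\<^sup>2)
      = (?w (Suc k))\<^sup>2 * (\<Sum>i\<in>{k * 2..<k * 2 + 2}. (empirical_coeff N y i)\<^sup>2)"
      unfolding sum_distrib_left
      by (intro sum.cong refl) (simp only: freq_pair power_mult_distrib)
    also have "\<dots> = (?w (Suc k))\<^sup>2 * (1 / real N * (\<Sum>p<N. aliases N (Suc k) p * (hartley_coeff N y (int p))\<^sup>2))"
      unfolding empirical_pair_hartley[OF N] sum_aliases_hartley[OF N] ..
    finally show ?thesis unfolding sum_distrib_left by (simp only: mult_ac)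
  qed
  moreover have "(\<lambda>k. \<Sum>p<N. 1 / real N * (aliases N (Suc k) p * (?w (Suc k))\<^sup>2) * (hartley_coeff N y (int p))\<^sup>2) sums
      (\<Sum>p<N. noise_weight m N n lam p * (hartley_coeff N y (int p))\<^sup>2)"
    unfolding noise_weight_def
    by (intro sums_sum sums_mult2 sums_mult summable_sums noise_weight_summable[OF m lam n])
  ultimately show ?thesis by (simp add: sums_unique2)
qed

section \<open>Size of the weights\<close>

text \<open>Among \<open>n\<close> consecutive integers exactly one is congruent to \<open>p\<close> and exactly one to \<open>- p\<close>.\<close>

lemma sum_aliases_block:
  assumes n: "n > 0"
  shows "(\<Sum>k\<in>{j * n..<j * n + n}. aliases n (Suc k) p) = 2"
proof -
  have "(\<Sum>k\<in>{j * n..<j * n + n}. aliases n (Suc k) p) = (\<Sum>i<n. aliases n (Suc (i + j * n)) p)"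
    using sum.shift_bounds_nat_ivl[of "\<lambda>k. aliases n (Suc k) p" 0 "j * n" n]
    by (simp add: lessThan_atLeast0 add.commute)
  also have "\<dots> = (\<Sum>i<n. of_bool (int n dvd (int p - 1 - int j * int n) - int i) * 1
     + of_bool (int n dvd (- int p - 1 - int j * int n) - int i) * 1)"
  proof (rule sum.cong[OF refl])
    fix i
    have "int n dvd int (Suc (i + j * n)) - int p \<longleftrightarrow> int n dvd (int p - 1 - int j * int n) - int i"
      using dvd_minus_iff[of "int n" "(int p - 1 - int j * int n) - int i"] by (simp add: algebra_simps)
    moreover have "int n dvd int (Suc (i + j * n)) + int p \<longleftrightarrow> int n dvd (- int p - 1 - int j * int n) - int i"
      using dvd_minus_iff[of "int n" "(- int p - 1 - int j * int n) - int i"] by (simp add: algebra_simps)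
    ultimately show "aliases n (Suc (i + j * n)) p = of_bool (int n dvd (int p - 1 - int j * int n) - int i) * 1
     + of_bool (int n dvd (- int p - 1 - int j * int n) - int i) * 1"
      by (simp only: aliases_def mult_1_right)
  qed
  also have "\<dots> = 2" unfolding sum.distrib sum_residue_class[OF n] by simp
  finally show ?thesis .
qed

lemma aliases_nonzero_ge:
  assumes "aliases n k p \<noteq> 0" "2 * p \<le> n" "k > 0"
  shows "p \<le> k"
proof (rule ccontr)
  assume "\<not> p \<le> k"
  have "int n dvd int k - int p \<or> int n dvd int k + int p"
    using assms(1) by (auto simp: aliases_def split: if_splits)
  then show False
  proof
    assume "int n dvd int k - int p"
    then have "int n dvd int p - int k" using dvd_minus_iff[of "int n" "int k - int p"] by simp
    then have "int n \<le> int p - int k" using \<open>\<not> p \<le> k\<close> by (intro zdvd_imp_le) auto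
    then show False using assms by linarith
  next
    assume "int n dvd int k + int p"
    then have "int n \<le> int k + int p" using assms by (intro zdvd_imp_le) auto
    then show False using assms \<open>\<not> p \<le> k\<close> by linarith
  qed
qed

lemma inverse_penalty_ratio:
  assumes "lam > 0" "k > 0" "l > 0"
  shows "inverse_penalty m lam l = inverse_penalty m lam k * (real k / real l) ^ (2 * m)"
  using assms by (simp add: inverse_penalty_def power_mult_distrib power_divide)

lemma inverse_penalty_decreasing:
  assumes "m \<ge> 1" "lam > 0" "k > 0" "x \<ge> 1" "real l \<ge> x * real k"
  shows "inverse_penalty m lam l \<le> inverse_penalty m lam k / x\<^sup>2"
proof -
  have "0 < x * real k" using assms by simp
  then have l: "l > 0" using assms(5) by (cases "l = 0") auto
  have "(real k / real l) ^ (2 * m) \<le> (1 / x) ^ (2 * m)"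
    using assms l by (intro power_mono) (auto simp: field_simps)
  also have "\<dots> \<le> (1 / x) ^ 2" using assms by (intro power_decreasing) auto
  also have "\<dots> = 1 / x\<^sup>2" by (simp add: power_divide)
  finally show ?thesis
    unfolding inverse_penalty_ratio[OF assms(2,3) l]
    using mult_left_mono[OF _ less_imp_le[OF inverse_penalty_pos[OF assms(2,3)]], of _ "1 / x\<^sup>2"]
    by simp
qed

text \<open>For \<open>2 * p \<le> n\<close> the frequency \<open>p\<close> is the lowest of its aliases. In the \<open>j\<close>-th block of \<open>n\<close>
frequencies the aliases exceed \<open>2 * j * p\<close>, so the blocks are dominated by \<open>1 / (4 * j\<^sup>2)\<close>, whose
sum over \<open>j \<ge> 1\<close> is \<open>pi\<^sup>2 / 24\<close>.\<close>

lemma alias_mass_le: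
  assumes m: "m \<ge> 1" and lam: "lam > 0" and n: "n > 0" and p: "p > 0" "2 * p \<le> n"
  shows "alias_mass m n lam p \<le> 4 * inverse_penalty m lam p"
proof -
  let ?x = "inverse_penalty m lam" and ?a = "\<lambda>k. aliases n (Suc k) p"
  \<comment> \<open>Block \<open>0\<close> contains \<open>p\<close> itself and must be bounded separately.\<close>
  define c where "c = (\<lambda>j::nat. if j = 0 then 1 else 1 / (4 * (real j)\<^sup>2))"
  have xp: "?x p > 0" by (rule inverse_penalty_pos[OF lam p(1)])
  have block: "(\<Sum>k\<in>{j * n..<j * n + n}. ?a k * ?x (Suc k)) \<le> 2 * ?x p * c j" for j
  proof -
    have "?a k * ?x (Suc k) \<le> ?a k * (?x p * c j)" if k: "k \<in> {j * n..<j * n + n}" for k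
    proof (cases "?a k = 0")
      case False
      have pk: "p \<le> Suc k" by (rule aliases_nonzero_ge[OF False p(2)]) simp
      have "?x (Suc k) \<le> ?x p * c j"
      proof (cases "j = 0")
        case True
        then show ?thesis using inverse_penalty_decreasing[OF m lam p(1), of 1 "Suc k"] pk by (simp add: c_def)
      next
        case j: False
        have "2 * j * p \<le> j * n" using p(2) by simp
        also have "\<dots> \<le> Suc k" using k by simp
        finally have "real (2 * j * p) \<le> real (Suc k)" by (rule of_nat_mono)
        then have "?x (Suc k) \<le> ?x p / (2 * real j)\<^sup>2"
          using j by (intro inverse_penalty_decreasing[OF m lam p(1)]) auto
        then show ?thesis using j by (simp add: c_def power_mult_distrib)
      qed
      then show ?thesis using aliases_nonneg by (intro mult_left_mono) auto
    qed simp
    then have "(\<Sum>k\<in>{j * n..<j * n + n}. ?a k * ?x (Suc k)) \<le> (\<Sum>k\<in>{j * n..<j * n + n}. ?a k * (?x p * c j))"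
      by (rule sum_mono)
    also have "\<dots> = 2 * ?x p * c j"
      unfolding sum_distrib_right[symmetric] sum_aliases_block[OF n] by simp
    finally show ?thesis .
  qed
  have c_sums: "c sums (1 + 1 / 4 * (pi\<^sup>2 / 6))"
  proof -
    have "(\<lambda>j. 1 / 4 * (1 / (real (j + 1))\<^sup>2)) sums (1 / 4 * (pi\<^sup>2 / 6))"
      by (rule sums_mult) (use inverse_squares_sums in simp)
    then have "(\<lambda>j. c (Suc j)) sums (1 / 4 * (pi\<^sup>2 / 6))" by (simp add: c_def)
    then show ?thesis using sums_Suc[of c "1 / 4 * (pi\<^sup>2 / 6)"] by (simp add: c_def add.commute)
  qed
  have "alias_mass m n lam p \<le> 2 * ?x p * (1 + 1 / 4 * (pi\<^sup>2 / 6))"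
    using block sums_group[OF alias_mass_sums[OF m lam, of n p] n] sums_mult[OF c_sums, of "2 * ?x p"]
    by (rule sums_le)
  also have "\<dots> \<le> 2 * ?x p * 2"
  proof (rule mult_left_mono)
    have "pi\<^sup>2 \<le> 4\<^sup>2" using pi_less_4 by (intro power_mono) auto
    then show "1 + 1 / 4 * (pi\<^sup>2 / 6) \<le> 2" by simp
  qed (use xp in simp)
  finally show ?thesis by simp
qed

lemma filter_weight_ge:
  assumes m: "m \<ge> 1" and lam: "lam > 0" and n: "n > 0" and p: "p > 0" "2 * p \<le> n"
    and x: "inverse_penalty m lam p \<ge> 1"
  shows "1 / 5 \<le> filter_weight m n lam p"
  using alias_mass_le[OF m lam n p] alias_mass_nonneg[OF m lam, of n p] x
  by (simp add: filter_weight_def field_simps)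

lemma noise_weight_ge:
  assumes m: "m \<ge> 1" and lam: "lam > 0" and n: "n > 0" and p: "p > 0"
  shows "(filter_weight m n lam p)\<^sup>2 / real N \<le> noise_weight m N n lam p"
proof -
  let ?f = "\<lambda>k. aliases N (Suc k) p * (filter_weight m n lam (Suc k))\<^sup>2"
  have "1 \<le> aliases N p p" by (simp add: aliases_def)
  then have "(filter_weight m n lam p)\<^sup>2 \<le> aliases N p p * (filter_weight m n lam p)\<^sup>2"
    by (simp add: mult_le_cancel_right1)
  also have "\<dots> = sum ?f {p - 1}" using p by simp
  also have "\<dots> \<le> suminf ?f"
    by (intro sum_le_suminf noise_weight_summable[OF m lam n]) (auto intro!: mult_nonneg_nonneg aliases_nonneg)
  finally show ?thesis unfolding noise_weight_def by (simp add: divide_right_mono)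
qed

lemma noise_weight_nonneg: 
  assumes "m \<ge> 1" "lam > 0" "n > 0"
  shows "0 \<le> noise_weight m N n lam p"
  unfolding noise_weight_def
  by (intro mult_nonneg_nonneg suminf_nonneg noise_weight_summable[OF assms]) (auto intro!: mult_nonneg_nonneg aliases_nonneg)

text \<open>One factor of the squared weight is bounded by \<open>W\<close>. The other is summed over the aliases on the
full grid, which are among those on the coarse grid since \<open>n\<close> divides \<open>N\<close>, and the weights of the
latter sum to at most \<open>1\<close>.\<close>

lemma noise_weight_le_gen:
  assumes m: "m \<ge> 1" and lam: "lam > 0" and n: "n > 0" and dvd: "n dvd N"
    and W: "0 \<le> W" "\<And>k. aliases N (Suc k) p \<noteq> 0 \<Longrightarrow> filter_weight m n lam (Suc k) \<le> W"
  shows "noise_weight m N n lam p \<le> W / real N"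
proof -
  let ?w = "filter_weight m n lam"
  let ?S = "alias_mass m n lam p"
  have S: "0 \<le> ?S" by (rule alias_mass_nonneg[OF m lam])
  have le: "aliases N k p \<le> aliases n k p" for k
  proof -
    have "int n dvd int N" using dvd by simp
    then show ?thesis unfolding aliases_def by (intro add_mono) (auto intro: dvd_trans)
  qed
  have "(\<Sum>k. aliases N (Suc k) p * (?w (Suc k))\<^sup>2) \<le> W * (?S / (1 + ?S))"
  proof (rule sums_le)
    show "(\<lambda>k. aliases N (Suc k) p * (?w (Suc k))\<^sup>2) sums (\<Sum>k. aliases N (Suc k) p * (?w (Suc k))\<^sup>2)"
      by (rule summable_sums[OF noise_weight_summable[OF m lam n]])
    show "(\<lambda>k. W * (aliases n (Suc k) p * ?w (Suc k))) sums (W * (?S / (1 + ?S)))"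
      by (intro sums_mult filter_weight_sums m lam)
    fix k
    have w: "0 < ?w (Suc k)" by (rule filter_weight_pos[OF m lam]) simp
    show "aliases N (Suc k) p * (?w (Suc k))\<^sup>2 \<le> W * (aliases n (Suc k) p * ?w (Suc k))"
    proof (cases "aliases N (Suc k) p = 0")
      case True
      then show ?thesis using W w aliases_nonneg[of n "Suc k" p] by simp
    next
      case False
      have "aliases N (Suc k) p * (?w (Suc k))\<^sup>2 = aliases N (Suc k) p * (?w (Suc k) * ?w (Suc k))"
        by (simp only: power2_eq_square)
      also have "\<dots> \<le> aliases n (Suc k) p * (W * ?w (Suc k))"
        using le[of "Suc k"] W(1) W(2)[OF False] w aliases_nonneg[of n "Suc k" p]
        by (intro mult_mono) auto
      finally show ?thesis by (simp only: mult_ac)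
    qed
  qed
  also have "\<dots> \<le> W * 1" using S W(1) by (intro mult_left_mono) auto
  finally show ?thesis unfolding noise_weight_def by (simp add: divide_right_mono)
qed

lemma noise_weight_le:
  assumes m: "m \<ge> 1" and lam: "lam > 0" and n: "n > 0" and dvd: "n dvd N"
  shows "noise_weight m N n lam p \<le> 1 / real N"
  by (rule noise_weight_le_gen[OF assms]) (auto intro!: filter_weight_le_1[OF m lam n])

text \<open>A frequency \<open>r \<le> N / 2\<close> is the lowest of its aliases on the full grid, so it carries the largest
weight among them.\<close>

lemma noise_weight_le_filter_weight:
  assumes m: "m \<ge> 1" and lam: "lam > 0" and n: "n > 0" and dvd: "n dvd N" and r: "r > 0" "2 * r \<le> N"
  shows "noise_weight m N n lam r \<le> filter_weight m n lam r / real N"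
proof (rule noise_weight_le_gen[OF m lam n dvd])
  show "0 \<le> filter_weight m n lam r" using filter_weight_pos[OF m lam r(1), of n] by simp
  fix k assume a: "aliases N (Suc k) r \<noteq> 0"
  have nN: "int n dvd int N" using dvd by simp
  have "int N dvd int (Suc k) - int r \<or> int N dvd int (Suc k) + int r"
    using a by (auto simp: aliases_def split: if_splits)
  then have "int n dvd int (Suc k) - int r \<or> int n dvd int (Suc k) + int r"
    using dvd_trans[OF nN] by blast
  then have "aliases n (Suc k) r \<noteq> 0" by (auto simp: aliases_def)
  then have S: "alias_mass m n lam (Suc k) = alias_mass m n lam r" by (rule alias_mass_cong)
  have "r \<le> Suc k" by (rule aliases_nonzero_ge[OF a r(2)]) simp
  then have "inverse_penalty m lam (Suc k) \<le> inverse_penalty m lam r"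
    using inverse_penalty_decreasing[OF m lam r(1), of 1 "Suc k"] by simp
  then show "filter_weight m n lam (Suc k) \<le> filter_weight m n lam r"
    unfolding filter_weight_def S using alias_mass_nonneg[OF m lam, of n r] by (intro divide_right_mono) auto
qed

text \<open>The loss by aliasing: some \<open>l \<le> n\<close> is an alias of \<open>r\<close>, and already this one takes the multiple
\<open>(r / l) ^ (2 * m)\<close> of the share of \<open>r\<close>.\<close>

lemma filter_weight_le_alias:
  assumes m: "m \<ge> 1" and lam: "lam > 0" and n: "n > 0" and r: "r > 0"
  shows "filter_weight m n lam r \<le> (real n / real r) ^ (2 * m)"
proof -
  define l where "l = (if r mod n = 0 then n else r mod n)"
  have l: "l > 0" "l \<le> n" using n by (auto simp: l_def less_imp_le)
  have "int n dvd int l - int r"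
  proof (cases "r mod n = 0")
    case True
    then have "n dvd r" by (simp add: dvd_eq_mod_eq_0)
    then show ?thesis using True by (simp add: l_def)
  next
    case False
    then show ?thesis by (simp add: l_def zmod_int mod_eq_dvd_iff[symmetric])
  qed
  then have al: "aliases n l r \<noteq> 0" by (simp add: aliases_def)
  have xl: "inverse_penalty m lam l > 0" by (rule inverse_penalty_pos[OF lam l(1)])
  have "inverse_penalty m lam r = inverse_penalty m lam l * (real l / real r) ^ (2 * m)"
    by (rule inverse_penalty_ratio[OF lam l(1) r])
  also have "\<dots> \<le> alias_mass m n lam r * (real l / real r) ^ (2 * m)"
    by (intro mult_right_mono alias_mass_ge_term[OF m lam l(1) al]) simp
  also have "\<dots> \<le> (1 + alias_mass m n lam r) * (real n / real r) ^ (2 * m)"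
    using l alias_mass_nonneg[OF m lam, of n r]
    by (intro mult_mono power_mono divide_right_mono) auto
  finally show ?thesis
    using alias_mass_nonneg[OF m lam, of n r] by (simp add: filter_weight_def divide_le_eq mult.commute)
qed

lemma inverse_penalty_bandwidth:
  assumes m: "m \<ge> 1" and lam: "lam > 0" and h: "h = lam powr (1 / (2 * real m))" and k: "k > 0"
  shows "inverse_penalty m lam k = (1 / (2 * pi * h * real k)) ^ (2 * m)"
proof -
  have "h ^ (2 * m) = lam"
  proof -
    have hp: "h > 0" using h lam by simp
    have "h ^ (2 * m) = h powr real (2 * m)" using hp by (rule powr_realpow[symmetric])
    also have "\<dots> = lam" using h lam m by (simp add: powr_powr)
    finally show ?thesis .
  qed
  then show ?thesis by (simp add: inverse_penalty_def power_mult_distrib power_divide mult_ac)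
qed

text \<open>The number of frequencies which the averaged estimator resolves is of the order of
  \<open>K\<close> below: frequencies are lost to the penalty beyond \<open>1/h\<close> and to aliasing beyond \<open>n\<close>.\<close>

definition effective_dim :: "nat \<Rightarrow> real \<Rightarrow> real" where
  "effective_dim n h = min (real n) (1 / (2 * pi * h))"

lemma filter_weight_le_effective_dim:
  assumes m: "m \<ge> 1" and lam: "lam > 0" and n: "n > 0" and h: "h = lam powr (1 / (2 * real m))" and r: "r > 0"
  shows "filter_weight m n lam r \<le> (effective_dim n h / real r) ^ (2 * m)"
proof -
  have "filter_weight m n lam r \<le> (1 / (2 * pi * h) / real r) ^ (2 * m)"
    using filter_weight_le_inverse_penalty[OF m lam r, of n]
    unfolding inverse_penalty_bandwidth[OF m lam h r] by (simp add: mult_ac)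
  then show ?thesis using filter_weight_le_alias[OF m lam n r]
    by (auto simp: effective_dim_def min_def)
qed

text \<open>Frequencies up to half the effective dimension are hardly aliased and hardly penalized, so their
weights are at least \<open>1 / 5\<close>. There are at least a quarter of the effective dimension of them.\<close>

lemma sum_noise_weight_squares_ge:
  assumes m: "m \<ge> 1" and lam: "lam > 0" and n: "n > 0" and h: "h = lam powr (1 / (2 * real m))"
    and N: "N = s * n" "s > 0" and K: "effective_dim n h \<ge> 4"
  shows "effective_dim n h / (4 * 625 * (real N)\<^sup>2) \<le> (\<Sum>p<N. (noise_weight m N n lam p)\<^sup>2)"
proof -
  let ?K = "effective_dim n h"
  have hp: "h > 0" using h lam by simp
  define P where "P = nat \<lfloor>?K / 2\<rfloor>"
  have P: "real P \<le> ?K / 2" "?K / 2 - 1 \<le> real P" unfolding P_def using K by linarith+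
  have Kn: "?K \<le> real n" "?K \<le> 1 / (2 * pi * h)" by (auto simp: effective_dim_def)
  have "real (2 * P) \<le> real n" using P Kn by simp
  then have Pn: "2 * P \<le> n" by (simp only: of_nat_le_iff)
  have nN: "n \<le> N" using N by simp
  have low: "1 / (25 * real N) \<le> noise_weight m N n lam p" if p: "p \<in> {1..P}" for p
  proof -
    have pp: "p > 0" "2 * p \<le> n" using p Pn by auto
    have "real p \<le> real P" using p by simp
    then have "real p \<le> 1 / (2 * pi * h)" using P(1) Kn(2) K by linarith
    then have "2 * pi * h * real p \<le> 1" using hp by (simp add: field_simps)
    then have "1 \<le> 1 / (2 * pi * h * real p)" using hp pp by simp
    then have "1 \<le> inverse_penalty m lam p"
      unfolding inverse_penalty_bandwidth[OF m lam h pp(1)] by (rule one_le_power)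
    then have "1 / 5 \<le> filter_weight m n lam p" by (rule filter_weight_ge[OF m lam n pp])
    then have "(1 / 5)\<^sup>2 \<le> (filter_weight m n lam p)\<^sup>2" by (intro power_mono) auto
    then have "(1 / 5)\<^sup>2 / real N \<le> (filter_weight m n lam p)\<^sup>2 / real N" by (intro divide_right_mono) auto
    also have "\<dots> \<le> noise_weight m N n lam p" by (rule noise_weight_ge[OF m lam n pp(1)])
    finally show ?thesis by (simp add: power2_eq_square)
  qed
  have "?K / 4 \<le> real P" using P K by linarith
  then have "?K / 4 * (1 / (25 * real N))\<^sup>2 \<le> real P * (1 / (25 * real N))\<^sup>2"
    by (intro mult_right_mono) auto
  also have "\<dots> = (\<Sum>p\<in>{1..P}. (1 / (25 * real N))\<^sup>2)" by simp
  also have "\<dots> \<le> (\<Sum>p\<in>{1..P}. (noise_weight m N n lam p)\<^sup>2)"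
    by (intro sum_mono power_mono low) auto
  also have "\<dots> \<le> (\<Sum>p<N. (noise_weight m N n lam p)\<^sup>2)"
  proof (rule sum_mono2)
    show "{1..P} \<subseteq> {..<N}" using Pn nN n by auto
  qed auto
  finally show ?thesis by (simp add: power_mult_distrib power_divide field_simps)
qed

section \<open>Quadratic forms in independent standard normal variables\<close>

lemma (in prob_space) iid_std_normalD:
  assumes "iid_std_normal M \<epsilon> N" "l < N"
  shows iid_std_normal_measurable: "\<epsilon> l \<in> borel_measurable M"
    and iid_std_normal_distr: "distr M borel (\<epsilon> l) = std_normal_distribution"
proof -
  have d: "distributed M lborel (\<epsilon> l) (\<lambda>x. ennreal (std_normal_density x))"
    using assms by (simp add: iid_std_normal_def)
  then show "\<epsilon> l \<in> borel_measurable M" using distributed_measurable[OF d] by simp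
  have "distr M borel (\<epsilon> l) = distr M lborel (\<epsilon> l)" by (rule distr_cong) auto
  also have "\<dots> = std_normal_distribution" using distributed_distr_eq_density[OF d] .
  finally show "distr M borel (\<epsilon> l) = std_normal_distribution" .
qed

lemma (in prob_space) iid_std_normal_indep:
  "iid_std_normal M \<epsilon> N \<Longrightarrow> indep_vars (\<lambda>_. borel) \<epsilon> {..<N}"
  by (simp add: iid_std_normal_def)

lemma (in prob_space) iid_std_normal_linear_measurable:
  assumes "iid_std_normal M \<epsilon> N"
  shows "(\<lambda>\<omega>. \<Sum>l<N. v l * \<epsilon> l \<omega>) \<in> borel_measurable M"
  by (intro borel_measurable_sum borel_measurable_times borel_measurable_const)
     (use iid_std_normal_measurable[OF assms] in auto)

lemma (in prob_space) char_linear_iid_std_normal: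
  assumes iid: "iid_std_normal M \<epsilon> N"
  shows "(CLINT \<omega>|M. iexp (\<Sum>l<N. v l * \<epsilon> l \<omega>)) = of_real (exp (- (\<Sum>l<N. (v l)\<^sup>2) / 2))"
proof -
  note meas = iid_std_normal_measurable[OF iid]
  have ind: "indep_vars (\<lambda>_. borel) (\<lambda>l \<omega>. v l * \<epsilon> l \<omega>) {..<N}"
    by (rule indep_vars_compose2[OF iid_std_normal_indep[OF iid]]) simp
  have "(CLINT \<omega>|M. iexp (\<Sum>l<N. v l * \<epsilon> l \<omega>)) = char (distr M borel (\<lambda>\<omega>. \<Sum>l<N. v l * \<epsilon> l \<omega>)) 1"
    unfolding char_def by (subst integral_distr) (auto intro!: iid_std_normal_linear_measurable[OF iid])
  also have "\<dots> = (\<Prod>l<N. char (distr M borel (\<lambda>\<omega>. v l * \<epsilon> l \<omega>)) 1)"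
    by (rule char_distr_sum[OF ind])
  also have "\<dots> = (\<Prod>l<N. of_real (exp (- (v l)\<^sup>2 / 2)))"
  proof (rule prod.cong[OF refl])
    fix l assume l: "l \<in> {..<N}"
    have [measurable]: "\<epsilon> l \<in> borel_measurable M" using meas l by simp
    have "char (distr M borel (\<lambda>\<omega>. v l * \<epsilon> l \<omega>)) 1 = char (distr M borel (\<epsilon> l)) (v l)"
      unfolding char_def by (simp add: integral_distr)
    also have "\<dots> = of_real (exp (- (v l)\<^sup>2 / 2))"
      using l by (simp add: iid_std_normal_distr[OF iid] char_std_normal_distribution)
    finally show "char (distr M borel (\<lambda>\<omega>. v l * \<epsilon> l \<omega>)) 1 = of_real (exp (- (v l)\<^sup>2 / 2))" .
  qed
  also have "\<dots> = of_real (exp (\<Sum>l<N. - (v l)\<^sup>2 / 2))"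
    by (simp add: exp_sum)
  finally show ?thesis by (simp add: sum_negf sum_divide_distrib)
qed

text \<open>Each factor \<open>exp (- x\<^sup>2 / 2)\<close> is linearized as the characteristic function of an auxiliary normal
variable at \<open>x\<close>; an independent copy \<open>\<eta>\<close> of the noise, on the second factor of \<open>M \<Otimes>\<^sub>M M\<close>,
supplies these variables. The exponent is then bilinear in the two copies, and integrating over
\<open>\<omega>\<close> first instead of \<open>\<eta>\<close> lets the orthonormality remove \<open>u\<close>.\<close>

lemma (in prob_space) laplace_quadratic_orthonormal:
  assumes iid: "iid_std_normal M \<epsilon> N"
    and on: "\<And>p q. p < N \<Longrightarrow> q < N \<Longrightarrow> (\<Sum>l<N. u p l * u q l) = of_bool (p = q)"
    and c: "\<And>p. p < N \<Longrightarrow> 0 \<le> c p"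
  shows "expectation (\<lambda>\<omega>. exp (- (\<Sum>p<N. c p * (\<Sum>l<N. u p l * \<epsilon> l \<omega>)\<^sup>2) / 2))
    = expectation (\<lambda>\<omega>. exp (- (\<Sum>p<N. c p * (\<epsilon> p \<omega>)\<^sup>2) / 2))"
proof -
  note meas = iid_std_normal_measurable[OF iid]
  interpret P: pair_prob_space M M ..
  define g where "g = (\<lambda>p \<omega>. \<Sum>l<N. u p l * \<epsilon> l \<omega>)"
  define F where "F = (\<lambda>\<omega> \<eta>. iexp (\<Sum>p<N. (sqrt (c p) * g p \<omega>) * \<epsilon> p \<eta>))"
  have gm: "g p \<in> borel_measurable M" for p
    unfolding g_def by (rule iid_std_normal_linear_measurable[OF iid])
  have Fm: "case_prod F \<in> borel_measurable (M \<Otimes>\<^sub>M M)"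
  proof -
    have "(\<lambda>x. \<Sum>p<N. (sqrt (c p) * g p (fst x)) * \<epsilon> p (snd x)) \<in> borel_measurable (M \<Otimes>\<^sub>M M)"
    proof (intro borel_measurable_sum borel_measurable_times borel_measurable_const)
      fix p assume "p \<in> {..<N}"
      then show "(\<lambda>x. \<epsilon> p (snd x)) \<in> borel_measurable (M \<Otimes>\<^sub>M M)"
        using meas measurable_compose[OF measurable_snd] by auto
      show "(\<lambda>x. g p (fst x)) \<in> borel_measurable (M \<Otimes>\<^sub>M M)"
        using gm measurable_compose[OF measurable_fst] by auto
    qed
    then show ?thesis unfolding F_def case_prod_beta' by measurable
  qed
  have int: "integrable (M \<Otimes>\<^sub>M M) (case_prod F)"
    by (rule P.integrable_const_bound[OF _ Fm, of 1]) (auto simp: F_def)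
  have inner1: "(CLINT \<eta>|M. F \<omega> \<eta>) = of_real (exp (- (\<Sum>p<N. c p * (g p \<omega>)\<^sup>2) / 2))" for \<omega>
  proof -
    have "(\<Sum>p<N. (sqrt (c p) * g p \<omega>)\<^sup>2) = (\<Sum>p<N. c p * (g p \<omega>)\<^sup>2)"
      using c by (intro sum.cong refl) (simp add: power_mult_distrib)
    then show ?thesis unfolding F_def char_linear_iid_std_normal[OF iid] by simp
  qed
  have inner2: "(CLINT \<omega>|M. F \<omega> \<eta>) = of_real (exp (- (\<Sum>p<N. c p * (\<epsilon> p \<eta>)\<^sup>2) / 2))" for \<eta>
  proof -
    define b where "b = (\<lambda>p. sqrt (c p) * \<epsilon> p \<eta>)"
    define v where "v = (\<lambda>l. \<Sum>p<N. b p * u p l)"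
    have lin: "(\<Sum>p<N. (sqrt (c p) * g p \<omega>) * \<epsilon> p \<eta>) = (\<Sum>l<N. v l * \<epsilon> l \<omega>)" for \<omega>
    proof -
      have "(\<Sum>p<N. (sqrt (c p) * g p \<omega>) * \<epsilon> p \<eta>) = (\<Sum>p<N. \<Sum>l<N. b p * u p l * \<epsilon> l \<omega>)"
        unfolding g_def b_def sum_distrib_left sum_distrib_right by (simp only: mult_ac)
      also have "\<dots> = (\<Sum>l<N. \<Sum>p<N. b p * u p l * \<epsilon> l \<omega>)" by (rule sum.swap)
      finally show ?thesis unfolding v_def sum_distrib_right .
    qed
    have "(\<Sum>l<N. (v l)\<^sup>2) = (\<Sum>l<N. \<Sum>p<N. \<Sum>q<N. b p * b q * (u p l * u q l))"
      unfolding v_def power2_eq_square sum_product by (simp only: mult_ac)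
    also have "\<dots> = (\<Sum>p<N. \<Sum>q<N. b p * b q * (\<Sum>l<N. u p l * u q l))"
      unfolding sum_distrib_left
      by (subst sum.swap, rule sum.cong[OF refl], rule sum.swap)
    also have "\<dots> = (\<Sum>p<N. \<Sum>q<N. if q = p then b p * b p else 0)"
      by (intro sum.cong refl) (auto simp: on)
    also have "\<dots> = (\<Sum>p<N. c p * (\<epsilon> p \<eta>)\<^sup>2)"
      using c by (intro sum.cong refl) (simp add: b_def power2_eq_square)
    finally have sq: "(\<Sum>l<N. (v l)\<^sup>2) = (\<Sum>p<N. c p * (\<epsilon> p \<eta>)\<^sup>2)" .
    show ?thesis unfolding F_def lin char_linear_iid_std_normal[OF iid] sq ..
  qed
  have "complex_of_real (expectation (\<lambda>\<omega>. exp (- (\<Sum>p<N. c p * (g p \<omega>)\<^sup>2) / 2)))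
     = (CLINT \<omega>|M. CLINT \<eta>|M. F \<omega> \<eta>)"
    unfolding inner1 by simp
  also have "\<dots> = (CLINT \<eta>|M. CLINT \<omega>|M. F \<omega> \<eta>)" using P.Fubini_integral[OF int] by simp
  also have "\<dots> = complex_of_real (expectation (\<lambda>\<eta>. exp (- (\<Sum>p<N. c p * (\<epsilon> p \<eta>)\<^sup>2) / 2)))"
    unfolding inner2 by simp
  finally show ?thesis unfolding g_def by (simp only: of_real_eq_iff)
qed

text \<open>A bounded variable is determined by its moments: the exponential series may be integrated termwise.\<close>

lemma (in prob_space) char_bounded_power_series:
  fixes Z :: "'a \<Rightarrow> real"
  assumes [measurable]: "Z \<in> borel_measurable M" and Z: "\<And>\<omega>. \<bar>Z \<omega>\<bar> \<le> 1"
  shows "(\<lambda>k. (\<i> * of_real t) ^ k / fact k * of_real (expectation (\<lambda>\<omega>. Z \<omega> ^ k))) sums char (distr M borel Z) t"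
proof -
  let ?f = "\<lambda>k \<omega>. (\<i> * of_real t) ^ k / fact k * complex_of_real (Z \<omega> ^ k)"
  have bound: "norm (?f k \<omega>) \<le> \<bar>t\<bar> ^ k / fact k" for k \<omega>
  proof -
    have "\<bar>Z \<omega>\<bar> ^ k \<le> 1" using Z by (intro power_le_one) auto
    then have "\<bar>t\<bar> ^ k / fact k * \<bar>Z \<omega>\<bar> ^ k \<le> \<bar>t\<bar> ^ k / fact k * 1" by (intro mult_left_mono) auto
    then show ?thesis by (simp add: norm_mult norm_divide norm_power power_abs)
  qed
  have sB: "summable (\<lambda>k. \<bar>t\<bar> ^ k / fact k)" using summable_exp[of "\<bar>t\<bar>"] by (simp add: field_simps)
  have int: "integrable M (?f k)" for k
    by (rule integrable_const_bound[of _ "\<bar>t\<bar> ^ k / fact k"]) (use bound in auto)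
  have s1: "AE \<omega> in M. summable (\<lambda>k. norm (?f k \<omega>))"
    by (rule AE_I2, rule summable_comparison_test'[OF sB]) (use bound in simp)
  have s2: "summable (\<lambda>k. \<integral>\<omega>. norm (?f k \<omega>) \<partial>M)"
  proof (rule summable_comparison_test'[OF sB])
    fix k
    have "(\<integral>\<omega>. norm (?f k \<omega>) \<partial>M) \<le> (\<integral>\<omega>. \<bar>t\<bar> ^ k / fact k \<partial>M)"
      by (intro integral_mono integrable_norm int) (use bound in auto)
    then show "norm (\<integral>\<omega>. norm (?f k \<omega>) \<partial>M) \<le> \<bar>t\<bar> ^ k / fact k" by (simp add: prob_space)
  qed
  have series: "(\<Sum>k. ?f k \<omega>) = iexp (t * Z \<omega>)" for \<omega>
  proof -
    have "?f k \<omega> = (\<i> * of_real (t * Z \<omega>)) ^ k /\<^sub>R fact k" for k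
      by (simp add: power_mult_distrib scaleR_conv_of_real divide_inverse mult_ac)
    then show ?thesis using exp_converges[of "\<i> * of_real (t * Z \<omega>)"] by (simp add: sums_iff)
  qed
  have "(\<lambda>k. CLINT \<omega>|M. ?f k \<omega>) sums (CLINT \<omega>|M. iexp (t * Z \<omega>))"
    using sums_integral[OF int s1 s2] unfolding series .
  moreover have "(CLINT \<omega>|M. ?f k \<omega>) = (\<i> * of_real t) ^ k / fact k * of_real (expectation (\<lambda>\<omega>. Z \<omega> ^ k))" for k
    by (simp only: integral_mult_right_zero integral_complex_of_real)
  ultimately have "(\<lambda>k. (\<i> * of_real t) ^ k / fact k * of_real (expectation (\<lambda>\<omega>. Z \<omega> ^ k))) sums (CLINT \<omega>|M. iexp (t * Z \<omega>))"
    by (simp only:)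
  moreover have "char (distr M borel Z) t = (CLINT \<omega>|M. iexp (t * Z \<omega>))"
    unfolding char_def by (subst integral_distr) auto
  ultimately show ?thesis by (simp only:)
qed

text \<open>The Laplace transforms at the natural numbers are the moments of the bounded variables
\<open>exp (- X)\<close> and \<open>exp (- Y)\<close>, which therefore have the same characteristic function.\<close>

lemma (in prob_space) laplace_transform_unique:
  fixes X Y :: "'a \<Rightarrow> real"
  assumes [measurable]: "X \<in> borel_measurable M" "Y \<in> borel_measurable M"
    and nn: "\<And>\<omega>. 0 \<le> X \<omega>" "\<And>\<omega>. 0 \<le> Y \<omega>"
    and eq: "\<And>k::nat. expectation (\<lambda>\<omega>. exp (- (real k * X \<omega>))) = expectation (\<lambda>\<omega>. exp (- (real k * Y \<omega>)))"
  shows "distr M borel X = distr M borel Y"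
proof -
  have pw: "exp (- (real k * x)) = exp (- x) ^ k" for k and x :: real
    using exp_of_nat_mult[of k "- x"] by simp
  have c: "char (distr M borel (\<lambda>\<omega>. exp (- X \<omega>))) = char (distr M borel (\<lambda>\<omega>. exp (- Y \<omega>)))"
  proof
    fix t
    have "(\<lambda>k. (\<i> * of_real t) ^ k / fact k * of_real (expectation (\<lambda>\<omega>. exp (- X \<omega>) ^ k))) sums char (distr M borel (\<lambda>\<omega>. exp (- X \<omega>))) t"
      by (rule char_bounded_power_series) (use nn in auto)
    moreover have "(\<lambda>k. (\<i> * of_real t) ^ k / fact k * of_real (expectation (\<lambda>\<omega>. exp (- Y \<omega>) ^ k))) sums char (distr M borel (\<lambda>\<omega>. exp (- Y \<omega>))) t"
      by (rule char_bounded_power_series) (use nn in auto)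
    ultimately show "char (distr M borel (\<lambda>\<omega>. exp (- X \<omega>))) t = char (distr M borel (\<lambda>\<omega>. exp (- Y \<omega>))) t"
      using eq unfolding pw by (simp add: sums_unique2)
  qed
  have d: "distr M borel (\<lambda>\<omega>. exp (- X \<omega>)) = distr M borel (\<lambda>\<omega>. exp (- Y \<omega>))"
    by (rule Levy_uniqueness[OF _ _ c]) (auto intro!: real_distribution_distr)
  have recover: "distr M borel Z = distr (distr M borel (\<lambda>\<omega>. exp (- Z \<omega>))) borel (\<lambda>z. - ln z)"
    if [measurable]: "Z \<in> borel_measurable M" for Z :: "'a \<Rightarrow> real"
    by (subst distr_distr) (auto simp: comp_def)
  show ?thesis using recover[of X] recover[of Y] d by simp
qed

text \<open>The form of rotation invariance of the Gaussian law that is needed here: an orthonormal change of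
coordinates does not change the law of a diagonal quadratic form.\<close>

lemma (in prob_space) distr_quadratic_orthonormal:
  assumes iid: "iid_std_normal M \<epsilon> N"
    and on: "\<And>p q. p < N \<Longrightarrow> q < N \<Longrightarrow> (\<Sum>l<N. u p l * u q l) = of_bool (p = q)"
    and a: "\<And>p. p < N \<Longrightarrow> 0 \<le> a p"
  shows "distr M borel (\<lambda>\<omega>. \<Sum>p<N. a p * (\<Sum>l<N. u p l * \<epsilon> l \<omega>)\<^sup>2)
    = distr M borel (\<lambda>\<omega>. \<Sum>p<N. a p * (\<epsilon> p \<omega>)\<^sup>2)"
proof (rule laplace_transform_unique)
  note meas = iid_std_normal_measurable[OF iid]
  show "(\<lambda>\<omega>. \<Sum>p<N. a p * (\<Sum>l<N. u p l * \<epsilon> l \<omega>)\<^sup>2) \<in> borel_measurable M"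
    by (intro borel_measurable_sum borel_measurable_times borel_measurable_const borel_measurable_power
        iid_std_normal_linear_measurable[OF iid])
  show "(\<lambda>\<omega>. \<Sum>p<N. a p * (\<epsilon> p \<omega>)\<^sup>2) \<in> borel_measurable M"
    by (intro borel_measurable_sum borel_measurable_times borel_measurable_const borel_measurable_power)
       (use meas in auto)
  fix k :: nat
  have "(\<Sum>p<N. 2 * real k * a p * z p) / 2 = real k * (\<Sum>p<N. a p * z p)" for z
    by (simp add: sum_distrib_left sum_divide_distrib mult_ac)
  then show "expectation (\<lambda>\<omega>. exp (- (real k * (\<Sum>p<N. a p * (\<Sum>l<N. u p l * \<epsilon> l \<omega>)\<^sup>2))))
    = expectation (\<lambda>\<omega>. exp (- (real k * (\<Sum>p<N. a p * (\<epsilon> p \<omega>)\<^sup>2))))"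
    using laplace_quadratic_orthonormal[OF iid on, of "\<lambda>p. 2 * real k * a p"] a by simp
qed (use a in \<open>auto intro!: sum_nonneg\<close>)

lemma (in prob_space) iid_std_normal_moments:
  assumes iid: "iid_std_normal M \<epsilon> N" and l: "l < N"
  shows "integrable M (\<lambda>\<omega>. (\<epsilon> l \<omega>) ^ k)"
    and "expectation (\<lambda>\<omega>. (\<epsilon> l \<omega>)\<^sup>2) = 1" and "expectation (\<lambda>\<omega>. (\<epsilon> l \<omega>) ^ 4) = 3"
    and "expectation (\<lambda>\<omega>. \<epsilon> l \<omega>) = 0"
proof -
  have [measurable]: "\<epsilon> l \<in> borel_measurable M" by (rule iid_std_normal_measurable[OF iid l])
  note d = iid_std_normal_distr[OF iid l, symmetric]
  show "integrable M (\<lambda>\<omega>. (\<epsilon> l \<omega>) ^ k)"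
    using integrable_std_normal_distribution_moment[of k] unfolding d by (subst (asm) integrable_distr_eq) auto
  have e: "expectation (\<lambda>\<omega>. (\<epsilon> l \<omega>) ^ k) = (LINT x|std_normal_distribution. x ^ k)" for k
    unfolding d by (subst integral_distr) auto
  show "expectation (\<lambda>\<omega>. (\<epsilon> l \<omega>)\<^sup>2) = 1"
    using std_normal_distribution_even_moments(1)[of 1] unfolding e by simp
  show "expectation (\<lambda>\<omega>. (\<epsilon> l \<omega>) ^ 4) = 3"
    using std_normal_distribution_even_moments(1)[of 2] unfolding e by (simp add: fact_numeral)
  show "expectation (\<lambda>\<omega>. \<epsilon> l \<omega>) = 0"
    using integral_std_normal_distribution_moment_odd[of 1] e[of 1] by simp
qed

text \<open>The variables \<open>f (\<epsilon> p)\<close> are independent and centered, hence orthogonal.\<close>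

lemma (in prob_space) iid_std_normal_second_moment:
  fixes f :: "real \<Rightarrow> real" and b :: "nat \<Rightarrow> real"
  assumes iid: "iid_std_normal M \<epsilon> N" and f[measurable]: "f \<in> borel_measurable borel"
    and f1: "\<And>p. p < N \<Longrightarrow> integrable M (\<lambda>\<omega>. f (\<epsilon> p \<omega>))" "\<And>p. p < N \<Longrightarrow> expectation (\<lambda>\<omega>. f (\<epsilon> p \<omega>)) = 0"
    and f2: "\<And>p. p < N \<Longrightarrow> integrable M (\<lambda>\<omega>. (f (\<epsilon> p \<omega>))\<^sup>2)" "\<And>p. p < N \<Longrightarrow> expectation (\<lambda>\<omega>. (f (\<epsilon> p \<omega>))\<^sup>2) = v"
  shows "integrable M (\<lambda>\<omega>. (\<Sum>p<N. b p * f (\<epsilon> p \<omega>))\<^sup>2)"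
    and "expectation (\<lambda>\<omega>. (\<Sum>p<N. b p * f (\<epsilon> p \<omega>))\<^sup>2) = v * (\<Sum>p<N. (b p)\<^sup>2)"
proof -
  let ?X = "\<lambda>p \<omega>. f (\<epsilon> p \<omega>)"
  have cov: "integrable M (\<lambda>\<omega>. ?X p \<omega> * ?X q \<omega>) \<and> expectation (\<lambda>\<omega>. ?X p \<omega> * ?X q \<omega>) = v * of_bool (p = q)"
    if p: "p < N" "q < N" for p q
  proof (cases "p = q")
    case True
    then show ?thesis using f2[OF p(1)] by (simp add: power2_eq_square)
  next
    case False
    have "indep_vars (\<lambda>_. borel) \<epsilon> {p, q}"
      by (rule indep_vars_subset[OF iid_std_normal_indep[OF iid]]) (use p in auto)
    then have ind: "indep_vars (\<lambda>_. borel) ?X {p, q}"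
      by (rule indep_vars_compose2) simp
    have int: "\<And>i. i \<in> {p, q} \<Longrightarrow> integrable M (?X i)" using f1(1) p by auto
    show ?thesis
      using indep_vars_integrable[OF _ ind int] indep_vars_lebesgue_integral[OF _ ind int] f1(2) p False by simp
  qed
  have expand: "(\<Sum>p<N. b p * ?X p \<omega>)\<^sup>2 = (\<Sum>p<N. \<Sum>q<N. b p * b q * (?X p \<omega> * ?X q \<omega>))" for \<omega>
    unfolding power2_eq_square sum_product by (simp only: mult_ac)
  show "integrable M (\<lambda>\<omega>. (\<Sum>p<N. b p * ?X p \<omega>)\<^sup>2)"
    unfolding expand using cov by (intro Bochner_Integration.integrable_sum) auto
  have "expectation (\<lambda>\<omega>. (\<Sum>p<N. b p * ?X p \<omega>)\<^sup>2) = (\<Sum>p<N. \<Sum>q<N. expectation (\<lambda>\<omega>. b p * b q * (?X p \<omega> * ?X q \<omega>)))"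
    unfolding expand using cov
    by (subst Bochner_Integration.integral_sum, fastforce intro!: Bochner_Integration.integrable_sum,
        intro sum.cong refl, subst Bochner_Integration.integral_sum) auto
  also have "\<dots> = (\<Sum>p<N. \<Sum>q<N. if q = p then v * (b p)\<^sup>2 else 0)"
    using cov by (intro sum.cong refl) (auto simp: power2_eq_square)
  also have "\<dots> = v * (\<Sum>p<N. (b p)\<^sup>2)" by (simp add: sum_distrib_left)
  finally show "expectation (\<lambda>\<omega>. (\<Sum>p<N. b p * ?X p \<omega>)\<^sup>2) = v * (\<Sum>p<N. (b p)\<^sup>2)" .
qed

lemma (in prob_space) weighted_chi_square_moments:
  fixes a :: "nat \<Rightarrow> real"
  assumes iid: "iid_std_normal M \<epsilon> N"
  defines "Q \<equiv> \<lambda>\<omega>. \<Sum>p<N. a p * (\<epsilon> p \<omega>)\<^sup>2"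
  shows "expectation Q = (\<Sum>p<N. a p)" and "variance Q = 2 * (\<Sum>p<N. (a p)\<^sup>2)"
proof -
  note mom = iid_std_normal_moments[OF iid]
  show E: "expectation Q = (\<Sum>p<N. a p)"
    unfolding Q_def by (subst Bochner_Integration.integral_sum) (auto simp: mom)
  have dev: "Q \<omega> - expectation Q = (\<Sum>p<N. a p * ((\<epsilon> p \<omega>)\<^sup>2 - 1))" for \<omega>
    unfolding E by (simp add: Q_def right_diff_distrib sum_subtractf)
  have sq: "(x\<^sup>2 - 1)\<^sup>2 = x ^ 4 - 2 * x\<^sup>2 + 1" for x :: real
    by (simp add: power2_eq_square power4_eq_xxxx algebra_simps)
  show "variance Q = 2 * (\<Sum>p<N. (a p)\<^sup>2)"
    unfolding dev
    by (rule iid_std_normal_second_moment(2)[OF iid]) (simp_all add: sq mom prob_space)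
qed

lemma (in prob_space) expectation_abs_normalized_linear_le:
  assumes iid: "iid_std_normal M \<epsilon> N" and v: "(\<Sum>l<N. (v l)\<^sup>2) = 1"
  shows "integrable M (\<lambda>\<omega>. \<Sum>l<N. v l * \<epsilon> l \<omega>)" and "expectation (\<lambda>\<omega>. \<bar>\<Sum>l<N. v l * \<epsilon> l \<omega>\<bar>) \<le> 1"
proof -
  note mom = iid_std_normal_moments[OF iid]
  have m1: "p < N \<Longrightarrow> integrable M (\<epsilon> p)" for p using mom(1)[of p 1] by simp
  then show "integrable M (\<lambda>\<omega>. \<Sum>l<N. v l * \<epsilon> l \<omega>)" by (intro Bochner_Integration.integrable_sum) auto
  have "integrable M (\<lambda>\<omega>. (\<Sum>l<N. v l * \<epsilon> l \<omega>)\<^sup>2)" "expectation (\<lambda>\<omega>. (\<Sum>l<N. v l * \<epsilon> l \<omega>)\<^sup>2) = 1 * (\<Sum>l<N. (v l)\<^sup>2)"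
    by (rule iid_std_normal_second_moment[OF iid, of "\<lambda>x. x" 1 v]; simp add: mom m1)+
  then show "expectation (\<lambda>\<omega>. \<bar>\<Sum>l<N. v l * \<epsilon> l \<omega>\<bar>) \<le> 1"
    using expectation_abs_le_sqrt[OF iid_std_normal_linear_measurable[OF iid]] v by fastforce
qed

section \<open>Asymptotic normality and the rejection probability\<close>

text \<open>Both functions differ from \<open>1 - \<theta>\<^sup>2\<close> by \<open>O (\<bar>\<theta>\<bar> ^ 3)\<close>: the variable \<open>x\<^sup>2 - 1\<close> has mean \<open>0\<close>,
variance \<open>2\<close> and a finite third absolute moment.\<close>

lemma char_centered_chi_square_approx:
  obtains C where "C \<ge> 0" "\<And>\<theta>. \<bar>\<theta>\<bar> \<le> 1 \<Longrightarrow>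
    cmod (char (distr std_normal_distribution borel (\<lambda>x. x\<^sup>2 - 1)) \<theta> - of_real (exp (- (\<theta>\<^sup>2)))) \<le> C * \<bar>\<theta>\<bar> ^ 3"
proof -
  interpret S: real_distribution std_normal_distribution by (rule real_dist_normal_dist)
  let ?X = "\<lambda>x::real. x\<^sup>2 - 1" and ?S = std_normal_distribution
  note mom = integrable_std_normal_distribution_moment
  have e2: "(LINT x|?S. x\<^sup>2) = 1" using std_normal_distribution_even_moments(1)[of 1] by simp
  have e4: "(LINT x|?S. x ^ 4) = 3" using std_normal_distribution_even_moments(1)[of 2] by (simp add: fact_numeral)
  have X1: "integrable ?S ?X" using mom[of 2] by simp
  have EX: "(LINT x|?S. ?X x) = 0" using mom[of 2] e2 S.prob_space by simp
  have sq: "(?X x)\<^sup>2 = x ^ 4 - 2 * x\<^sup>2 + 1" for x by (simp add: power2_eq_square power4_eq_xxxx algebra_simps)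
  have X2: "integrable ?S (\<lambda>x. (?X x)\<^sup>2)" unfolding sq using mom[of 2] mom[of 4] by simp
  have VX: "S.variance ?X = 2" unfolding EX diff_0_right sq using mom[of 2] mom[of 4] e2 e4 S.prob_space by simp
  have X3: "integrable ?S (\<lambda>x. \<bar>?X x\<bar> ^ 3)"
  proof (rule Bochner_Integration.integrable_bound)
    have eq: "(x\<^sup>2 + 1) ^ 3 = x ^ 6 + 3 * x ^ 4 + 3 * x\<^sup>2 + 1" for x :: real
      by (simp add: power3_eq_cube power2_eq_square eval_nat_numeral algebra_simps)
    show "integrable ?S (\<lambda>x. (x\<^sup>2 + 1) ^ 3)" unfolding eq using mom[of 2] mom[of 4] mom[of 6] by simp
    have "\<bar>?X x\<bar> ^ 3 \<le> (x\<^sup>2 + 1) ^ 3" for x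
    proof (rule power_mono)
      show "\<bar>?X x\<bar> \<le> x\<^sup>2 + 1" using zero_le_power2[of x] unfolding abs_le_iff by linarith
    qed simp
    then show "AE x in ?S. norm (\<bar>?X x\<bar> ^ 3) \<le> norm ((x\<^sup>2 + 1) ^ 3)" by simp
  qed simp
  define B where "B = (LINT x|?S. \<bar>?X x\<bar> ^ 3)"
  have B: "B \<ge> 0" unfolding B_def by simp
  show ?thesis
  proof
    show "0 \<le> B / 6 + 1" using B by simp
    fix \<theta> :: real assume \<theta>: "\<bar>\<theta>\<bar> \<le> 1"
    have "cmod (char (distr ?S borel ?X) \<theta> - (1 - \<theta>\<^sup>2 * 2 / 2))
       \<le> (\<theta>\<^sup>2 / 6) * S.expectation (\<lambda>x. min (6 * (?X x)\<^sup>2) (\<bar>\<theta>\<bar> * \<bar>?X x\<bar> ^ 3))"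
      using S.char_approx3'[OF _ X1 X2 EX VX refl, of \<theta>] by simp
    also have "\<dots> \<le> (\<theta>\<^sup>2 / 6) * S.expectation (\<lambda>x. \<bar>\<theta>\<bar> * \<bar>?X x\<bar> ^ 3)"
      using X2 X3 by (intro mult_left_mono integral_mono) auto
    also have "\<dots> = B / 6 * \<bar>\<theta>\<bar> ^ 3"
    proof -
      have "\<theta>\<^sup>2 = \<bar>\<theta>\<bar> * \<bar>\<theta>\<bar>" by (simp add: power2_eq_square)
      then show ?thesis by (simp add: B_def power3_eq_cube mult_ac)
    qed
    finally have 1: "cmod (char (distr ?S borel ?X) \<theta> - of_real (1 - \<theta>\<^sup>2)) \<le> B / 6 * \<bar>\<theta>\<bar> ^ 3" by simp
    define x where "x = \<theta>\<^sup>2"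
    have x: "0 \<le> x" by (simp add: x_def)
    have "1 - x \<le> exp (- x)" using exp_ge_add_one_self[of "- x"] by simp
    moreover have "exp (- x) \<le> 1 - x + x\<^sup>2"
    proof -
      have "exp (- x) = 1 / exp x" by (simp add: exp_minus divide_inverse)
      also have "\<dots> \<le> 1 / (1 + x)" using x by (intro divide_left_mono exp_ge_add_one_self) auto
      also have "\<dots> \<le> 1 - x + x\<^sup>2"
      proof -
        have "(1 - x + x\<^sup>2) * (1 + x) = 1 + x * x * x" by (simp add: power2_eq_square algebra_simps)
        then have "1 \<le> (1 - x + x\<^sup>2) * (1 + x)" using x by simp
        then show ?thesis using x by (simp add: pos_divide_le_eq)
      qed
      finally show ?thesis .
    qed
    ultimately have "\<bar>(1 - x) - exp (- x)\<bar> \<le> x\<^sup>2" unfolding abs_le_iff using zero_le_power2[of x] by linarith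
    moreover have "cmod (of_real (1 - \<theta>\<^sup>2) - of_real (exp (- (\<theta>\<^sup>2)))) = \<bar>(1 - x) - exp (- x)\<bar>"
      unfolding x_def by (simp only: of_real_diff[symmetric] norm_of_real)
    moreover have "x\<^sup>2 \<le> \<bar>\<theta>\<bar> ^ 3"
    proof -
      have "x\<^sup>2 = \<bar>\<theta>\<bar> ^ 4" by (simp add: x_def)
      also have "\<dots> \<le> \<bar>\<theta>\<bar> ^ 3" using \<theta> by (intro power_decreasing) auto
      finally show ?thesis .
    qed
    ultimately have 2: "cmod (of_real (1 - \<theta>\<^sup>2) - of_real (exp (- (\<theta>\<^sup>2)))) \<le> \<bar>\<theta>\<bar> ^ 3" by linarith
    have "cmod (char (distr ?S borel ?X) \<theta> - of_real (exp (- (\<theta>\<^sup>2)))) \<le> B / 6 * \<bar>\<theta>\<bar> ^ 3 + \<bar>\<theta>\<bar> ^ 3"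
      by (rule norm_diff_triangle_le[OF 1 2])
    then show "cmod (char (distr ?S borel ?X) \<theta> - of_real (exp (- (\<theta>\<^sup>2)))) \<le> (B / 6 + 1) * \<bar>\<theta>\<bar> ^ 3"
      by (simp add: distrib_right)
  qed
qed

text \<open>A quantitative central limit theorem. The normal characteristic function factorizes with the same
weights, the difference of two products of numbers in the unit disc is at most the sum of the
differences of the factors, and cubes of the weights are at most \<open>\<delta>\<close> times their squares.\<close>

lemma (in prob_space) char_weighted_chi_square_approx:
  assumes iid: "iid_std_normal M \<epsilon> N"
    and C: "\<And>\<theta>. \<bar>\<theta>\<bar> \<le> 1 \<Longrightarrow>
      cmod (char (distr std_normal_distribution borel (\<lambda>x. x\<^sup>2 - 1)) \<theta> - of_real (exp (- (\<theta>\<^sup>2)))) \<le> C * \<bar>\<theta>\<bar> ^ 3"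
    and C0: "C \<ge> 0"
    and b: "\<And>p. p < N \<Longrightarrow> \<bar>b p\<bar> \<le> \<delta>" and \<delta>: "\<bar>t\<bar> * \<delta> \<le> 1" and var: "2 * (\<Sum>p<N. (b p)\<^sup>2) = 1"
  shows "cmod (char (distr M borel (\<lambda>\<omega>. \<Sum>p<N. b p * ((\<epsilon> p \<omega>)\<^sup>2 - 1))) t - of_real (exp (- (t\<^sup>2) / 2))) \<le> C * \<bar>t\<bar> ^ 3 * \<delta>"
proof -
  let ?\<phi> = "char (distr std_normal_distribution borel (\<lambda>x. x\<^sup>2 - 1))"
  interpret S: real_distribution "distr std_normal_distribution borel (\<lambda>x::real. x\<^sup>2 - 1)"
    using real_dist_normal_dist
    by (intro prob_space.real_distribution_distr) (auto simp: real_distribution_def)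
  have ind: "indep_vars (\<lambda>_. borel) (\<lambda>p \<omega>. b p * ((\<epsilon> p \<omega>)\<^sup>2 - 1)) {..<N}"
    by (rule indep_vars_compose2[OF iid_std_normal_indep[OF iid]]) simp
  have "char (distr M borel (\<lambda>\<omega>. \<Sum>p<N. b p * ((\<epsilon> p \<omega>)\<^sup>2 - 1))) t
     = (\<Prod>p<N. char (distr M borel (\<lambda>\<omega>. b p * ((\<epsilon> p \<omega>)\<^sup>2 - 1))) t)"
    by (rule char_distr_sum[OF ind])
  also have "\<dots> = (\<Prod>p<N. ?\<phi> (b p * t))"
  proof (rule prod.cong[OF refl])
    fix p assume p: "p \<in> {..<N}"
    have [measurable]: "\<epsilon> p \<in> borel_measurable M" using iid_std_normal_measurable[OF iid] p by simp
    have "?\<phi> (b p * t) = char (distr (distr M borel (\<epsilon> p)) borel (\<lambda>x. x\<^sup>2 - 1)) (b p * t)"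
      using iid_std_normal_distr[OF iid] p by simp
    also have "\<dots> = char (distr M borel (\<lambda>\<omega>. b p * ((\<epsilon> p \<omega>)\<^sup>2 - 1))) t"
      unfolding char_def by (simp add: distr_distr integral_distr comp_def mult_ac)
    finally show "char (distr M borel (\<lambda>\<omega>. b p * ((\<epsilon> p \<omega>)\<^sup>2 - 1))) t = ?\<phi> (b p * t)" ..
  qed
  finally have lhs: "char (distr M borel (\<lambda>\<omega>. \<Sum>p<N. b p * ((\<epsilon> p \<omega>)\<^sup>2 - 1))) t = (\<Prod>p<N. ?\<phi> (b p * t))" .
  have "(\<Sum>p<N. - ((b p * t)\<^sup>2)) = - (t\<^sup>2) / 2"
    using var by (simp add: power_mult_distrib sum_distrib_right[symmetric] sum_negf)
  then have rhs: "of_real (exp (- (t\<^sup>2) / 2)) = (\<Prod>p<N. complex_of_real (exp (- ((b p * t)\<^sup>2))))"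
    by (metis exp_sum finite_lessThan of_real_prod)
  have "cmod ((\<Prod>p<N. ?\<phi> (b p * t)) - (\<Prod>p<N. complex_of_real (exp (- ((b p * t)\<^sup>2)))))
     \<le> (\<Sum>p<N. cmod (?\<phi> (b p * t) - complex_of_real (exp (- ((b p * t)\<^sup>2)))))"
    by (rule norm_prod_diff) (auto simp: S.cmod_char_le_1)
  also have "\<dots> \<le> (\<Sum>p<N. C * \<bar>t\<bar> ^ 3 * \<delta> * (b p)\<^sup>2)"
  proof (rule sum_mono)
    fix p assume p: "p \<in> {..<N}"
    have bp: "\<bar>b p\<bar> \<le> \<delta>" using b p by simp
    then have "\<bar>b p * t\<bar> \<le> 1"
      using \<delta> mult_right_mono[OF bp abs_ge_zero[of t]] by (simp add: abs_mult mult.commute)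
    then have "cmod (?\<phi> (b p * t) - complex_of_real (exp (- ((b p * t)\<^sup>2)))) \<le> C * \<bar>b p * t\<bar> ^ 3" by (rule C)
    also have "\<dots> = C * \<bar>t\<bar> ^ 3 * (\<bar>b p\<bar> * (b p)\<^sup>2)"
      by (simp add: abs_mult power_mult_distrib power3_eq_cube power2_eq_square mult_ac abs_mult_self_eq)
    also have "\<dots> \<le> C * \<bar>t\<bar> ^ 3 * (\<delta> * (b p)\<^sup>2)"
      using bp C0 by (intro mult_left_mono mult_right_mono) auto
    finally show "cmod (?\<phi> (b p * t) - complex_of_real (exp (- ((b p * t)\<^sup>2)))) \<le> C * \<bar>t\<bar> ^ 3 * \<delta> * (b p)\<^sup>2"
      by (simp only: mult_ac)
  qed
  also have "\<dots> = C * \<bar>t\<bar> ^ 3 * \<delta> * (1 / 2)" using var unfolding sum_distrib_left[symmetric] by simp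
  also have "\<dots> \<le> C * \<bar>t\<bar> ^ 3 * \<delta>"
  proof -
    have "N \<noteq> 0"
    proof
      assume "N = 0"
      with var show False by simp
    qed
    then have "0 \<le> \<delta>" using b[of 0] by simp
    then show ?thesis using C0 by (simp add: mult_nonneg_nonneg)
  qed
  finally show ?thesis unfolding lhs rhs .
qed

lemma (in prob_space) char_perturbation:
  assumes [measurable]: "X \<in> borel_measurable M" "Y \<in> borel_measurable M"
    and int: "integrable M (\<lambda>\<omega>. X \<omega> - Y \<omega>)"
  shows "cmod (char (distr M borel X) t - char (distr M borel Y) t) \<le> \<bar>t\<bar> * expectation (\<lambda>\<omega>. \<bar>X \<omega> - Y \<omega>\<bar>)"
proof -
  have c: "char (distr M borel Z) t = (CLINT \<omega>|M. iexp (t * Z \<omega>))" if [measurable]: "Z \<in> borel_measurable M" for Z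
    unfolding char_def by (subst integral_distr) auto
  have i: "integrable M (\<lambda>\<omega>. iexp (t * Z \<omega>))" if [measurable]: "Z \<in> borel_measurable M" for Z
    by (rule integrable_const_bound[of _ 1]) auto
  have lip: "cmod (iexp (t * X \<omega>) - iexp (t * Y \<omega>)) \<le> \<bar>t\<bar> * \<bar>X \<omega> - Y \<omega>\<bar>" for \<omega>
  proof -
    have "iexp (t * X \<omega>) - iexp (t * Y \<omega>) = iexp (t * Y \<omega>) * (iexp (t * (X \<omega> - Y \<omega>)) - 1)"
      by (simp add: right_diff_distrib exp_add[symmetric])
    then have "cmod (iexp (t * X \<omega>) - iexp (t * Y \<omega>)) = cmod (iexp (t * (X \<omega> - Y \<omega>)) - 1)"
      by (simp only: norm_mult norm_exp_i_times mult_1)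
    also have "\<dots> \<le> \<bar>t * (X \<omega> - Y \<omega>)\<bar>" using iexp_approx1[of "t * (X \<omega> - Y \<omega>)" 0] by simp
    finally show ?thesis by (simp add: abs_mult)
  qed
  have "char (distr M borel X) t - char (distr M borel Y) t = (CLINT \<omega>|M. iexp (t * X \<omega>) - iexp (t * Y \<omega>))"
    unfolding c[OF assms(1)] c[OF assms(2)]
    by (rule Bochner_Integration.integral_diff[symmetric]) (rule i, measurable)+
  then have "cmod (char (distr M borel X) t - char (distr M borel Y) t) \<le> (\<integral>\<omega>. cmod (iexp (t * X \<omega>) - iexp (t * Y \<omega>)) \<partial>M)"
    by (simp only: integral_norm_bound)
  also have "\<dots> \<le> (\<integral>\<omega>. \<bar>t\<bar> * \<bar>X \<omega> - Y \<omega>\<bar> \<partial>M)"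
  proof (rule integral_mono)
    show "integrable M (\<lambda>\<omega>. cmod (iexp (t * X \<omega>) - iexp (t * Y \<omega>)))"
      by (intro integrable_norm Bochner_Integration.integrable_diff i) simp_all
    show "integrable M (\<lambda>\<omega>. \<bar>t\<bar> * \<bar>X \<omega> - Y \<omega>\<bar>)"
      by (intro integrable_mult_right integrable_abs int)
  qed (rule lip)
  finally show ?thesis by simp
qed

text \<open>Right continuity of the distribution function shows that the infimum in \<open>quantile\<close> is attained;
the lower tail equals the upper one by symmetry, which is read off from the characteristic
function.\<close>

lemma measure_std_normal_two_sided:
  assumes "0 < \<alpha>" "\<alpha> < 1"
  defines "z \<equiv> quantile std_normal_distribution (1 - \<alpha> / 2)"
  shows "measure std_normal_distribution {x. z \<le> \<bar>x\<bar>} \<le> \<alpha>"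
proof -
  let ?S = std_normal_distribution
  interpret S: real_distribution ?S by (rule real_dist_normal_dist)
  interpret S: cdf_distribution ?S ..
  have cdf: "1 - \<alpha> / 2 \<le> cdf ?S z"
    using S.pseudoinverse[of "1 - \<alpha> / 2" z] assms unfolding z_def quantile_def by simp
  have sym: "distr ?S borel uminus = ?S"
  proof (rule Levy_uniqueness)
    show "char (distr ?S borel uminus) = char ?S"
    proof
      fix t
      have "char (distr ?S borel uminus) t = char ?S (- t)"
        unfolding char_def by (subst integral_distr) auto
      then show "char (distr ?S borel uminus) t = char ?S t" by (simp add: char_std_normal_distribution)
    qed
  qed (auto intro!: S.real_distribution_distr real_dist_normal_dist)
  have atom: "measure ?S {x} = 0" for x
  proof -
    have "emeasure ?S {x} = 0" by (subst emeasure_density) (auto simp: nn_integral_cmult_indicator nn_integral_indicator_singleton)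
    then show ?thesis by (simp add: measure_def)
  qed
  have up: "measure ?S {z..} \<le> \<alpha> / 2"
  proof -
    have "measure ?S {z..} = measure ?S {z} + measure ?S {z<..}"
      by (subst S.finite_measure_Union[symmetric]) (auto intro!: arg_cong[where f="measure ?S"])
    also have "measure ?S {z<..} = 1 - cdf ?S z"
    proof -
      have "{z<..} = space ?S - {..z}" by auto
      then show ?thesis using S.prob_compl[of "{..z}"] by (simp add: cdf_def2)
    qed
    finally show ?thesis using cdf atom[of z] by simp
  qed
  have "measure ?S {..- z} = measure (distr ?S borel uminus) {..- z}" by (simp only: sym)
  also have "\<dots> = measure ?S {z..}"
    by (subst measure_distr) (auto intro!: arg_cong[where f="measure ?S"])
  finally have down: "measure ?S {..- z} \<le> \<alpha> / 2" using up by simp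
  have "measure ?S {x. z \<le> \<bar>x\<bar>} \<le> measure ?S ({z..} \<union> {..- z})"
    by (rule S.finite_measure_mono) auto
  also have "\<dots> \<le> measure ?S {z..} + measure ?S {..- z}"
    by (rule measure_Un_le) auto
  finally show ?thesis using up down by simp
qed

text \<open>Convergence in law, by Levy's continuity theorem, gives convergence of the probability of the
rejection region, whose boundary consists of at most two points.\<close>

theorem (in prob_space) two_sided_rejection_limsup:
  fixes X :: "nat \<Rightarrow> 'a \<Rightarrow> real"
  assumes \<alpha>: "0 < \<alpha>" "\<alpha> < 1" and meas[measurable]: "\<And>k. X k \<in> borel_measurable M"
    and char: "\<And>t. (\<lambda>k. char (distr M borel (X k)) t) \<longlonglongrightarrow> of_real (exp (- (t\<^sup>2) / 2))"
  shows "limsup (\<lambda>k. ereal (prob {\<omega> \<in> space M. quantile std_normal_distribution (1 - \<alpha> / 2) \<le> \<bar>X k \<omega>\<bar>})) \<le> ereal \<alpha>"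
proof -
  let ?z = "quantile std_normal_distribution (1 - \<alpha> / 2)" and ?S = std_normal_distribution
  let ?A = "{x::real. ?z \<le> \<bar>x\<bar>}"
  interpret S: real_distribution ?S by (rule real_dist_normal_dist)
  have rd: "real_distribution (distr M borel (X k))" for k by (rule real_distribution_distr) simp
  have wc: "weak_conv_m (\<lambda>k. distr M borel (X k)) ?S"
    by (rule levy_continuity[OF rd real_dist_normal_dist]) (use char in \<open>simp add: char_std_normal_distribution\<close>)
  have "frontier ?A \<subseteq> {?z, - ?z}"
  proof -
    have closed: "closed ?A" by (intro closed_Collect_le continuous_intros)
    have "open {x::real. ?z < \<bar>x\<bar>}" by (intro open_Collect_less continuous_intros)
    then have sub: "{x::real. ?z < \<bar>x\<bar>} \<subseteq> interior ?A" by (intro interior_maximal) auto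
    show ?thesis
    proof
      fix x assume "x \<in> frontier ?A"
      then have "x \<in> ?A" "x \<notin> interior ?A"
        using closure_closed[OF closed] unfolding frontier_def by blast+
      then have "?z \<le> \<bar>x\<bar>" "\<not> ?z < \<bar>x\<bar>" using sub by blast+
      then have "x = ?z \<or> x = - ?z" by linarith
      then show "x \<in> {?z, - ?z}" by simp
    qed
  qed
  moreover have "emeasure ?S {?z, - ?z} = 0"
  proof -
    have "{?z, - ?z} \<in> null_sets lborel" by (simp add: finite_imp_null_set_lborel)
    then show ?thesis by (subst emeasure_density) (auto simp: nn_integral_null_set)
  qed
  ultimately have fr: "emeasure ?S (frontier ?A) = 0"
    by (metis emeasure_mono le_zero_eq sets_density sets_lborel borel_closed finite.emptyI finite_insert finite_imp_closed)
  have Am: "?A \<in> sets borel" by measurable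
  have "(\<lambda>k. measure (distr M borel (X k)) ?A) \<longlonglongrightarrow> measure ?S ?A"
    by (rule weak_conv_imp_continuity_set_conv[OF rd real_dist_normal_dist wc Am fr])
  moreover have "measure (distr M borel (X k)) ?A = prob {\<omega> \<in> space M. ?z \<le> \<bar>X k \<omega>\<bar>}" for k
    by (subst measure_distr[OF meas Am]) (auto intro!: arg_cong[where f=prob])
  ultimately have "(\<lambda>k. ereal (prob {\<omega> \<in> space M. ?z \<le> \<bar>X k \<omega>\<bar>})) \<longlonglongrightarrow> ereal (measure ?S ?A)"
    by (simp add: lim_ereal)
  then have "limsup (\<lambda>k. ereal (prob {\<omega> \<in> space M. ?z \<le> \<bar>X k \<omega>\<bar>})) = ereal (measure ?S ?A)"
    by (rule lim_imp_Limsup[OF sequentially_bot])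
  then show ?thesis using measure_std_normal_two_sided[OF \<alpha>] by simp
qed

section \<open>An undetectable alternative\<close>

text \<open>Equal parts of cosine and sine of frequency \<open>r\<close>. On the grid this is a multiple of a single Hartley
vector, so it shifts exactly one coordinate of the noise.\<close>

definition spike_coeff :: "real \<Rightarrow> nat \<Rightarrow> nat \<Rightarrow> real" where
  "spike_coeff A r i = (if freq (Suc i) = r then A / sqrt 2 else 0)"

definition spike :: "real \<Rightarrow> nat \<Rightarrow> real \<Rightarrow> real" where
  "spike A r = trig_series (spike_coeff A r)"

lemma spike_coeff_sums:
  fixes F :: "real \<Rightarrow> nat \<Rightarrow> real"
  assumes r: "r > 0" and F0: "\<And>i. F 0 i = 0"
  shows "(\<lambda>i. F (spike_coeff A r i) i) sums (F (A / sqrt 2) (2 * r - 2) + F (A / sqrt 2) (2 * r - 1))"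
proof -
  have iff: "freq (Suc i) = r \<longleftrightarrow> i = 2 * r - 2 \<or> i = 2 * r - 1" for i using r by auto
  have "(\<lambda>i. F (spike_coeff A r i) i) sums (\<Sum>i\<in>{2 * r - 2, 2 * r - 1}. F (spike_coeff A r i) i)"
    by (rule sums_finite) (auto simp: spike_coeff_def iff F0)
  moreover have "(\<Sum>i\<in>{2 * r - 2, 2 * r - 1}. F (spike_coeff A r i) i) = F (A / sqrt 2) (2 * r - 2) + F (A / sqrt 2) (2 * r - 1)"
  proof -
    have "2 * r - 2 \<noteq> 2 * r - 1" using r by auto
    moreover have "spike_coeff A r (2 * r - 2) = A / sqrt 2" "spike_coeff A r (2 * r - 1) = A / sqrt 2"
      unfolding spike_coeff_def iff by auto
    ultimately show ?thesis by simp
  qed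
  ultimately show ?thesis by simp
qed

lemma spike_freq:
  assumes "r > 0"
  shows "freq (Suc (2 * r - 2)) = r" "freq (Suc (2 * r - 1)) = r" "odd (Suc (2 * r - 2))" "even (Suc (2 * r - 1))"
  using assms by (auto simp: even_Suc)

lemma spike_sobolev_sums:
  assumes r: "r > 0"
  shows "(\<lambda>i. (spike_coeff A r i)\<^sup>2 * trig_eigenvalue m (Suc i)) sums (A\<^sup>2 * (2 * pi * real r) ^ (2 * m))"
  using spike_coeff_sums[OF r, of "\<lambda>x i. x\<^sup>2 * trig_eigenvalue m (Suc i)" A]
  unfolding trig_eigenvalue_def spike_freq[OF r] by (simp add: power_divide)

lemma spike_coeffs: "r > 0 \<Longrightarrow> sobolev_coeffs m (spike_coeff A r)"
  unfolding sobolev_coeffs_def using spike_sobolev_sums by (rule sums_summable)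

lemma spike_sobolev_ball:
  assumes "m \<ge> 1" "r > 0" "A\<^sup>2 * (2 * pi * real r) ^ (2 * m) \<le> C"
  shows "spike A r \<in> sobolev_ball m C"
  using assms spike_coeffs[OF assms(2)] sobolev_form_trig_series[OF assms(1) spike_coeffs[OF assms(2)]]
    sums_unique[OF spike_sobolev_sums[OF assms(2), of A m]]
  unfolding sobolev_ball_def sobolev_eq spike_def by auto

lemma L2norm_spike:
  assumes "r > 0" "A \<ge> 0"
  shows "L2norm (spike A r) = A"
proof -
  have "(L2norm (spike A r))\<^sup>2 = A\<^sup>2"
    unfolding spike_def L2norm_trig_series[OF order_refl spike_coeffs[OF assms(1)]]
    using sums_unique[OF spike_coeff_sums[OF assms(1), of "\<lambda>x i. x\<^sup>2" A]] by (simp add: power_divide)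
  moreover have "0 \<le> L2norm (spike A r)" by (simp add: L2norm_def set_integral_unit_interval)
  ultimately show ?thesis using assms(2) by (simp add: power2_eq_iff_nonneg)
qed

lemma spike_on_grid:
  assumes r: "r > 0" and N: "N > 0"
  shows "spike A r (real l / real N) = A * sqrt (real N) * hartley N (int r) l"
proof -
  let ?t = "real l / real N"
  have "spike A r ?t = A / sqrt 2 * trig_basis (Suc (2 * r - 2)) ?t + A / sqrt 2 * trig_basis (Suc (2 * r - 1)) ?t"
    unfolding spike_def trig_series_def
    using sums_unique[OF spike_coeff_sums[OF r, of "\<lambda>x i. x * trig_basis (Suc i) ?t" A]] by simp
  also have "\<dots> = A * (cos (2 * pi * real r * ?t) + sin (2 * pi * real r * ?t))"
    unfolding trig_basis_def spike_freq[OF r] using spike_freq(3,4)[OF r] by (simp add: distrib_left)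
  also have "\<dots> = A * (sqrt 2 * cos (2 * pi * real r * ?t - pi / 4))"
  proof -
    have factor: "c * (x * (c / 2) + y * (c / 2)) = c * c / 2 * (x + y)" for c x y :: real
      by (simp add: algebra_simps add_divide_distrib)
    have "sqrt 2 * (x * (sqrt 2 / 2) + y * (sqrt 2 / 2)) = x + y" for x y :: real
      unfolding factor by simp
    then show ?thesis unfolding cos_diff cos_45 sin_45 by (simp only:)
  qed
  also have "\<dots> = A * sqrt (real N) * hartley N (int r) l"
    using N by (simp add: hartley_def real_sqrt_divide)
  finally show ?thesis .
qed

section \<open>The normalized test statistic\<close>

text \<open>One stage \<open>k\<close> of the asymptotics. The noise and the statistic for the alternative \<open>spike A r\<close> live
on the same probability space, so the two laws can be compared through the difference of the
variables.\<close>

locale distributed_regression = prob_space M for M :: "'a measure" +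
  fixes m s n :: nat and lam :: real and \<epsilon> :: "nat \<Rightarrow> 'a \<Rightarrow> real"
  assumes m: "m \<ge> 1" and s: "s > 0" and n: "n > 0" and lam: "lam > 0"
    and iid: "iid_std_normal M \<epsilon> (s * n)"
begin

abbreviation "N \<equiv> s * n"
abbreviation "a \<equiv> noise_weight m N n lam"
abbreviation "u \<equiv> \<lambda>p l. hartley N (int p) l"
abbreviation "g \<equiv> \<lambda>p \<omega>. \<Sum>l<N. u p l * \<epsilon> l \<omega>"

definition "\<sigma> = sqrt (2 * (\<Sum>p<N. (a p)\<^sup>2))"
definition "null_stat \<omega> = (\<Sum>p<N. a p * (g p \<omega>)\<^sup>2)"
definition "spike_stat A r \<omega> = null_stat \<omega> + a r * (2 * (A * sqrt (real N)) * g r \<omega> + (A * sqrt (real N))\<^sup>2)"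

lemma N_pos: "N > 0" using s n by simp

lemma test_stat_null: "test_stat m s n lam (observations N \<epsilon> (\<lambda>_. 0) \<omega>) = null_stat \<omega>"
  unfolding test_stat_diagonal[OF m lam n s] hartley_coeff_def observations_def null_stat_def by simp

lemma test_stat_spike:
  assumes r: "r > 0" "r < N"
  shows "test_stat m s n lam (observations N \<epsilon> (spike A r) \<omega>) = spike_stat A r \<omega>"
proof -
  let ?b = "A * sqrt (real N)"
  have c: "hartley_coeff N (observations N \<epsilon> (spike A r) \<omega>) (int p) = ?b * of_bool (p = r) + g p \<omega>" if p: "p < N" for p
  proof -
    have "hartley_coeff N (observations N \<epsilon> (spike A r) \<omega>) (int p) = (\<Sum>l<N. ?b * (u p l * u r l) + u p l * \<epsilon> l \<omega>)"
      unfolding hartley_coeff_def observations_def spike_on_grid[OF r(1) N_pos]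
      by (intro sum.cong refl) (simp add: algebra_simps)
    also have "\<dots> = ?b * of_bool (p = r) + g p \<omega>"
      unfolding sum.distrib sum_distrib_left[symmetric] hartley_orthonormal[OF N_pos p r(2)] ..
    finally show ?thesis .
  qed
  have "test_stat m s n lam (observations N \<epsilon> (spike A r) \<omega>)
      = (\<Sum>p<N. a p * (?b * of_bool (p = r) + g p \<omega>)\<^sup>2)"
    unfolding test_stat_diagonal[OF m lam n s] by (intro sum.cong refl) (simp add: c)
  also have "\<dots> = (\<Sum>p<N. a p * (g p \<omega>)\<^sup>2 + (if p = r then a r * (2 * ?b * g r \<omega> + ?b\<^sup>2) else 0))"
    by (intro sum.cong refl) (simp add: power2_sum algebra_simps)
  also have "\<dots> = spike_stat A r \<omega>"
    unfolding sum.distrib spike_stat_def null_stat_def using r by simp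
  finally show ?thesis .
qed

lemma g_measurable: "g p \<in> borel_measurable M"
  by (rule iid_std_normal_linear_measurable[OF iid])

lemma null_stat_measurable[measurable]: "null_stat \<in> borel_measurable M"
  unfolding null_stat_def
  by (intro borel_measurable_sum borel_measurable_times borel_measurable_const borel_measurable_power g_measurable)

lemma spike_stat_measurable[measurable]: "spike_stat A r \<in> borel_measurable M"
  unfolding spike_stat_def
  by (intro borel_measurable_add borel_measurable_times borel_measurable_const g_measurable null_stat_measurable)

lemma chi_square_measurable[measurable]: "(\<lambda>\<omega>. \<Sum>p<N. a p * (\<epsilon> p \<omega>)\<^sup>2) \<in> borel_measurable M"
  by (intro borel_measurable_sum borel_measurable_times borel_measurable_const borel_measurable_power)
     (use iid_std_normal_measurable[OF iid] in auto)

text \<open>Hartley vectors are orthonormal, so the noise coordinates may be replaced by the noise itself.\<close>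

lemma distr_null_stat: "distr M borel null_stat = distr M borel (\<lambda>\<omega>. \<Sum>p<N. a p * (\<epsilon> p \<omega>)\<^sup>2)"
proof -
  have "distr M borel (\<lambda>\<omega>. \<Sum>p<N. a p * (g p \<omega>)\<^sup>2) = distr M borel (\<lambda>\<omega>. \<Sum>p<N. a p * (\<epsilon> p \<omega>)\<^sup>2)"
    by (rule distr_quadratic_orthonormal[OF iid])
       (auto simp: hartley_orthonormal[OF N_pos] noise_weight_nonneg[OF m lam n])
  then show ?thesis by (simp add: null_stat_def[abs_def])
qed

lemma distr_image_null_stat:
  assumes [measurable]: "f \<in> borel_measurable borel"
  shows "distr M borel (\<lambda>\<omega>. f (null_stat \<omega>)) = distr M borel (\<lambda>\<omega>. f (\<Sum>p<N. a p * (\<epsilon> p \<omega>)\<^sup>2))"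
proof -
  have "distr M borel (\<lambda>\<omega>. f (null_stat \<omega>)) = distr (distr M borel null_stat) borel f"
    by (subst distr_distr) (auto simp: comp_def)
  also have "\<dots> = distr M borel (\<lambda>\<omega>. f (\<Sum>p<N. a p * (\<epsilon> p \<omega>)\<^sup>2))"
    unfolding distr_null_stat by (subst distr_distr) (auto simp: comp_def)
  finally show ?thesis .
qed

lemma expectation_image_null_stat:
  fixes f :: "real \<Rightarrow> real"
  assumes [measurable]: "f \<in> borel_measurable borel"
  shows "expectation (\<lambda>\<omega>. f (null_stat \<omega>)) = expectation (\<lambda>\<omega>. f (\<Sum>p<N. a p * (\<epsilon> p \<omega>)\<^sup>2))"
proof -
  have "expectation (\<lambda>\<omega>. f (null_stat \<omega>)) = integral\<^sup>L (distr M borel null_stat) f"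
    by (subst integral_distr) auto
  also have "\<dots> = expectation (\<lambda>\<omega>. f (\<Sum>p<N. a p * (\<epsilon> p \<omega>)\<^sup>2))"
    unfolding distr_null_stat by (subst integral_distr) auto
  finally show ?thesis .
qed

lemma null_mean_eq: "null_mean M \<epsilon> m s n lam = (\<Sum>p<N. a p)"
  unfolding null_mean_def test_stat_null
  using expectation_image_null_stat[of "\<lambda>x. x"] weighted_chi_square_moments(1)[OF iid, of a] by simp

lemma null_sd_eq: "null_sd M \<epsilon> m s n lam = \<sigma>"
proof -
  have E: "expectation null_stat = expectation (\<lambda>\<omega>. \<Sum>p<N. a p * (\<epsilon> p \<omega>)\<^sup>2)"
    using expectation_image_null_stat[of "\<lambda>x. x"] by simp
  have "variance null_stat = variance (\<lambda>\<omega>. \<Sum>p<N. a p * (\<epsilon> p \<omega>)\<^sup>2)"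
    unfolding E by (rule expectation_image_null_stat) simp
  then show ?thesis
    unfolding null_sd_def test_stat_null \<sigma>_def using weighted_chi_square_moments(2)[OF iid, of a] by simp
qed

definition "normalized_spike_stat A r \<omega> = (spike_stat A r \<omega> - (\<Sum>p<N. a p)) / \<sigma>"

lemma normalized_spike_stat_measurable: "normalized_spike_stat A r \<in> borel_measurable M"
  unfolding normalized_spike_stat_def by measurable

lemma rejection_prob_spike:
  assumes "\<sigma> > 0" "r > 0" "r < N"
  shows "rejection_prob M \<epsilon> m s n lam \<alpha> (spike A r)
    = prob {\<omega> \<in> space M. quantile std_normal_distribution (1 - \<alpha> / 2) \<le> \<bar>normalized_spike_stat A r \<omega>\<bar>}"
proof -
  have cond: "quantile std_normal_distribution (1 - \<alpha> / 2) * \<sigma> \<le> \<bar>x\<bar> \<longleftrightarrow>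
     quantile std_normal_distribution (1 - \<alpha> / 2) \<le> \<bar>x / \<sigma>\<bar>" for x
    using assms(1) by (simp add: abs_divide pos_le_divide_eq)
  show ?thesis
    unfolding rejection_prob_def wald_test_def test_stat_spike[OF assms(2,3)] null_mean_eq null_sd_eq
      normalized_spike_stat_def of_bool_eq_1_iff cond ..
qed

text \<open>The first term on the right is the mean absolute shift caused by the spike, a linear part and a
quadratic part in \<open>A * sqrt N\<close>; the second is the error of the normal approximation under the null
hypothesis, where \<open>\<delta>\<close> bounds the normalized weights.\<close>

lemma char_normalized_spike_stat:
  assumes C: "\<And>\<theta>. \<bar>\<theta>\<bar> \<le> 1 \<Longrightarrow>
      cmod (char (distr std_normal_distribution borel (\<lambda>x. x\<^sup>2 - 1)) \<theta> - of_real (exp (- (\<theta>\<^sup>2)))) \<le> C * \<bar>\<theta>\<bar> ^ 3"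
    and C0: "C \<ge> 0" and \<sigma>: "\<sigma> > 0" and r: "r < N" and A: "A \<ge> 0"
    and \<delta>: "1 / (real N * \<sigma>) \<le> \<delta>" "\<bar>t\<bar> * \<delta> \<le> 1"
  shows "cmod (char (distr M borel (normalized_spike_stat A r)) t - of_real (exp (- (t\<^sup>2) / 2)))
    \<le> \<bar>t\<bar> * (a r * (2 * (A * sqrt (real N)) + (A * sqrt (real N))\<^sup>2) / \<sigma>) + C * \<bar>t\<bar> ^ 3 * \<delta>"
proof -
  let ?b = "A * sqrt (real N)" and ?Z = "\<lambda>\<omega>. (null_stat \<omega> - (\<Sum>p<N. a p)) / \<sigma>"
  have b0: "?b \<ge> 0" using A by simp
  have a0: "a p \<ge> 0" for p by (rule noise_weight_nonneg[OF m lam n])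
  have Zm: "?Z \<in> borel_measurable M" by measurable
  have unit: "(\<Sum>l<N. (u r l)\<^sup>2) = 1"
    using hartley_orthonormal[OF N_pos r r] by (simp add: power2_eq_square)
  note gi = expectation_abs_normalized_linear_le[OF iid unit]
  have diff: "normalized_spike_stat A r \<omega> - ?Z \<omega> = a r / \<sigma> * (2 * ?b * g r \<omega> + ?b\<^sup>2)" for \<omega>
    unfolding normalized_spike_stat_def spike_stat_def by (simp add: diff_divide_distrib[symmetric])
  have int: "integrable M (\<lambda>\<omega>. normalized_spike_stat A r \<omega> - ?Z \<omega>)"
    unfolding diff by (intro integrable_mult_right Bochner_Integration.integrable_add gi integrable_const)
  have "expectation (\<lambda>\<omega>. \<bar>normalized_spike_stat A r \<omega> - ?Z \<omega>\<bar>) \<le> expectation (\<lambda>\<omega>. a r / \<sigma> * (2 * ?b * \<bar>g r \<omega>\<bar> + ?b\<^sup>2))"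
  proof (rule integral_mono)
    show "integrable M (\<lambda>\<omega>. a r / \<sigma> * (2 * ?b * \<bar>g r \<omega>\<bar> + ?b\<^sup>2))"
      by (intro integrable_mult_right Bochner_Integration.integrable_add integrable_abs gi integrable_const)
    fix \<omega>
    have tri: "\<bar>2 * b * G + b\<^sup>2\<bar> \<le> 2 * b * \<bar>G\<bar> + b\<^sup>2" if "0 \<le> b" for b G :: real
      using that abs_triangle_ineq[of "2 * b * G" "b\<^sup>2"] by (simp add: abs_mult)
    have "0 \<le> a r / \<sigma>" using a0[of r] \<sigma> by simp
    then show "\<bar>normalized_spike_stat A r \<omega> - ?Z \<omega>\<bar> \<le> a r / \<sigma> * (2 * ?b * \<bar>g r \<omega>\<bar> + ?b\<^sup>2)"
      unfolding diff abs_mult[of "a r / \<sigma>"] abs_of_nonneg[OF \<open>0 \<le> a r / \<sigma>\<close>]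
      by (intro mult_left_mono tri b0)
  qed (intro integrable_abs int)
  also have "\<dots> = a r / \<sigma> * (2 * ?b * expectation (\<lambda>\<omega>. \<bar>g r \<omega>\<bar>) + ?b\<^sup>2)"
    using integrable_abs[OF gi(1)] by (simp add: prob_space)
  also have "\<dots> \<le> a r / \<sigma> * (2 * ?b * 1 + ?b\<^sup>2)"
    using gi(2) b0 a0[of r] \<sigma> by (intro mult_left_mono add_right_mono) auto
  finally have L1: "expectation (\<lambda>\<omega>. \<bar>normalized_spike_stat A r \<omega> - ?Z \<omega>\<bar>) \<le> a r * (2 * ?b + ?b\<^sup>2) / \<sigma>" by simp
  have "cmod (char (distr M borel (normalized_spike_stat A r)) t - char (distr M borel ?Z) t)
     \<le> \<bar>t\<bar> * expectation (\<lambda>\<omega>. \<bar>normalized_spike_stat A r \<omega> - ?Z \<omega>\<bar>)"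
    by (rule char_perturbation[OF normalized_spike_stat_measurable Zm int])
  also have "\<dots> \<le> \<bar>t\<bar> * (a r * (2 * ?b + ?b\<^sup>2) / \<sigma>)" by (intro mult_left_mono L1) simp
  finally have 1: "cmod (char (distr M borel (normalized_spike_stat A r)) t - char (distr M borel ?Z) t)
     \<le> \<bar>t\<bar> * (a r * (2 * ?b + ?b\<^sup>2) / \<sigma>)" .
  have "distr M borel ?Z = distr M borel (\<lambda>\<omega>. ((\<Sum>p<N. a p * (\<epsilon> p \<omega>)\<^sup>2) - (\<Sum>p<N. a p)) / \<sigma>)"
    by (rule distr_image_null_stat) measurable
  also have "(\<lambda>\<omega>. ((\<Sum>p<N. a p * (\<epsilon> p \<omega>)\<^sup>2) - (\<Sum>p<N. a p)) / \<sigma>) = (\<lambda>\<omega>. \<Sum>p<N. a p / \<sigma> * ((\<epsilon> p \<omega>)\<^sup>2 - 1))"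
    by (simp add: sum_subtractf[symmetric] sum_divide_distrib right_diff_distrib diff_divide_distrib)
  finally have dZ: "distr M borel ?Z = distr M borel (\<lambda>\<omega>. \<Sum>p<N. a p / \<sigma> * ((\<epsilon> p \<omega>)\<^sup>2 - 1))" .
  have 2: "cmod (char (distr M borel ?Z) t - of_real (exp (- (t\<^sup>2) / 2))) \<le> C * \<bar>t\<bar> ^ 3 * \<delta>"
    unfolding dZ
  proof (rule char_weighted_chi_square_approx[OF iid C C0 _ \<delta>(2)])
    show "2 * (\<Sum>p<N. (a p / \<sigma>)\<^sup>2) = 1"
    proof -
      have "2 * (\<Sum>p<N. (a p / \<sigma>)\<^sup>2) = 2 * (\<Sum>p<N. (a p)\<^sup>2) / \<sigma>\<^sup>2"
        by (simp add: power_divide sum_divide_distrib[symmetric])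
      also have "2 * (\<Sum>p<N. (a p)\<^sup>2) = \<sigma>\<^sup>2" unfolding \<sigma>_def by (simp add: sum_nonneg)
      finally show ?thesis using \<sigma> by simp
    qed
    fix p
    have "a p \<le> 1 / real N" by (rule noise_weight_le[OF m lam n]) simp
    then have "a p / \<sigma> \<le> 1 / real N / \<sigma>" using \<sigma> by (intro divide_right_mono) auto
    then show "\<bar>a p / \<sigma>\<bar> \<le> \<delta>" using \<delta>(1) a0[of p] \<sigma> by simp
  qed
  show ?thesis by (rule norm_diff_triangle_le[OF 1 2])
qed

lemma \<sigma>_ge:
  assumes h: "h = lam powr (1 / (2 * real m))" and K: "effective_dim n h \<ge> 4"
  shows "sqrt (effective_dim n h / 1250) / real N \<le> \<sigma>"
proof -
  have "effective_dim n h / (4 * 625 * (real N)\<^sup>2) \<le> (\<Sum>p<N. (a p)\<^sup>2)"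
    by (rule sum_noise_weight_squares_ge[OF m lam n h refl s K])
  then have "effective_dim n h / 1250 / (real N)\<^sup>2 \<le> 2 * (\<Sum>p<N. (a p)\<^sup>2)" by simp
  then have "sqrt (effective_dim n h / 1250 / (real N)\<^sup>2) \<le> \<sigma>" unfolding \<sigma>_def by (rule real_sqrt_le_mono)
  then show ?thesis unfolding real_sqrt_divide[of _ "(real N)\<^sup>2"] real_sqrt_abs abs_of_nat .
qed

end

section \<open>The asymptotic statement\<close>

lemma effective_dim_at_top:
  assumes n: "filterlim n at_top sequentially" and h: "h \<longlonglongrightarrow> 0" and hpos: "\<And>k. h k > 0"
  shows "filterlim (\<lambda>k. effective_dim (n k) (h k)) at_top sequentially"
  unfolding filterlim_at_top
proof
  fix Z :: real
  have "filterlim (\<lambda>k. 1 / (2 * pi * h k)) at_top sequentially"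
  proof -
    have "(\<lambda>k. 2 * pi * h k) \<longlonglongrightarrow> 0" using tendsto_mult_left[OF h, of "2 * pi"] by simp
    then have "filterlim (\<lambda>k. inverse (2 * pi * h k)) at_top sequentially"
      by (rule filterlim_inverse_at_top) (use hpos in simp)
    then show ?thesis by (simp only: inverse_eq_divide)
  qed
  then have "\<forall>\<^sub>F k in sequentially. Z \<le> 1 / (2 * pi * h k)" by (simp add: filterlim_at_top)
  moreover have "\<forall>\<^sub>F k in sequentially. Z \<le> real (n k)"
    using filterlim_compose[OF filterlim_real_sequentially n] by (simp add: filterlim_at_top)
  ultimately show "\<forall>\<^sub>F k in sequentially. Z \<le> effective_dim (n k) (h k)"
    by eventually_elim (simp add: effective_dim_def)
qed

text \<open>
The left side is the bound for the shift of the statistic over the bound for its standard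
deviation, with \<open>\<rho> = n / R\<close> and the squared norm \<open>C / (2 * pi * r) ^ (2 * m)\<close> of the spike. All
powers of \<open>R\<close> cancel against \<open>Nr = N\<close>, and \<open>r \<ge> R * \<rho> powr (1 / 4)\<close> costs only \<open>\<rho> powr (- m)\<close>
of the gain \<open>\<rho> powr (2 * m - 1 / 2)\<close>, which leaves a positive power of \<open>\<rho>\<close>.\<close>

lemma shift_to_noise_bound:
  fixes K R \<rho> Nr C r :: real and m :: nat
  assumes m: "m \<ge> 1" and K: "K > 0" "K \<le> \<rho> * R" and R: "R > 0" and \<rho>: "\<rho> > 0"
    and N: "Nr = R powr (2 * real m + 1 / 2)" and r: "r \<ge> R * \<rho> powr (1 / 4)" and C: "C > 0"
  shows "(K / r) ^ (2 * m) * (C / (2 * pi * r) ^ (2 * m)) * Nr / sqrt (K / 1250)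
     \<le> C * sqrt 1250 * \<rho> powr (real m - 1 / 2)"
proof -
  define q where "q = R * \<rho> powr (1 / 4)"
  have q: "q > 0" using R \<rho> by (simp add: q_def)
  then have r0: "r > 0" using r by (simp add: q_def)
  have e: "2 * real m - 1 / 2 \<ge> 0" using m by simp
  have "(K / r) ^ (2 * m) * (C / (2 * pi * r) ^ (2 * m)) * Nr / sqrt (K / 1250)
     \<le> (K / r) ^ (2 * m) * (C / r ^ (2 * m)) * Nr / sqrt (K / 1250)"
  proof (intro divide_right_mono mult_right_mono mult_left_mono divide_left_mono)
    have "1 * r \<le> 2 * pi * r" using pi_gt3 r0 by (intro mult_right_mono) auto
    then show "r ^ (2 * m) \<le> (2 * pi * r) ^ (2 * m)" using r0 by (intro power_mono) auto
  qed (use K r0 C N in auto)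
  also have "\<dots> = C * sqrt 1250 * (K powr (2 * real m - 1 / 2) * r powr (- (4 * real m)) * Nr)"
  proof -
    have Kp: "K ^ (2 * m) / sqrt K = K powr (2 * real m - 1 / 2)"
      using K by (simp add: powr_diff powr_half_sqrt powr_realpow[symmetric])
    have rp: "r ^ (2 * m) * r ^ (2 * m) = r powr (4 * real m)"
      using r0 by (simp add: powr_realpow[symmetric] powr_add[symmetric])
    have "(K / r) ^ (2 * m) * (C / r ^ (2 * m)) * Nr / sqrt (K / 1250)
      = C * sqrt 1250 * (K ^ (2 * m) / sqrt K) * (1 / (r ^ (2 * m) * r ^ (2 * m))) * Nr"
      using K r0 by (simp add: power_divide real_sqrt_divide field_simps)
    also have "\<dots> = C * sqrt 1250 * K powr (2 * real m - 1 / 2) * r powr (- (4 * real m)) * Nr"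
      unfolding Kp rp powr_minus_divide ..
    finally show ?thesis by (simp only: mult_ac)
  qed
  also have "\<dots> \<le> C * sqrt 1250 * ((\<rho> * R) powr (2 * real m - 1 / 2) * q powr (- (4 * real m)) * Nr)"
  proof (intro mult_left_mono mult_right_mono mult_mono)
    show "K powr (2 * real m - 1 / 2) \<le> (\<rho> * R) powr (2 * real m - 1 / 2)"
      using K e by (intro powr_mono2) auto
    show "r powr (- (4 * real m)) \<le> q powr (- (4 * real m))"
      using q r by (intro powr_mono2') (auto simp: q_def)
  qed (use C N in auto)
  also have "(\<rho> * R) powr (2 * real m - 1 / 2) * q powr (- (4 * real m)) * Nr = \<rho> powr (real m - 1 / 2)"
  proof -
    have "(\<rho> * R) powr (2 * real m - 1 / 2) * q powr (- (4 * real m)) * Nr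
      = (\<rho> powr (2 * real m - 1 / 2) * \<rho> powr (- real m))
        * (R powr (2 * real m - 1 / 2) * R powr (- (4 * real m)) * R powr (2 * real m + 1 / 2))"
      using R \<rho> unfolding q_def N by (simp add: powr_mult powr_powr)
    also have "\<dots> = \<rho> powr (real m - 1 / 2)"
      using R \<rho> by (simp add: powr_add[symmetric])
    finally show ?thesis .
  qed
  finally show ?thesis .
qed

theorem theorem4p3:
  fixes m :: nat and C \<alpha> :: real
    and N n s :: "nat \<Rightarrow> nat" and lam h :: "nat \<Rightarrow> real"
    and M :: "'a measure" and e :: "nat \<Rightarrow> nat \<Rightarrow> 'a \<Rightarrow> real"
  assumes "m \<ge> 1" and "C > 0" and "0 < \<alpha>" and "\<alpha> < 1"
    and "\<And>k. n k > 0" and "\<And>k. s k > 0" and "\<And>k. N k = s k * n k"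
    and "\<And>k. lam k > 0" and "\<And>k. h k = lam k powr (1 / (2 * real m))"
    and "filterlim N at_top sequentially"
    and "prob_space M" and "\<And>k. iid_std_normal M (e k) (N k)"
    and "filterlim (\<lambda>k. real (s k) / real (N k) powr ((4 * real m - 1) / (4 * real m + 1)))
           at_top sequentially"
    and "h \<longlonglongrightarrow> 0"
    and "filterlim n at_top sequentially"
    and "\<exists>L :: ereal. (\<lambda>k. ereal (real (n k) * h k)) \<longlonglongrightarrow> L"
  shows "\<exists>\<beta> :: nat \<Rightarrow> real.
           (\<forall>k. \<beta> k > 0) \<and> filterlim \<beta> at_top sequentially \<and>
           limsup (\<lambda>k. INF f \<in> {f \<in> sobolev_ball m C. L2norm f \<ge> \<beta> k * separation_rate m (N k)}.
             ereal (rejection_prob M (e k) m (s k) (n k) (lam k) \<alpha> f)) \<le> ereal \<alpha>"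
proof -
  note m = assms(1) and C = assms(2) and n0 = assms(5) and s0 = assms(6) and N_eq = assms(7)
    and lam0 = assms(8) and h_eq = assms(9)
  interpret prob_space M by fact
  interpret D: distributed_regression M m "s k" "n k" "lam k" "e k" for k
    by unfold_locales (use assms(12) N_eq m s0 n0 lam0 in auto)
  have h0: "h k > 0" for k using h_eq[of k] lam0[of k] by simp
  have N0: "N k > 0" for k using N_eq[of k] n0[of k] s0[of k] by simp
  \<comment> \<open>The exponent \<open>1 / 4\<close> keeps \<open>r\<close> asymptotically between the number \<open>\<rho> * R\<close> of points per machine and \<open>R\<close>.
    The amplitude \<open>A\<close> puts the spike on the boundary of the ball, and \<open>\<beta>\<close> is defined so that its
    norm is exactly the required separation.\<close>
  define R where "R = (\<lambda>k. real (N k) powr (2 / (4 * real m + 1)))"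
  define \<rho> where "\<rho> = (\<lambda>k. real (n k) / R k)"
  define r where "r = (\<lambda>k. nat \<lceil>R k * \<rho> k powr (1 / 4)\<rceil>)"
  define A where "A = (\<lambda>k. sqrt C / (2 * pi * real (r k)) ^ m)"
  define \<beta> where "\<beta> = (\<lambda>k. A k / separation_rate m (N k))"
  define K where "K = (\<lambda>k. effective_dim (n k) (h k))"
  have R0: "R k > 0" for k using N0[of k] by (simp add: R_def)
  have \<rho>0: "\<rho> k > 0" for k using R0[of k] n0[of k] by (simp add: \<rho>_def)
  have r0: "r k > 0" for k using R0[of k] \<rho>0[of k] by (simp add: r_def)
  have r_ge: "R k * \<rho> k powr (1 / 4) \<le> real (r k)" for k unfolding r_def by linarith
  have r_le: "real (r k) \<le> R k * \<rho> k powr (1 / 4) + 1" for k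
  proof -
    have "0 \<le> R k * \<rho> k powr (1 / 4)" using R0[of k] by simp
    then show ?thesis unfolding r_def by linarith
  qed
  have A0: "A k > 0" for k using C r0[of k] by (simp add: A_def)
  have sep0: "separation_rate m (N k) > 0" for k using N0[of k] by (simp add: separation_rate_def)
  have sep: "separation_rate m (N k) = 1 / R k ^ m" for k
  proof -
    have "R k ^ m = real (N k) powr (2 / (4 * real m + 1) * real m)"
      using R0[of k] by (simp add: R_def powr_realpow[symmetric] powr_powr)
    moreover have "- (2 * real m) / (4 * real m + 1) = - (2 / (4 * real m + 1) * real m)" by simp
    ultimately show ?thesis unfolding separation_rate_def by (simp only: powr_minus_divide)
  qed
  have Nr: "real (N k) = R k powr (2 * real m + 1 / 2)" for k
  proof -
    have "2 / (4 * real m + 1) * (2 * real m + 1 / 2) = 1" by (simp add: field_simps)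
    then show ?thesis using N0[of k] unfolding R_def powr_powr by simp
  qed
  have N_top: "filterlim (\<lambda>k. real (N k)) at_top sequentially"
    by (rule filterlim_compose[OF filterlim_real_sequentially assms(10)])
  have R_inv: "(\<lambda>k. 1 / R k) \<longlonglongrightarrow> 0"
    using tendsto_neg_powr[OF _ N_top, of "- (2 / (4 * real m + 1))"]
    unfolding R_def powr_minus_divide by simp
  have \<rho>_lim: "\<rho> \<longlonglongrightarrow> 0"
  proof -
    have "real (s k) / real (N k) powr ((4 * real m - 1) / (4 * real m + 1)) = inverse (\<rho> k)" for k
    proof -
      have "(4 * real m - 1) / (4 * real m + 1) = 1 - 2 / (4 * real m + 1)" by (simp add: field_simps)
      then have "real (N k) powr ((4 * real m - 1) / (4 * real m + 1)) = real (N k) / R k"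
        using N0[of k] by (simp add: R_def powr_diff)
      then show ?thesis using n0[of k] s0[of k] R0[of k] by (simp add: \<rho>_def N_eq field_simps)
    qed
    then have "filterlim (\<lambda>k. inverse (\<rho> k)) at_top sequentially" using assms(13) by simp
    then have "(\<lambda>k. inverse (inverse (\<rho> k))) \<longlonglongrightarrow> 0"
      by (intro filterlim_compose[OF tendsto_inverse_0_at_top]) (auto simp: filterlim_ident)
    then show ?thesis by simp
  qed
  have rR_lim: "(\<lambda>k. real (r k) / R k) \<longlonglongrightarrow> 0"
  proof (rule tendsto_sandwich[OF _ _ tendsto_const])
    show "\<forall>\<^sub>F k in sequentially. real (r k) / R k \<le> \<rho> k powr (1 / 4) + 1 / R k"
    proof (rule always_eventually, rule allI)
      fix k
      have "real (r k) / R k \<le> (R k * \<rho> k powr (1 / 4) + 1) / R k"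
        using r_le[of k] R0[of k] by (intro divide_right_mono) auto
      then show "real (r k) / R k \<le> \<rho> k powr (1 / 4) + 1 / R k" using R0[of k] by (simp add: add_divide_distrib)
    qed
    have "(\<lambda>k. \<rho> k powr (1 / 4)) \<longlonglongrightarrow> 0"
      using tendsto_powr'[OF \<rho>_lim tendsto_const, of "1 / 4"] \<rho>0 by (simp add: less_imp_le)
    from tendsto_add[OF this R_inv] show "(\<lambda>k. \<rho> k powr (1 / 4) + 1 / R k) \<longlonglongrightarrow> 0" by simp
    show "\<forall>\<^sub>F k in sequentially. 0 \<le> real (r k) / R k" using R0 by (simp add: less_imp_le)
  qed
  have \<beta>_eq: "\<beta> k = sqrt C * (inverse (2 * pi * (real (r k) / R k))) ^ m" for k
    using R0[of k] r0[of k] by (simp add: \<beta>_def A_def sep power_mult_distrib power_divide power_inverse field_simps)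
  have \<beta>_top: "filterlim \<beta> at_top sequentially"
  proof -
    have "(\<lambda>k. 2 * pi * (real (r k) / R k)) \<longlonglongrightarrow> 0" using tendsto_mult_left[OF rR_lim, of "2 * pi"] by simp
    then have "filterlim (\<lambda>k. inverse (2 * pi * (real (r k) / R k))) at_top sequentially"
      by (rule filterlim_inverse_at_top) (use R0 r0 in simp)
    then have "filterlim (\<lambda>k. (inverse (2 * pi * (real (r k) / R k))) ^ m) at_top sequentially"
      by (rule filterlim_pow_at_top[rotated]) (use m in simp)
    then show ?thesis unfolding \<beta>_eq[abs_def]
      by (intro filterlim_tendsto_pos_mult_at_top[OF tendsto_const]) (use C in auto)
  qed
  have K_top: "filterlim K at_top sequentially"
    unfolding K_def by (rule effective_dim_at_top[OF assms(15,14) h0])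
  have K_ev: "\<forall>\<^sub>F k in sequentially. 4 \<le> K k" using K_top by (simp add: filterlim_at_top)
  have rN_ev: "\<forall>\<^sub>F k in sequentially. 2 * r k \<le> N k"
  proof -
    have "\<forall>\<^sub>F k in sequentially. real (r k) / R k < 1 / 2"
      by (rule order_tendstoD(2)[OF rR_lim]) simp
    then show ?thesis
    proof eventually_elim
      case (elim k)
      have "R k \<le> real (N k) powr 1"
        unfolding R_def using N0[of k] m by (intro powr_mono) auto
      then have "real (2 * r k) \<le> real (N k)" using elim R0[of k] N0[of k] by (simp add: field_simps)
      then show ?case by (simp only: of_nat_le_iff)
    qed
  qed
  define \<delta> where "\<delta> = (\<lambda>k. sqrt (1250 / K k))"
  have \<delta>_lim: "\<delta> \<longlonglongrightarrow> 0"
  proof -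
    have "(\<lambda>k. 1250 * inverse (K k)) \<longlonglongrightarrow> 1250 * 0"
      by (intro tendsto_mult tendsto_const tendsto_inverse_0_at_top[OF K_top])
    from tendsto_real_sqrt[OF this] show ?thesis
      unfolding \<delta>_def divide_inverse mult_zero_right real_sqrt_zero .
  qed
  define S where "S = (\<lambda>k. C * sqrt 1250 * \<rho> k powr (real m - 1 / 2))"
  have S_lim: "S \<longlonglongrightarrow> 0"
  proof -
    have "(\<lambda>k. \<rho> k powr (real m - 1 / 2)) \<longlonglongrightarrow> 0"
      using tendsto_powr'[OF \<rho>_lim tendsto_const, of "real m - 1 / 2"] \<rho>0 m by (simp add: less_imp_le)
    then show ?thesis unfolding S_def using tendsto_mult_left by fastforce
  qed
  define T where "T = (\<lambda>k. noise_weight m (N k) (n k) (lam k) (r k) *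
    (2 * (A k * sqrt (real (N k))) + (A k * sqrt (real (N k)))\<^sup>2) / D.\<sigma> k)"
  have step: "\<forall>\<^sub>F k in sequentially. D.\<sigma> k > 0 \<and> r k < N k \<and> 1 / (real (N k) * D.\<sigma> k) \<le> \<delta> k \<and>
     T k \<le> 2 * sqrt (S k * \<delta> k) + S k"
    using K_ev rN_ev
  proof eventually_elim
    case (elim k)
    let ?a = "noise_weight m (N k) (n k) (lam k) (r k)" and ?\<sigma> = "D.\<sigma> k" and ?b = "A k * sqrt (real (N k))"
    have K0: "K k > 0" using elim by simp
    have \<sigma>_ge: "sqrt (K k / 1250) / real (N k) \<le> ?\<sigma>"
      using D.\<sigma>_ge[OF h_eq] elim(1) by (simp add: K_def N_eq)
    have "0 < sqrt (K k / 1250) / real (N k)" using K0 N0[of k] by simp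
    then have \<sigma>0: "?\<sigma> > 0" using \<sigma>_ge by linarith
    have N\<sigma>: "sqrt (K k / 1250) \<le> real (N k) * ?\<sigma>"
      using \<sigma>_ge N0[of k] by (simp add: divide_le_eq mult.commute)
    have d: "1 / (real (N k) * ?\<sigma>) \<le> \<delta> k"
    proof -
      have "1 / (real (N k) * ?\<sigma>) \<le> 1 / sqrt (K k / 1250)"
        using N\<sigma> K0 N0[of k] \<sigma>0 by (intro divide_left_mono) auto
      then show ?thesis by (simp add: \<delta>_def real_sqrt_divide)
    qed
    have dvd: "n k dvd N k" by (simp add: N_eq)
    have a0: "0 \<le> ?a" by (rule noise_weight_nonneg[OF m lam0 n0])
    have a1: "?a \<le> 1 / real (N k)" by (rule noise_weight_le[OF m lam0 n0 dvd])
    have aw: "?a * real (N k) \<le> (K k / real (r k)) ^ (2 * m)"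
    proof -
      have "?a \<le> filter_weight m (n k) (lam k) (r k) / real (N k)"
        by (rule noise_weight_le_filter_weight[OF m lam0 n0 dvd r0 elim(2)])
      then have "?a * real (N k) \<le> filter_weight m (n k) (lam k) (r k)"
        using N0[of k] by (simp add: pos_le_divide_eq)
      also have "\<dots> \<le> (K k / real (r k)) ^ (2 * m)"
        unfolding K_def by (rule filter_weight_le_effective_dim[OF m lam0 n0 h_eq r0])
      finally show ?thesis .
    qed
    have A2: "(A k)\<^sup>2 = C / (2 * pi * real (r k)) ^ (2 * m)"
      using C by (simp add: A_def power_divide power_even_eq)
    have shift: "?a * ?b\<^sup>2 / ?\<sigma> \<le> S k"
    proof -
      have "?a * ?b\<^sup>2 / ?\<sigma> = (?a * real (N k)) * (A k)\<^sup>2 / ?\<sigma>" by (simp add: power_mult_distrib mult_ac)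
      also have "\<dots> \<le> (K k / real (r k)) ^ (2 * m) * (A k)\<^sup>2 / (sqrt (K k / 1250) / real (N k))"
        using aw \<sigma>_ge a0 K0 N0[of k] by (intro frac_le mult_mono) auto
      also have "\<dots> = (K k / real (r k)) ^ (2 * m) * (C / (2 * pi * real (r k)) ^ (2 * m)) * real (N k) / sqrt (K k / 1250)"
        unfolding A2 by simp
      also have "\<dots> \<le> S k" unfolding S_def
      proof (rule shift_to_noise_bound[OF m K0 _ R0 \<rho>0 Nr r_ge C])
        show "K k \<le> \<rho> k * R k" using R0[of k] by (simp add: K_def effective_dim_def \<rho>_def)
      qed
      finally show ?thesis .
    qed
    have S0: "0 \<le> S k" using C by (simp add: S_def)
    \<comment> \<open>The square of the linear part is the quadratic part times a normalized weight.\<close>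
    have cross: "?a * ?b / ?\<sigma> \<le> sqrt (S k * \<delta> k)"
    proof (rule real_le_rsqrt)
      have "(?a * ?b / ?\<sigma>)\<^sup>2 = (?a * ?b\<^sup>2 / ?\<sigma>) * (?a / ?\<sigma>)"
        by (simp add: power2_eq_square mult_ac)
      also have "\<dots> \<le> S k * \<delta> k"
      proof (intro mult_mono shift S0)
        have "?a / ?\<sigma> \<le> 1 / real (N k) / ?\<sigma>" using a1 \<sigma>0 by (intro divide_right_mono) auto
        then show "?a / ?\<sigma> \<le> \<delta> k" using d by simp
        show "0 \<le> ?a / ?\<sigma>" using a0 \<sigma>0 by simp
      qed
      finally show "(?a * ?b / ?\<sigma>)\<^sup>2 \<le> S k * \<delta> k" .
    qed
    have "T k = 2 * (?a * ?b / ?\<sigma>) + ?a * ?b\<^sup>2 / ?\<sigma>"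
      by (simp add: T_def distrib_left add_divide_distrib)
    then have "T k \<le> 2 * sqrt (S k * \<delta> k) + S k" using cross shift by linarith
    moreover have "r k < N k" using elim(2) r0[of k] by linarith
    ultimately show ?case using \<sigma>0 d by blast
  qed
  obtain B where B0: "B \<ge> 0" and B: "\<And>\<theta>. \<bar>\<theta>\<bar> \<le> 1 \<Longrightarrow>
    cmod (char (distr std_normal_distribution borel (\<lambda>x. x\<^sup>2 - 1)) \<theta> - of_real (exp (- (\<theta>\<^sup>2)))) \<le> B * \<bar>\<theta>\<bar> ^ 3"
    using char_centered_chi_square_approx by blast
  define X where "X = (\<lambda>k. D.normalized_spike_stat k (A k) (r k))"
  have char: "(\<lambda>k. char (distr M borel (X k)) t) \<longlonglongrightarrow> of_real (exp (- (t\<^sup>2) / 2))" for t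
  proof (rule LIM_zero_cancel, rule Lim_null_comparison)
    have "(\<lambda>k. \<bar>t\<bar> * \<delta> k) \<longlonglongrightarrow> 0" using tendsto_mult_left[OF \<delta>_lim, of "\<bar>t\<bar>"] by simp
    then have "\<forall>\<^sub>F k in sequentially. \<bar>t\<bar> * \<delta> k < 1" by (rule order_tendstoD(2)) simp
    with step show "\<forall>\<^sub>F k in sequentially. cmod (char (distr M borel (X k)) t - of_real (exp (- (t\<^sup>2) / 2)))
       \<le> \<bar>t\<bar> * (2 * sqrt (S k * \<delta> k) + S k) + B * \<bar>t\<bar> ^ 3 * \<delta> k"
    proof eventually_elim
      case (elim k)
      have "cmod (char (distr M borel (X k)) t - of_real (exp (- (t\<^sup>2) / 2)))
        \<le> \<bar>t\<bar> * T k + B * \<bar>t\<bar> ^ 3 * \<delta> k"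
        unfolding X_def T_def N_eq
        by (rule D.char_normalized_spike_stat[OF B B0]) (use elim A0[of k] in \<open>auto simp: N_eq\<close>)
      also have "\<dots> \<le> \<bar>t\<bar> * (2 * sqrt (S k * \<delta> k) + S k) + B * \<bar>t\<bar> ^ 3 * \<delta> k"
        using elim by (intro add_right_mono mult_left_mono) auto
      finally show ?case .
    qed
    have "(\<lambda>k. \<bar>t\<bar> * (2 * sqrt (S k * \<delta> k) + S k) + B * \<bar>t\<bar> ^ 3 * \<delta> k) \<longlonglongrightarrow> \<bar>t\<bar> * (2 * sqrt (0 * 0) + 0) + B * \<bar>t\<bar> ^ 3 * 0"
      by (intro tendsto_intros S_lim \<delta>_lim)
    then show "(\<lambda>k. \<bar>t\<bar> * (2 * sqrt (S k * \<delta> k) + S k) + B * \<bar>t\<bar> ^ 3 * \<delta> k) \<longlonglongrightarrow> 0" by simp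
  qed
  let ?inf = "\<lambda>k. INF f \<in> {f \<in> sobolev_ball m C. L2norm f \<ge> \<beta> k * separation_rate m (N k)}.
             ereal (rejection_prob M (e k) m (s k) (n k) (lam k) \<alpha> f)"
  have "limsup ?inf
     \<le> limsup (\<lambda>k. ereal (prob {\<omega> \<in> space M. quantile std_normal_distribution (1 - \<alpha> / 2) \<le> \<bar>X k \<omega>\<bar>}))"
  proof (rule Limsup_mono, use step in eventually_elim)
    fix k
    assume st: "D.\<sigma> k > 0 \<and> r k < N k \<and> 1 / (real (N k) * D.\<sigma> k) \<le> \<delta> k \<and>
     T k \<le> 2 * sqrt (S k * \<delta> k) + S k"
    have "spike (A k) (r k) \<in> sobolev_ball m C"
    proof (rule spike_sobolev_ball[OF m r0])
      show "(A k)\<^sup>2 * (2 * pi * real (r k)) ^ (2 * m) \<le> C"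
        using C r0[of k] by (simp add: A_def power_divide power_even_eq)
    qed
    moreover have "\<beta> k * separation_rate m (N k) \<le> L2norm (spike (A k) (r k))"
      using L2norm_spike[OF r0, of "A k" k] A0[of k] sep0[of k] by (simp add: \<beta>_def)
    ultimately have "?inf k
       \<le> ereal (rejection_prob M (e k) m (s k) (n k) (lam k) \<alpha> (spike (A k) (r k)))"
      by (intro INF_lower) auto
    also have "\<dots> = ereal (prob {\<omega> \<in> space M. quantile std_normal_distribution (1 - \<alpha> / 2) \<le> \<bar>X k \<omega>\<bar>})"
      unfolding X_def using D.rejection_prob_spike[of k "r k" \<alpha> "A k"] st r0[of k] by (simp add: N_eq)
    finally show "?inf k
       \<le> ereal (prob {\<omega> \<in> space M. quantile std_normal_distribution (1 - \<alpha> / 2) \<le> \<bar>X k \<omega>\<bar>})" .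
  qed
  also have "\<dots> \<le> ereal \<alpha>"
    by (rule two_sided_rejection_limsup[OF assms(3,4) _ char])
       (simp add: X_def D.normalized_spike_stat_measurable)
  finally show ?thesis
    using \<beta>_top A0 sep0 by (intro exI[of _ \<beta>]) (auto simp: \<beta>_def)
qed

end
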